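(* Assume that $f_{ij}$ is convex and $L$-smooth for all $i=1,\dots,n$, $j=1,\dots,m$ and $f$ is $\mu$-quasi strongly convex, $\mu\ge0$. Consider D-LSVRG-DIANA with delay $\tau\ge1$, $p\in(0,1)$, $0<\alpha\le\frac1{\omega+1}$ and $$0<\gamma\le\min\left\{\frac1{8L\left(\frac{37}9+\frac{24\omega}{3n}\right)},\ \frac1{8L\sqrt{\tau\left(2+\tau+\frac4{1-p}+\frac{4\omega}n\left(1+\frac3{1-\alpha}+\frac2{1-p}+\frac4{(1-\alpha)(1-p)}\right)\right)}}\right\}.$$ Then D-LSVRG-DIANA satisfies the parametric assumption of the context with $A'=2L\left(1+\frac{2\omega}n\right)$, $B_1'=\frac{2\omega}n$, $B_2'=2\left(1+\frac{2\omega}n\right)$, $D_1'=0$, $$\sigma_{1,k}^2=\frac1n\sum_{i=1}^n\|h_i^k-\nabla f_i(x^* )\|^2,\qquad\sigma_{2,k}^2=\frac1{nm}\sum_{i=1}^n\sum_{j=1}^m\|\nabla f_{ij}(w_i^k)-\nabla f_{ij}(x^* )\|^2,$$ $\rho_1=\alpha$, $\rho_2=p$, $C_1=3L\alpha$, $C_2=Lp$, $D_2=0$, $G=2$, $$F_1=\frac{12\gamma^2L\omega\tau(2+\alpha)}{n\alpha},\quad F_2=\frac{12\gamma^2\tau L(2+p)}p\left(\frac{4\omega}{n(1-\alpha)}+1+\frac{2\omega}n\right),\quad D_3=0.$$ Moreover, with $M_1=\frac{8\omega}{3n\alpha}$, $M_2=\frac{8(7+\frac{6\omega}n)}{9p}$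 and $T^k=\|\tilde x^k-x^*\|^2+M_1\gamma^2\sigma_{1,k}^2+M_2\gamma^2\sigma_{2,k}^2$, where $\tilde x^k=x^k-e^k$ (so $\tilde x^0=x^0$), for all $K\ge0$ $$\mathbf E[f(\bar x^K)-f(x^* )]\le\left(1-\min\left\{\frac{\gamma\mu}2,\frac\alpha4,\frac p4\right\}\right)^K\frac{4(T^0+\gamma F_1\sigma_{1,0}^2+\gamma F_2\sigma_{2,0}^2)}\gamma$$ when $\mu>0$, and $$\mathbf E[f(\bar x^K)-f(x^* )]\le\frac{4(T^0+\gamma F_1\sigma_{1,0}^2+\gamma F_2\sigma_{2,0}^2)}{\gamma K}$$ when $\mu=0$ (right-hand side read as $+\infty$ for $K=0$).
   Context: $f(x)=\frac1n\sum_{i=1}^nf_i(x)$, $f_i(x)=\frac1m\sum_{j=1}^mf_{ij}(x)$ on $\mathbb R^d$. A function is $L$-smooth if it is differentiable with $L$-Lipschitz gradient. $f$ is $\mu$-quasi strongly convex if it has a unique minimizer $x^*$ and $f(x^* )\ge f(x)+\langle\nabla f(x),x^*-x\rangle+\frac\mu2\|x-x^*\|^2$ for all $x$. $Q$ is a randomized quantization operator with $\mathbf E[Q(x)]=x$, $\mathbf E\|Q(x)-x\|^2\le\omega\|x\|^2$ for all $x$, $\omega>0$. All random choices use fresh independent randomness. Delayed framework with integer delay $\tau\ge1$: $x^{k+1}=x^k-\frac1n\sum_iv_i^k$, where $v_i^k=\gamma g_i^{k-\tau}$ if $k\ge\tau$ and $v_i^k=0$ if $k<\tau$; $e_i^{k+1}=e_i^k+\gamma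 g_i^k-v_i^k$, $e_i^0=0$; $x^0\in\mathbb R^d$ is the initial vector. Here $g_i^k$ is the stochastic vector associated with the point $x^k$. D-LSVRG-DIANA: given initial vectors $h_i^0,w_i^0\in\mathbb R^d$; for $k\ge0$ worker $i$ picks $l$ uniformly from $\{1,\dots,m\}$, sets $\hat g_i^k=\nabla f_{il}(x^k)-\nabla f_{il}(w_i^k)+\nabla f_i(w_i^k)$, $\hat\Delta_i^k=Q(\hat g_i^k-h_i^k)$ (quantization performed independently from other workers), $g_i^k=h_i^k+\hat\Delta_i^k$, $h_i^{k+1}=h_i^k+\alpha\hat\Delta_i^k$, and $w_i^{k+1}=x^k$ with probability $p$, $w_i^{k+1}=w_i^k$ with probability $1-p$. Parametric assumption: let $g^k=\frac1n\sum_ig_i^k$, $e^k=\frac1n\sum_ie_i^k$, $\mathbf E_k$ the conditional expectation given $x^k$ and all randomness used to generate $g_i^t,h_i^{t+1},w_i^{t+1}$ for $t<k$. For all $k,K\ge0$: $\mathbf E_k[g^k]=\nabla f(x^k)$; $\mathbf E_k\|g^k\|^2\le2A'(f(x^k)-f(x^* ))+B_1'\sigma_{1,k}^2+B_2'\sigma_{2,k}^2+D_1'$; $\mathbf E_k[\sigma_{1,k+1}^2]\le(1-\rho_1)\sigma_{1,k}^2+2C_1(f(x^k)-f(x^* ))+G\rho_1\sigma_{2,k}^2+D_2$; $\mathbf E_k[\sigma_{2,k+1}^2]\le(1-\rho_2)\sigma_{2,k}^2+2C_2(f(x^k)-f(x^* ))$; $3L\sum_{k=0}^Kw_k\mathbf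 E\|e^k\|^2\le\frac14\sum_{k=0}^Kw_k\mathbf E[f(x^k)-f(x^* )]+F_1\sigma_{1,0}^2+F_2\sigma_{2,0}^2+\gamma D_3W_K$, where (scalar weights) $w_k=(1-\eta)^{-(k+1)}$, $W_K=\sum_{k=0}^Kw_k$, $\eta=\min\{\frac{\gamma\mu}2,\frac{\rho_1}4,\frac{\rho_2}4\}$. Also $\bar x^K=\frac1{W_K}\sum_{k=0}^Kw_kx^k$. *)

theory Defs
  imports "HOL-Probability.Probability"
begin

section \<open>Smoothness and quasi strong convexity\<close>

definition grad :: "('a::euclidean_space \<Rightarrow> real) \<Rightarrow> 'a \<Rightarrow> 'a" where
  "grad f y = (THE D. GDERIV f y :> D)"

definition smooth :: "real \<Rightarrow> ('a::euclidean_space \<Rightarrow> real) \<Rightarrow> bool" where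
  "smooth L f \<longleftrightarrow> (\<forall>y. f differentiable (at y)) \<and> L-lipschitz_on UNIV (grad f)"

text \<open>The first conjunct says that \<open>xs\<close> is the unique minimizer of \<open>f\<close>.\<close>

definition quasi_strongly_convex ::
    "real \<Rightarrow> ('a::euclidean_space \<Rightarrow> real) \<Rightarrow> 'a \<Rightarrow> bool" where
  "quasi_strongly_convex \<mu> f xs \<longleftrightarrow>
     (\<forall>y. is_arg_min f (\<lambda>_. True) y \<longleftrightarrow> y = xs) \<and>
     (\<forall>y. f xs \<ge> f y + grad f y \<bullet> (xs - y) + \<mu> / 2 * (norm (y - xs))\<^sup>2)"

definition worker_loss :: "nat \<Rightarrow> (nat \<Rightarrow> nat \<Rightarrow> 'a \<Rightarrow> real) \<Rightarrow> nat \<Rightarrow> 'a \<Rightarrow> real" where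
  "worker_loss m f i y = (1 / real m) * (\<Sum>j<m. f i j y)"

definition total_loss :: "nat \<Rightarrow> nat \<Rightarrow> (nat \<Rightarrow> nat \<Rightarrow> 'a \<Rightarrow> real) \<Rightarrow> 'a \<Rightarrow> real" where
  "total_loss n m f y = (1 / real n) * (\<Sum>i<n. worker_loss m f i y)"

definition worker_mean :: "nat \<Rightarrow> (nat \<Rightarrow> 'a::real_vector) \<Rightarrow> 'a" where
  "worker_mean n v = (1 / real n) *\<^sub>R (\<Sum>i<n. v i)"


section \<open>Sources of randomness\<close>

text \<open>A randomized operator is a map \<open>Q s y\<close> of a random seed \<open>s\<close>, drawn from the probability
  measure \<open>N\<close>, and the vector \<open>y\<close>.  Joint measurability is what makes \<open>Q\<close> applicable to random
  vectors.\<close>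

definition quantizer ::
    "'s measure \<Rightarrow> real \<Rightarrow> ('s \<Rightarrow> 'a::euclidean_space \<Rightarrow> 'a) \<Rightarrow> bool" where
  "quantizer N \<omega> Q \<longleftrightarrow>
     prob_space N \<and>
     (\<lambda>(s, y). Q s y) \<in> borel_measurable (N \<Otimes>\<^sub>M borel) \<and>
     (\<forall>y. integrable N (\<lambda>s. Q s y) \<and> (\<integral>s. Q s y \<partial>N) = y \<and>
          integrable N (\<lambda>s. (norm (Q s y - y))\<^sup>2) \<and>
          (\<integral>s. (norm (Q s y - y))\<^sup>2 \<partial>N) \<le> \<omega> * (norm y)\<^sup>2)"

text \<open>In iteration \<open>k\<close> worker \<open>i\<close> uses a summand index \<open>l k i\<close>, a quantization seed \<open>s k i\<close> and
  a coin \<open>c k i\<close> deciding whether the reference point is renewed.\<close>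

definition draw ::
    "(nat \<Rightarrow> nat \<Rightarrow> 'w \<Rightarrow> nat) \<Rightarrow> (nat \<Rightarrow> nat \<Rightarrow> 'w \<Rightarrow> 's) \<Rightarrow> (nat \<Rightarrow> nat \<Rightarrow> 'w \<Rightarrow> bool) \<Rightarrow>
     nat \<Rightarrow> nat \<Rightarrow> 'w \<Rightarrow> nat \<times> 's \<times> bool" where
  "draw l s c k i z = (l k i z, s k i z, c k i z)"

definition draw_space :: "'s measure \<Rightarrow> (nat \<times> 's \<times> bool) measure" where
  "draw_space N = count_space UNIV \<Otimes>\<^sub>M N \<Otimes>\<^sub>M count_space UNIV"

text \<open>All draws are mutually independent: across iterations and workers by the first conjunct,
  within one draw because its law is a product.\<close>

definition fresh_draws ::
    "'w measure \<Rightarrow> 's measure \<Rightarrow> nat \<Rightarrow> nat \<Rightarrow> real \<Rightarrow>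
     (nat \<Rightarrow> nat \<Rightarrow> 'w \<Rightarrow> nat) \<Rightarrow> (nat \<Rightarrow> nat \<Rightarrow> 'w \<Rightarrow> 's) \<Rightarrow> (nat \<Rightarrow> nat \<Rightarrow> 'w \<Rightarrow> bool) \<Rightarrow> bool" where
  "fresh_draws M N n m p l s c \<longleftrightarrow>
     prob_space.indep_vars M (\<lambda>_. draw_space N) (\<lambda>(k, i). draw l s c k i) (UNIV \<times> {..<n}) \<and>
     (\<forall>k. \<forall>i<n. distr M (draw_space N) (draw l s c k i) =
        measure_pmf (pmf_of_set {..<m}) \<Otimes>\<^sub>M N \<Otimes>\<^sub>M measure_pmf (bernoulli_pmf p))"


section \<open>The algorithm, along one sample path\<close>

definition delayed_step :: "real \<Rightarrow> nat \<Rightarrow> (nat \<Rightarrow> nat \<Rightarrow> 'a) \<Rightarrow> nat \<Rightarrow> nat \<Rightarrow> 'a::real_vector" where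
  "delayed_step \<gamma> \<tau> g k i = (if k \<ge> \<tau> then \<gamma> *\<^sub>R g (k - \<tau>) i else 0)"

definition delayed_framework ::
    "nat \<Rightarrow> real \<Rightarrow> nat \<Rightarrow> 'a::real_vector \<Rightarrow>
     (nat \<Rightarrow> 'a) \<Rightarrow> (nat \<Rightarrow> nat \<Rightarrow> 'a) \<Rightarrow> (nat \<Rightarrow> nat \<Rightarrow> 'a) \<Rightarrow> bool" where
  "delayed_framework n \<gamma> \<tau> x0 x g e \<longleftrightarrow>
     x 0 = x0 \<and> (\<forall>i<n. e 0 i = 0) \<and>
     (\<forall>k. x (Suc k) = x k - worker_mean n (delayed_step \<gamma> \<tau> g k)) \<and>
     (\<forall>k. \<forall>i<n. e (Suc k) i = e k i + \<gamma> *\<^sub>R g k i - delayed_step \<gamma> \<tau> g k i)"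

definition lsvrg_diana ::
    "nat \<Rightarrow> nat \<Rightarrow> (nat \<Rightarrow> nat \<Rightarrow> 'a::euclidean_space \<Rightarrow> real) \<Rightarrow> ('s \<Rightarrow> 'a \<Rightarrow> 'a) \<Rightarrow> real \<Rightarrow>
     (nat \<Rightarrow> 'a) \<Rightarrow> (nat \<Rightarrow> 'a) \<Rightarrow>
     (nat \<Rightarrow> nat \<Rightarrow> nat) \<Rightarrow> (nat \<Rightarrow> nat \<Rightarrow> 's) \<Rightarrow> (nat \<Rightarrow> nat \<Rightarrow> bool) \<Rightarrow>
     (nat \<Rightarrow> 'a) \<Rightarrow> (nat \<Rightarrow> nat \<Rightarrow> 'a) \<Rightarrow> (nat \<Rightarrow> nat \<Rightarrow> 'a) \<Rightarrow> (nat \<Rightarrow> nat \<Rightarrow> 'a) \<Rightarrow> bool" where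
  "lsvrg_diana n m f Q \<alpha> h0 w0 l s c x h w g \<longleftrightarrow>
     (\<forall>i<n. h 0 i = h0 i \<and> w 0 i = w0 i) \<and>
     (\<forall>k. \<forall>i<n.
        let g_hat = grad (f i (l k i)) (x k) - grad (f i (l k i)) (w k i)
                      + grad (worker_loss m f i) (w k i);
            \<Delta>_hat = Q (s k i) (g_hat - h k i)
        in g k i = h k i + \<Delta>_hat \<and>
           h (Suc k) i = h k i + \<alpha> *\<^sub>R \<Delta>_hat \<and>
           w (Suc k) i = (if c k i then x k else w k i))"


section \<open>The parametric assumption\<close>

text \<open>The \<open>\<sigma>\<close>-algebra generated by \<open>x\<^sup>k\<close> and all draws made before iteration \<open>k\<close>.\<close>

definition past ::
    "'w measure \<Rightarrow> 's measure \<Rightarrow> nat \<Rightarrow>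
     (nat \<Rightarrow> nat \<Rightarrow> 'w \<Rightarrow> nat) \<Rightarrow> (nat \<Rightarrow> nat \<Rightarrow> 'w \<Rightarrow> 's) \<Rightarrow> (nat \<Rightarrow> nat \<Rightarrow> 'w \<Rightarrow> bool) \<Rightarrow>
     (nat \<Rightarrow> 'w \<Rightarrow> 'a::euclidean_space) \<Rightarrow> nat \<Rightarrow> 'w measure" where
  "past M N n l s c x k = sigma (space M)
     ({x k -` A \<inter> space M | A. A \<in> sets borel} \<union>
      (\<Union>t\<in>{..<k}. \<Union>i\<in>{..<n}. {draw l s c t i -` A \<inter> space M | A. A \<in> sets (draw_space N)}))"

definition vector_cond_exp ::
    "'w measure \<Rightarrow> 'w measure \<Rightarrow> ('w \<Rightarrow> 'a::euclidean_space) \<Rightarrow> 'w \<Rightarrow> 'a" where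
  "vector_cond_exp M F X z = (\<Sum>b\<in>Basis. real_cond_exp M F (\<lambda>z. X z \<bullet> b) z *\<^sub>R b)"

definition rate :: "real \<Rightarrow> real \<Rightarrow> real \<Rightarrow> real \<Rightarrow> real" where
  "rate \<gamma> \<mu> \<rho>1 \<rho>2 = min (\<gamma> * \<mu> / 2) (min (\<rho>1 / 4) (\<rho>2 / 4))"

definition weight :: "real \<Rightarrow> nat \<Rightarrow> real" where
  "weight \<eta> k = 1 / (1 - \<eta>) ^ (k + 1)"

definition total_weight :: "real \<Rightarrow> nat \<Rightarrow> real" where
  "total_weight \<eta> K = (\<Sum>k\<le>K. weight \<eta> k)"

definition weighted_average :: "real \<Rightarrow> (nat \<Rightarrow> 'a::real_vector) \<Rightarrow> nat \<Rightarrow> 'a" where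
  "weighted_average \<eta> x K = (1 / total_weight \<eta> K) *\<^sub>R (\<Sum>k\<le>K. weight \<eta> k *\<^sub>R x k)"

record parameters =
  par_A :: real
  par_B1 :: real
  par_B2 :: real
  par_D1 :: real
  par_rho1 :: real
  par_C1 :: real
  par_G :: real
  par_D2 :: real
  par_rho2 :: real
  par_C2 :: real
  par_F1 :: real
  par_F2 :: real
  par_D3 :: real

text \<open>\<open>s1\<close> and \<open>s2\<close> stand for the processes \<open>\<sigma>\<^sub>1\<^sup>2\<close> and \<open>\<sigma>\<^sub>2\<^sup>2\<close> (already squared), \<open>g\<close> and \<open>e\<close> for
  the averages over the workers, \<open>F k\<close> for the information conditioned on in iteration \<open>k\<close>.
  Integrability is required explicitly, since \<open>integral\<^sup>L\<close> and \<open>real_cond_exp\<close> return unspecified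
  or default values on functions that are not integrable.  The last inequality is pointwise in
  \<open>z\<close> only because \<open>s1 0\<close> and \<open>s2 0\<close> formally depend on \<open>z\<close>; with deterministic initial vectors
  they are constant.\<close>

definition parametric_assumption ::
    "'w measure \<Rightarrow> (nat \<Rightarrow> 'w measure) \<Rightarrow> ('a::euclidean_space \<Rightarrow> real) \<Rightarrow> 'a \<Rightarrow>
     real \<Rightarrow> real \<Rightarrow> real \<Rightarrow>
     (nat \<Rightarrow> 'w \<Rightarrow> 'a) \<Rightarrow> (nat \<Rightarrow> 'w \<Rightarrow> 'a) \<Rightarrow> (nat \<Rightarrow> 'w \<Rightarrow> 'a) \<Rightarrow>
     (nat \<Rightarrow> 'w \<Rightarrow> real) \<Rightarrow> (nat \<Rightarrow> 'w \<Rightarrow> real) \<Rightarrow> parameters \<Rightarrow> bool" where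
  "parametric_assumption M F f xs L \<mu> \<gamma> x g e s1 s2 P \<longleftrightarrow>
     (\<forall>k. integrable M (\<lambda>z. f (x k z) - f xs) \<and>
          integrable M (g k) \<and> integrable M (\<lambda>z. (norm (g k z))\<^sup>2) \<and>
          integrable M (s1 k) \<and> integrable M (s2 k) \<and>
          integrable M (\<lambda>z. (norm (e k z))\<^sup>2)) \<and>
     (\<forall>k. AE z in M. vector_cond_exp M (F k) (g k) z = grad f (x k z)) \<and>
     (\<forall>k. AE z in M. real_cond_exp M (F k) (\<lambda>z. (norm (g k z))\<^sup>2) z
        \<le> 2 * par_A P * (f (x k z) - f xs) + par_B1 P * s1 k z + par_B2 P * s2 k z + par_D1 P) \<and>
     (\<forall>k. AE z in M. real_cond_exp M (F k) (s1 (Suc k)) z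
        \<le> (1 - par_rho1 P) * s1 k z + 2 * par_C1 P * (f (x k z) - f xs)
            + par_G P * par_rho1 P * s2 k z + par_D2 P) \<and>
     (\<forall>k. AE z in M. real_cond_exp M (F k) (s2 (Suc k)) z
        \<le> (1 - par_rho2 P) * s2 k z + 2 * par_C2 P * (f (x k z) - f xs)) \<and>
     (let \<eta> = rate \<gamma> \<mu> (par_rho1 P) (par_rho2 P) in
      \<forall>K. \<forall>z\<in>space M.
        3 * L * (\<Sum>k\<le>K. weight \<eta> k * (\<integral>y. (norm (e k y))\<^sup>2 \<partial>M))
        \<le> 1 / 4 * (\<Sum>k\<le>K. weight \<eta> k * (\<integral>y. f (x k y) - f xs \<partial>M))
            + par_F1 P * s1 0 z + par_F2 P * s2 0 z + \<gamma> * par_D3 P * total_weight \<eta> K)"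

end

theory Submission
  imports Defs
begin

text \<open>
  The analysis follows the virtual iterate, the point minus the averaged error.  The error collects
  the stochastic vectors that have been computed but not yet applied (\<open>ebar_eq\<close>), so the virtual
  iterate makes undelayed steps (\<open>virtual_Suc\<close>), and the delay only shows in the gradient being taken
  at a point that differs from the virtual one by the error.

  Randomness is removed in two moves.  Conditioning on the past is integration over the fresh draws
  (\<open>cond_exp_independent\<close>), and one quantized step has an explicit mean and variance
  (\<open>quantized_moments\<close>).  The noise of a worker has mean zero even when every other draw of the same
  iteration is known; hence all noises, across workers and across iterations, are pairwise orthogonal
  (\<open>noise_orthogonal\<close>, \<open>noise_bar_variance\<close>, \<open>noise_bar_sum\<close>).  What remains are pointwise inequalities
  between the suboptimality and the distances of gradients from their values at the minimizer.  They
  rest on convexity and smoothness of the summands (\<open>gradient_gap_le_bregman\<close>, \<open>mean_gap_le_subopt\<close>)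
  and on Young's inequality (\<open>mean_estimate_var_le\<close>, \<open>shift_gap_le\<close>), and they give the bounds
  on conditional expectations (\<open>gbar_bound\<close>, \<open>sig1_bound\<close>, \<open>sig2_bound\<close>).

  After taking expectations the rest concerns real sequences.  The error is a sum over a window of
  length \<open>\<tau>\<close>, so its weighted sum is bounded by weighted sums of the suboptimality and of both \<open>\<sigma>\<close>
  processes (\<open>error_mean_le\<close>, \<open>weighted_delay\<close>); the latter contract and are controlled by the
  suboptimality again (\<open>weighted_contraction\<close>), and the step size makes the resulting factor at most
  1/4 (\<open>weighted_error\<close>).  A Lyapunov function for the virtual iterate then yields the rates
  (\<open>lyapunov_step\<close>, \<open>weighted_subopt\<close>, \<open>subopt_average_le\<close>).

  The Lyapunov function is not the function \<open>T\<close> of the theorem.  Combining \<open>T\<close> with the bounds on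
  conditional expectations in the form in which the theorem states them gives a contraction of the
  \<open>\<sigma>\<^sub>2\<close> part only for \<open>\<omega> \<le> n / 2\<close>.  For larger \<open>\<omega>\<close> sharper inequalities are used: the variance of the
  gradient estimator is bounded after centering, and Young's inequality is applied with unequal weights
  (\<open>second_order_terms\<close>).  The resulting Lyapunov function has other weights than \<open>T\<close>, and it descends
  faster than the claim requires; the surplus makes up for the difference of the weights.
\<close>

section \<open>Gradients\<close>

lemma GDERIV_unique:
  assumes "GDERIV f y :> D" "GDERIV f y :> D'"
  shows "D = D'"
proof -
  have "(\<lambda>h. h \<bullet> D) = (\<lambda>h. h \<bullet> D')"
    using assms unfolding gderiv_def by (rule has_derivative_unique)
  then have "(D - D') \<bullet> D = (D - D') \<bullet> D'" by (rule fun_cong)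
  then have "(D - D') \<bullet> (D - D') = 0" by (simp add: inner_diff_right)
  then show ?thesis by simp
qed

lemma grad_eqI: "GDERIV f y :> D \<Longrightarrow> grad f y = D"
  unfolding grad_def by (blast intro: GDERIV_unique)

lemma GDERIV_grad:
  fixes f :: "'a::euclidean_space \<Rightarrow> real"
  assumes "f differentiable (at y)"
  shows "GDERIV f y :> grad f y"
proof -
  obtain f' where f': "(f has_derivative f') (at y)" using assms by (auto simp: differentiable_def)
  interpret bounded_linear f' using f' by (rule has_derivative_bounded_linear)
  have "f' h = h \<bullet> (\<Sum>b\<in>Basis. f' b *\<^sub>R b)" for h
  proof -
    have "f' h = f' (\<Sum>b\<in>Basis. (h \<bullet> b) *\<^sub>R b)" by (simp add: euclidean_representation)
    also have "\<dots> = (\<Sum>b\<in>Basis. (h \<bullet> b) * f' b)" by (simp add: sum scaleR)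
    finally show ?thesis by (simp add: inner_sum_right mult.commute)
  qed
  then have "f' = (\<lambda>h. h \<bullet> (\<Sum>b\<in>Basis. f' b *\<^sub>R b))" by (rule ext)
  then have D: "GDERIV f y :> (\<Sum>b\<in>Basis. f' b *\<^sub>R b)" using f' unfolding gderiv_def by simp
  show ?thesis using D unfolding grad_eqI[OF D] .
qed

lemma GDERIV_scaled_sum:
  fixes F :: "'i \<Rightarrow> 'a::euclidean_space \<Rightarrow> real"
  assumes "\<And>i. i \<in> I \<Longrightarrow> GDERIV (F i) y :> D i"
  shows "GDERIV (\<lambda>y. c * (\<Sum>i\<in>I. F i y)) y :> c *\<^sub>R (\<Sum>i\<in>I. D i)"
proof -
  have "((\<lambda>y. c * (\<Sum>i\<in>I. F i y)) has_derivative (\<lambda>h. c * (\<Sum>i\<in>I. h \<bullet> D i))) (at y)"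
    using assms unfolding gderiv_def
    by (intro has_derivative_mult_right has_derivative_sum) auto
  then show ?thesis unfolding gderiv_def by (simp add: inner_sum_right)
qed

lemma smooth_GDERIV: "smooth L f \<Longrightarrow> GDERIV f y :> grad f y"
  unfolding smooth_def by (blast intro: GDERIV_grad)

lemma smooth_lipschitz: "smooth L f \<Longrightarrow> norm (grad f y - grad f z) \<le> L * norm (y - z)"
  unfolding smooth_def lipschitz_on_def by (simp add: dist_norm)

lemma GDERIV_along_line:
  fixes f :: "'a::euclidean_space \<Rightarrow> real"
  assumes "GDERIV f (y + t *\<^sub>R d) :> D"
  shows "((\<lambda>t. f (y + t *\<^sub>R d)) has_real_derivative d \<bullet> D) (at t)"
proof -
  have "((\<lambda>t. y + t *\<^sub>R d) has_derivative (\<lambda>h. h *\<^sub>R d)) (at t)"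
    by (auto intro!: derivative_eq_intros)
  then have "((\<lambda>t. f (y + t *\<^sub>R d)) has_derivative (\<lambda>h. (h *\<^sub>R d) \<bullet> D)) (at t)"
    using assms unfolding gderiv_def by (rule has_derivative_compose)
  then show ?thesis by (simp add: has_field_derivative_def mult_commute_abs)
qed

lemma GDERIV_minimum:
  assumes "GDERIV f y :> D" "\<And>z. f y \<le> f z"
  shows "D = 0"
proof -
  have "(\<lambda>h. h \<bullet> D) = (\<lambda>h. 0)"
    using assms unfolding gderiv_def by (rule_tac has_derivative_local_min) auto
  then show ?thesis by (metis inner_eq_zero_iff)
qed

lemma descent_lemma:
  fixes f :: "'a::euclidean_space \<Rightarrow> real"
  assumes "smooth L f"
  shows "f z \<le> f y + grad f y \<bullet> (z - y) + L / 2 * (norm (z - y))\<^sup>2"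
proof -
  define d where "d = z - y"
  define u where "u t = f (y + t *\<^sub>R d) - t * (grad f y \<bullet> d) - L / 2 * t\<^sup>2 * (norm d)\<^sup>2" for t
  have der: "(u has_real_derivative
      (d \<bullet> grad f (y + t *\<^sub>R d) - grad f y \<bullet> d - L * t * (norm d)\<^sup>2)) (at t)" for t
    unfolding u_def
    by (auto intro!: derivative_eq_intros GDERIV_along_line[OF smooth_GDERIV[OF assms]])
  have "u 1 \<le> u 0"
  proof (rule DERIV_nonpos_imp_nonincreasing[of 0 1 u])
    fix t :: real assume t: "0 \<le> t" "t \<le> 1"
    have "d \<bullet> (grad f (y + t *\<^sub>R d) - grad f y) \<le> norm d * norm (grad f (y + t *\<^sub>R d) - grad f y)"
      by (rule norm_cauchy_schwarz)
    also have "\<dots> \<le> norm d * (L * norm (t *\<^sub>R d))"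
      using smooth_lipschitz[OF assms, of "y + t *\<^sub>R d" y] by (intro mult_left_mono) auto
    also have "\<dots> = L * t * (norm d)\<^sup>2" using t by (simp add: power2_eq_square)
    finally have "d \<bullet> grad f (y + t *\<^sub>R d) - grad f y \<bullet> d - L * t * (norm d)\<^sup>2 \<le> 0"
      by (simp add: inner_diff_right inner_commute)
    then show "\<exists>v. (u has_real_derivative v) (at t) \<and> v \<le> 0" using der by blast
  qed simp
  then show ?thesis by (simp add: u_def d_def)
qed

lemma convex_above_tangent:
  fixes f :: "'a::euclidean_space \<Rightarrow> real"
  assumes "convex_on UNIV f" "GDERIV f y :> D"
  shows "f y + D \<bullet> (z - y) \<le> f z"
proof -
  define v where "v t = f (y + t *\<^sub>R (z - y))" for t :: real
  have "convex_on UNIV v"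
  proof (rule convex_onI)
    fix t a b :: real assume t: "0 < t" "t < 1"
    have "y + ((1 - t) *\<^sub>R a + t *\<^sub>R b) *\<^sub>R (z - y)
        = (1 - t) *\<^sub>R (y + a *\<^sub>R (z - y)) + t *\<^sub>R (y + b *\<^sub>R (z - y))"
      by (simp add: algebra_simps)
    then show "v ((1 - t) *\<^sub>R a + t *\<^sub>R b) \<le> (1 - t) * v a + t * v b"
      unfolding v_def using convex_onD[OF assms(1), of t] t by (metis UNIV_I less_eq_real_def)
  qed simp
  moreover have "(v has_real_derivative (z - y) \<bullet> D) (at 0)"
    unfolding v_def using assms(2) by (intro GDERIV_along_line) simp
  ultimately have "v 1 - v 0 \<ge> ((z - y) \<bullet> D) * (1 - 0)"
    by (intro convex_on_imp_above_tangent[where A = UNIV]) auto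
  then show ?thesis by (simp add: v_def inner_commute)
qed

text \<open>Subtracting the tangent at \<open>z\<close> makes \<open>z\<close> a minimizer; one gradient step of length \<open>1 / L\<close>
  from \<open>y\<close> cannot undercut that minimum.\<close>

lemma gradient_gap_le_bregman:
  fixes f :: "'a::euclidean_space \<Rightarrow> real"
  assumes cv: "convex_on UNIV f" and sm: "smooth L f" and L: "L > 0"
  shows "(norm (grad f y - grad f z))\<^sup>2 \<le> 2 * L * (f y - f z - grad f z \<bullet> (y - z))"
proof -
  define v where "v = grad f y - grad f z"
  define q where "q = y - (1 / L) *\<^sub>R v"
  have 1: "f q \<le> f y - (1 / L) * (grad f y \<bullet> v) + (norm v)\<^sup>2 / (2 * L)"
    using descent_lemma[OF sm, of q y] L
    by (simp add: q_def power_mult_distrib power2_eq_square field_simps)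
  have 2: "f z + grad f z \<bullet> (q - z) \<le> f q"
    using convex_above_tangent[OF cv smooth_GDERIV[OF sm]] .
  have 3: "grad f z \<bullet> (q - z) = grad f z \<bullet> (y - z) - (1 / L) * (grad f z \<bullet> v)"
    by (simp add: q_def inner_diff_right)
  have 4: "grad f y \<bullet> v - grad f z \<bullet> v = (norm v)\<^sup>2"
    by (simp add: v_def power2_norm_eq_inner inner_diff_left)
  have "f z + grad f z \<bullet> (y - z) \<le> f y - (1 / L) * (grad f y \<bullet> v - grad f z \<bullet> v) + (norm v)\<^sup>2 / (2 * L)"
    using 1 2 unfolding 3 by (simp add: right_diff_distrib)
  then have "(norm v)\<^sup>2 / (2 * L) \<le> f y - f z - grad f z \<bullet> (y - z)"
    unfolding 4 using L by (simp add: field_simps)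
  then show ?thesis using L by (simp add: v_def field_simps)
qed

lemma gderiv_strict:
  fixes f :: "'a::euclidean_space \<Rightarrow> real"
  assumes "GDERIV f x :> D" "e > 0"
  shows "\<exists>d>0. \<forall>y\<in>ball x d. \<forall>z\<in>ball x d.
     \<bar>f y - f z - D \<bullet> (y - z)\<bar> \<le> e * (norm (y - x) + norm (z - x))"
proof -
  obtain d where d: "d > 0" "\<And>y. norm (y - x) < d \<Longrightarrow>
      norm (f y - f x - (y - x) \<bullet> D) \<le> e * norm (y - x)"
    using assms unfolding gderiv_def has_derivative_at_alt by blast
  have "\<bar>f y - f z - D \<bullet> (y - z)\<bar> \<le> e * (norm (y - x) + norm (z - x))"
    if "y \<in> ball x d" "z \<in> ball x d" for y z
    using d(2)[of y] d(2)[of z] that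
    by (simp add: dist_norm norm_minus_commute inner_diff_left inner_diff_right inner_commute
        distrib_left)
  then show ?thesis using d(1) by blast
qed

text \<open>The gradient of an arbitrary function is Borel measurable.  This keeps the iterates measurable
  on the null set where a drawn summand index falls outside \<open>{..<m}\<close>, where nothing is known about
  the summand.  The usual difference quotients would inherit non-measurability from \<open>f\<close>; with two
  moving points next to the base point \<open>x\<close> the approximation property becomes closed in \<open>x\<close>,
  because for a fixed pair of moving points \<open>x\<close> enters only through continuous terms.\<close>

definition two_point_set :: "('a::euclidean_space \<Rightarrow> real) \<Rightarrow> 'a \<Rightarrow> real \<Rightarrow> real \<Rightarrow> real \<Rightarrow> 'a set" where
  "two_point_set f A r e d = {x. \<forall>y\<in>ball x d. \<forall>z\<in>ball x d.
     \<bar>f y - f z - A \<bullet> (y - z)\<bar> \<le> r * norm (y - z) + e * (norm (y - x) + norm (z - x))}"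

lemma closed_two_point_set: "closed (two_point_set f A r e d)"
  unfolding closed_sequential_limits
proof safe
  fix X l assume X: "\<forall>n. X n \<in> two_point_set f A r e d" "X \<longlonglongrightarrow> l"
  show "l \<in> two_point_set f A r e d"
    unfolding two_point_set_def
  proof safe
    fix y z assume yz: "y \<in> ball l d" "z \<in> ball l d"
    have "\<forall>\<^sub>F n in sequentially. dist (X n) y < d" "\<forall>\<^sub>F n in sequentially. dist (X n) z < d"
      using yz X(2) by (auto intro!: order_tendstoD(2) tendsto_intros)
    then have "\<forall>\<^sub>F n in sequentially. \<bar>f y - f z - A \<bullet> (y - z)\<bar> \<le>
        r * norm (y - z) + e * (norm (y - X n) + norm (z - X n))"
      by eventually_elim (use X(1) in \<open>auto simp: two_point_set_def\<close>)
    moreover have "(\<lambda>n. r * norm (y - z) + e * (norm (y - X n) + norm (z - X n)))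
        \<longlonglongrightarrow> r * norm (y - z) + e * (norm (y - l) + norm (z - l))"
      using X(2) by (intro tendsto_intros)
    ultimately show "\<bar>f y - f z - A \<bullet> (y - z)\<bar> \<le> r * norm (y - z) + e * (norm (y - l) + norm (z - l))"
      by (rule_tac tendsto_lowerbound) auto
  qed
qed

lemma two_point_set_mono:
  assumes "e \<le> e'" "d' \<le> d" "r \<le> r'"
  shows "two_point_set f A r e d \<subseteq> two_point_set f A r' e' d'"
  unfolding two_point_set_def
proof safe
  fix x y z
  assume *: "\<forall>y\<in>ball x d. \<forall>z\<in>ball x d.
     \<bar>f y - f z - A \<bullet> (y - z)\<bar> \<le> r * norm (y - z) + e * (norm (y - x) + norm (z - x))"
    and "y \<in> ball x d'" "z \<in> ball x d'"
  then have "\<bar>f y - f z - A \<bullet> (y - z)\<bar> \<le> r * norm (y - z) + e * (norm (y - x) + norm (z - x))"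
    using assms by auto
  also have "\<dots> \<le> r' * norm (y - z) + e' * (norm (y - x) + norm (z - x))"
    using assms by (intro add_mono mult_right_mono) auto
  finally show "\<bar>f y - f z - A \<bullet> (y - z)\<bar> \<le> r' * norm (y - z) + e' * (norm (y - x) + norm (z - x))" .
qed

text \<open>Two linear approximations of \<open>f\<close> at the same point are compared in the direction of their
  difference.\<close>

lemma two_point_sets_close:
  assumes "x \<in> two_point_set f A r e d" "d > 0" and "x \<in> two_point_set f A' r' e' d'" "d' > 0"
    and nonneg: "0 \<le> r + e + r' + e'"
  shows "norm (A - A') \<le> r + e + r' + e'"
proof (cases "A = A'")
  case False
  define N where "N = norm (A - A')"
  define t where "t = min d d' / (2 * N)"
  define y where "y = x + t *\<^sub>R (A - A')"
  have N: "N > 0" using False by (simp add: N_def)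
  have t: "t > 0" using N assms(2,4) by (simp add: t_def)
  have ny: "norm (y - x) = t * N" using t by (simp add: y_def N_def)
  have "t * N < d" "t * N < d'" using N assms(2,4) by (auto simp: t_def min_def)
  then have yb: "y \<in> ball x d" "y \<in> ball x d'"
    using ny by (auto simp: dist_norm norm_minus_commute)
  have x: "x \<in> ball x d" "x \<in> ball x d'" using assms(2,4) by auto
  have 1: "\<bar>f y - f x - A \<bullet> (y - x)\<bar> \<le> r * norm (y - x) + e * (norm (y - x) + norm (x - x))"
    using assms(1) yb(1) x(1) unfolding two_point_set_def by blast
  have 2: "\<bar>f y - f x - A' \<bullet> (y - x)\<bar> \<le> r' * norm (y - x) + e' * (norm (y - x) + norm (x - x))"
    using assms(3) yb(2) x(2) unfolding two_point_set_def by blast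
  have "(A - A') \<bullet> (y - x) = t * N * N"
    by (simp add: y_def N_def power2_norm_eq_inner[symmetric] power2_eq_square)
  then have "t * N * N \<le> (r * (t * N) + e * (t * N)) + (r' * (t * N) + e' * (t * N))"
    using 1 2 unfolding ny inner_diff_left by simp
  then have "N * (t * N) \<le> (r + e + r' + e') * (t * N)" by (simp add: algebra_simps)
  then show ?thesis using t N by (simp add: N_def)
qed (use nonneg in simp)

text \<open>The points where \<open>f\<close> is approximated by \<open>A\<close> up to slope \<open>r\<close>; at points of differentiability
  this says that the gradient is within \<open>r\<close> of \<open>A\<close>.\<close>

definition grad_near :: "('a::euclidean_space \<Rightarrow> real) \<Rightarrow> 'a \<Rightarrow> real \<Rightarrow> 'a set" where
  "grad_near f A r = (\<Inter>i::nat. \<Union>j::nat. two_point_set f A r (1 / Suc i) (1 / Suc j))"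

lemma grad_near_borel: "grad_near f A r \<in> sets borel"
  unfolding grad_near_def
  by (intro sets.countable_INT'' sets.countable_UN borel_closed closed_two_point_set)
    (auto intro!: sets.countable_UN borel_closed closed_two_point_set)

lemma grad_near_iff: "x \<in> grad_near f A r \<longleftrightarrow> (\<forall>e>0. \<exists>d>0. x \<in> two_point_set f A r e d)"
proof
  assume *: "x \<in> grad_near f A r"
  show "\<forall>e>0. \<exists>d>0. x \<in> two_point_set f A r e d"
  proof safe
    fix e :: real assume "e > 0"
    then obtain i :: nat where i: "1 / Suc i < e" using nat_approx_posE by metis
    then obtain j :: nat where "x \<in> two_point_set f A r (1 / Suc i) (1 / Suc j)"
      using * by (auto simp: grad_near_def)
    then have "x \<in> two_point_set f A r e (1 / Suc j)"
      using two_point_set_mono[of "1 / Suc i" e] i by (meson less_eq_real_def subsetD order_refl)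
    then show "\<exists>d>0. x \<in> two_point_set f A r e d" by (intro exI[of _ "1 / Suc j"]) auto
  qed
next
  assume *: "\<forall>e>0. \<exists>d>0. x \<in> two_point_set f A r e d"
  have "\<exists>j. x \<in> two_point_set f A r (1 / Suc i) (1 / Suc j)" for i
  proof -
    obtain d where "d > 0" "x \<in> two_point_set f A r (1 / Suc i) d"
      using *[rule_format, of "1 / Suc i"] by auto
    moreover then obtain j :: nat where "1 / Suc j < d" using nat_approx_posE by metis
    ultimately show ?thesis
      using two_point_set_mono[of "1 / Suc i" "1 / Suc i" "1 / Suc j" d r r] by (meson less_eq_real_def subsetD order_refl)
  qed
  then show "x \<in> grad_near f A r" by (auto simp: grad_near_def)
qed

lemma grad_near_differentiable:
  assumes D: "GDERIV f x :> D" and r: "0 \<le> r"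
  shows "x \<in> grad_near f A r \<longleftrightarrow> norm (D - A) \<le> r"
proof
  assume le: "norm (D - A) \<le> r"
  show "x \<in> grad_near f A r"
    unfolding grad_near_iff
  proof safe
    fix e :: real assume "e > 0"
    then obtain d where d: "d > 0" "\<forall>y\<in>ball x d. \<forall>z\<in>ball x d.
        \<bar>f y - f z - D \<bullet> (y - z)\<bar> \<le> e * (norm (y - x) + norm (z - x))"
      using gderiv_strict[OF D] by blast
    have "\<bar>f y - f z - A \<bullet> (y - z)\<bar> \<le> r * norm (y - z) + e * (norm (y - x) + norm (z - x))"
      if "y \<in> ball x d" "z \<in> ball x d" for y z
    proof -
      have "\<bar>(D - A) \<bullet> (y - z)\<bar> \<le> norm (D - A) * norm (y - z)" by (rule Cauchy_Schwarz_ineq2)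
      also have "\<dots> \<le> r * norm (y - z)" using le by (intro mult_right_mono) auto
      moreover have "\<bar>f y - f z - D \<bullet> (y - z)\<bar> \<le> e * (norm (y - x) + norm (z - x))"
        using d(2) that by blast
      ultimately show ?thesis unfolding inner_diff_left by linarith
    qed
    then show "\<exists>d>0. x \<in> two_point_set f A r e d"
      using d(1) by (auto simp: two_point_set_def intro!: exI[of _ d])
  qed
next
  assume near: "x \<in> grad_near f A r"
  have bound: "norm (D - A) \<le> r + 2 * e" if e: "e > 0" for e
  proof -
    obtain d1 where d1: "d1 > 0" "x \<in> two_point_set f A r e d1"
      using near e unfolding grad_near_iff by blast
    obtain d2 where d2: "d2 > 0" "\<forall>y\<in>ball x d2. \<forall>z\<in>ball x d2.
        \<bar>f y - f z - D \<bullet> (y - z)\<bar> \<le> e * (norm (y - x) + norm (z - x))"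
      using gderiv_strict[OF D e] by blast
    have "x \<in> two_point_set f D 0 e d2" using d2(2) by (simp add: two_point_set_def)
    from two_point_sets_close[OF this d2(1) d1(2) d1(1)] show ?thesis using r e by simp
  qed
  then have "norm (D - A) \<le> r + e" if "e > 0" for e
    using bound[of "e / 2"] that by simp
  then show "norm (D - A) \<le> r" by (rule field_le_epsilon)
qed

text \<open>Approximate slopes for every accuracy form a Cauchy sequence, whose limit is the gradient.\<close>

lemma grad_near_imp_differentiable:
  fixes f :: "'a::euclidean_space \<Rightarrow> real"
  assumes cauchy: "\<And>r. r > 0 \<Longrightarrow> \<exists>A. x \<in> grad_near f A r"
  shows "\<exists>D. GDERIV f x :> D"
proof -
  obtain A where A: "\<And>k::nat. x \<in> grad_near f (A k) (1 / Suc k)"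
    using cauchy[of "1 / Suc k" for k :: nat] by (metis of_nat_0_less_iff zero_less_Suc zero_less_divide_1_iff)
  have close: "norm (A k - A l) \<le> 1 / Suc k + 1 / Suc l" for k l
  proof (rule field_le_epsilon)
    fix e :: real assume e: "e > 0"
    obtain d1 d2 where d: "d1 > 0" "x \<in> two_point_set f (A k) (1 / Suc k) (e/2) d1"
        "d2 > 0" "x \<in> two_point_set f (A l) (1 / Suc l) (e/2) d2"
      using A[of k] A[of l] e half_gt_zero unfolding grad_near_iff by metis
    show "norm (A k - A l) \<le> 1 / Suc k + 1 / Suc l + e"
      using two_point_sets_close[OF d(2,1,4,3)] e by simp
  qed
  have "Cauchy A"
  proof (rule metric_CauchyI)
    fix e :: real assume "e > 0"
    then obtain K :: nat where K: "1 / Suc K < e / 2" using nat_approx_posE half_gt_zero by metis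
    have "dist (A k) (A l) < e" if "k \<ge> K" "l \<ge> K" for k l
    proof -
      have "1 / Suc k \<le> 1 / Suc K" "1 / Suc l \<le> 1 / Suc K" using that by (auto intro!: divide_left_mono)
      then show ?thesis using close[of k l] K unfolding dist_norm by linarith
    qed
    then show "\<exists>M. \<forall>m\<ge>M. \<forall>n\<ge>M. dist (A m) (A n) < e" by blast
  qed
  then obtain D where AD: "A \<longlonglongrightarrow> D" by (auto simp: Cauchy_convergent_iff convergent_def)
  have AkD: "norm (A k - D) \<le> 1 / Suc k" for k
  proof (rule tendsto_le[of sequentially])
    show "(\<lambda>l. norm (A k - A l)) \<longlonglongrightarrow> norm (A k - D)" by (intro tendsto_intros AD)
    have "(\<lambda>l. 1 / real (Suc l)) \<longlonglongrightarrow> 0" using LIMSEQ_inverse_real_of_nat by (simp add: inverse_eq_divide)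
    then show "(\<lambda>l. 1 / Suc k + 1 / Suc l) \<longlonglongrightarrow> 1 / Suc k"
      using tendsto_add[OF tendsto_const[of "1 / real (Suc k)"]] by fastforce
  qed (use close in \<open>auto intro!: always_eventually\<close>)
  have "GDERIV f x :> D"
    unfolding gderiv_def has_derivative_at_alt
  proof (intro conjI allI impI)
    show "bounded_linear (\<lambda>h. h \<bullet> D)" by (rule bounded_linear_inner_left)
  next
    fix e :: real assume "e > 0"
    then obtain k :: nat where k: "1 / Suc k < e / 3" using nat_approx_posE[of "e/3"] by auto
    obtain d where d: "d > 0" "x \<in> two_point_set f (A k) (1 / Suc k) (e/3) d"
      using A[of k] \<open>e > 0\<close> unfolding grad_near_iff by (metis divide_pos_pos zero_less_numeral)
    have "norm (f y - f x - (y - x) \<bullet> D) \<le> e * norm (y - x)" if "norm (y - x) < d" for y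
    proof -
      have "y \<in> ball x d" "x \<in> ball x d" using that d(1) by (auto simp: dist_norm norm_minus_commute)
      then have 1: "\<bar>f y - f x - A k \<bullet> (y - x)\<bar> \<le> 1 / Suc k * norm (y - x) + e/3 * (norm (y - x) + norm (x - x))"
        using d(2) unfolding two_point_set_def by blast
      have "\<bar>(A k - D) \<bullet> (y - x)\<bar> \<le> norm (A k - D) * norm (y - x)" by (rule Cauchy_Schwarz_ineq2)
      also have "\<dots> \<le> 1 / Suc k * norm (y - x)" using AkD by (intro mult_right_mono) auto
      finally have 2: "\<bar>(A k - D) \<bullet> (y - x)\<bar> \<le> 1 / Suc k * norm (y - x)" .
      have 3: "1 / Suc k * norm (y - x) \<le> e / 3 * norm (y - x)" using k by (intro mult_right_mono) auto
      have "f y - f x - (y - x) \<bullet> D = (f y - f x - A k \<bullet> (y - x)) + (A k - D) \<bullet> (y - x)"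
        by (simp add: inner_diff_left inner_diff_right inner_commute)
      then have "\<bar>f y - f x - (y - x) \<bullet> D\<bar> \<le> e / 3 * norm (y - x) + e/3 * norm (y - x) + e / 3 * norm (y - x)"
        using 1 2 3 unfolding diff_self norm_zero add_0_right by linarith
      then show ?thesis by simp
    qed
    then show "\<exists>d>0. \<forall>y. norm (y - x) < d \<longrightarrow> norm (f y - f x - (y - x) \<bullet> D) \<le> e * norm (y - x)"
      using d(1) by blast
  qed
  then show ?thesis ..
qed

lemma grad_nondifferentiable:
  assumes "\<nexists>D. GDERIV f x :> D"
  shows "grad f x = (THE D. False)"
  using assms unfolding grad_def by (metis (mono_tags, lifting))

lemma differentiable_set_borel:
  fixes f :: "'a::euclidean_space \<Rightarrow> real"
  shows "{x. \<exists>D. GDERIV f x :> D} \<in> sets borel"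
proof -
  obtain E :: "'a set" where E: "countable E" "\<And>X. open X \<Longrightarrow> X \<noteq> {} \<Longrightarrow> \<exists>d\<in>E. d \<in> X"
    using countable_dense_setE by blast
  have "{x. \<exists>D. GDERIV f x :> D} = (\<Inter>k::nat. \<Union>A\<in>E. grad_near f A (1 / Suc k))"
  proof (intro equalityI subsetI)
    fix x assume "x \<in> {x. \<exists>D. GDERIV f x :> D}"
    then obtain D where D: "GDERIV f x :> D" by auto
    have "\<exists>A\<in>E. x \<in> grad_near f A (1 / Suc k)" for k
    proof -
      obtain A where A: "A \<in> E" "A \<in> ball D (1 / Suc k)" using E(2)[of "ball D (1 / Suc k)"] by auto
      then show ?thesis
        using grad_near_differentiable[OF D, of "1 / Suc k" A] by (auto simp: dist_norm intro!: bexI[of _ A])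
    qed
    then show "x \<in> (\<Inter>k::nat. \<Union>A\<in>E. grad_near f A (1 / Suc k))" by auto
  next
    fix x assume x: "x \<in> (\<Inter>k::nat. \<Union>A\<in>E. grad_near f A (1 / Suc k))"
    have "\<exists>A. x \<in> grad_near f A r" if r: "r > 0" for r
    proof -
      obtain k :: nat where k: "1 / Suc k < r" by (rule nat_approx_posE[OF r])
      obtain A where A: "x \<in> grad_near f A (1 / Suc k)" using x by auto
      have "x \<in> grad_near f A r"
        unfolding grad_near_iff
      proof safe
        fix e :: real assume "e > 0"
        then obtain d where "d > 0" "x \<in> two_point_set f A (1 / Suc k) e d" using A by (auto simp: grad_near_iff)
        then show "\<exists>d>0. x \<in> two_point_set f A r e d"
          using two_point_set_mono[of e e d d "1 / Suc k" r f A] k by (auto intro!: exI[of _ d] simp del: of_nat_Suc)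
      qed
      then show ?thesis ..
    qed
    then show "x \<in> {x. \<exists>D. GDERIV f x :> D}" using grad_near_imp_differentiable by blast
  qed
  also have "\<dots> \<in> sets borel"
    using E(1) grad_near_borel by (intro sets.countable_INT'') (auto intro!: sets.countable_UN')
  finally show ?thesis .
qed

lemma grad_borel_measurable [measurable]:
  fixes f :: "'a::euclidean_space \<Rightarrow> real"
  shows "grad f \<in> borel_measurable borel"
proof -
  let ?D = "{x. \<exists>D. GDERIV f x :> D}"
  have "{x. dist A (grad f x) \<le> r} \<in> sets borel" for A :: 'a and r :: real
  proof (cases "r \<ge> 0")
    case True
    have "{x. dist A (grad f x) \<le> r} = (?D \<inter> grad_near f A r) \<union> (if dist A (THE D. False) \<le> r then - ?D else {})"
    proof (intro set_eqI)
      fix x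
      show "x \<in> {x. dist A (grad f x) \<le> r} \<longleftrightarrow>
        x \<in> (?D \<inter> grad_near f A r) \<union> (if dist A (THE D. False) \<le> r then - ?D else {})"
      proof (cases "x \<in> ?D")
        case True
        then obtain D where D: "GDERIV f x :> D" by auto
        then show ?thesis using grad_near_differentiable[OF D \<open>r \<ge> 0\<close>, of A] grad_eqI[OF D] True
          by (simp add: dist_norm norm_minus_commute)
      next
        case False
        then show ?thesis using grad_nondifferentiable[of f x] by auto
      qed
    qed
    then show ?thesis
      using differentiable_set_borel[of f] grad_near_borel[of f A r] by auto
  next
    case False
    then have "{x. dist A (grad f x) \<le> r} = {}" by (auto simp: not_le intro: less_le_trans)
    then show ?thesis by simp
  qed
  then have cb: "grad f -` cball A r \<in> sets borel" for A r by (simp add: vimage_def)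
  show ?thesis
  proof (rule borel_measurableI)
    fix S :: "'a set" assume S: "open S"
    obtain E :: "'a set" where E: "countable E" "\<And>X. open X \<Longrightarrow> X \<noteq> {} \<Longrightarrow> \<exists>d\<in>E. d \<in> X"
      using countable_dense_setE by blast
    define I where "I = {(A, k::nat). A \<in> E \<and> cball A (1 / Suc k) \<subseteq> S}"
    have "I \<subseteq> E \<times> UNIV" by (auto simp: I_def)
    then have I: "countable I" using E(1) by (rule_tac countable_subset) auto
    have "S = (\<Union>(A, k)\<in>I. cball A (1 / Suc k))"
    proof (intro equalityI subsetI)
      fix s assume "s \<in> S"
      then obtain e where e: "e > 0" "ball s e \<subseteq> S" using S openE by blast
      then obtain k :: nat where k: "1 / Suc k < e / 2" using nat_approx_posE half_gt_zero by metis
      obtain A where A: "A \<in> E" "A \<in> ball s (1 / Suc k)" using E(2)[of "ball s (1 / Suc k)"] by auto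
      have "cball A (1 / Suc k) \<subseteq> ball s e"
      proof
        fix v assume "v \<in> cball A (1 / Suc k)"
        then have "dist A v \<le> 1 / Suc k" by simp
        moreover have "dist s v \<le> dist s A + dist A v" by (rule dist_triangle)
        ultimately show "v \<in> ball s e" using A(2) k unfolding mem_ball by linarith
      qed
      then have "(A, k) \<in> I" using A e by (auto simp: I_def)
      moreover have "s \<in> cball A (1 / Suc k)"
        using A(2) unfolding mem_ball mem_cball by (metis dist_commute less_eq_real_def)
      ultimately show "s \<in> (\<Union>(A, k)\<in>I. cball A (1 / Suc k))" by blast
    qed (auto simp: I_def)
    then have "grad f -` S = (\<Union>(A, k)\<in>I. grad f -` cball A (1 / Suc k))" by blast
    also have "\<dots> \<in> sets borel" using I cb by (intro sets.countable_UN') auto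
    finally show "grad f -` S \<inter> space borel \<in> sets borel" by simp
  qed
qed

section \<open>Conditioning on independent draws\<close>

text \<open>Independence makes the law of \<open>(z, Y z)\<close> on \<open>F\<close> times \<open>D\<close> a product, where \<open>z\<close> is
  the sample itself seen with the coarser \<open>\<sigma>\<close>-algebra \<open>F\<close>; so conditioning on \<open>F\<close> is integration
  over the second coordinate.\<close>

lemma (in prob_space) cond_exp_independent:
  fixes \<phi> :: "'a \<times> 'd \<Rightarrow> real"
  assumes sub: "subalgebra M F" and Y[measurable]: "Y \<in> measurable M D"
    and ind: "\<forall>A\<in>sets F. \<forall>B\<in>sets D.
      prob (A \<inter> (Y -` B \<inter> space M)) = prob A * prob (Y -` B \<inter> space M)"
    and \<phi>[measurable]: "\<phi> \<in> borel_measurable (F \<Otimes>\<^sub>M D)"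
    and law: "distr M D Y = \<nu>"
    and int: "\<And>z. z \<in> space M \<Longrightarrow> integrable \<nu> (\<lambda>y. \<phi> (z, y))"
    and bnd: "\<And>z. z \<in> space M \<Longrightarrow> (\<integral>y. \<bar>\<phi> (z, y)\<bar> \<partial>\<nu>) \<le> b z" "integrable M b"
  shows "integrable M (\<lambda>z. \<phi> (z, Y z))"
    and "AE z in M. real_cond_exp M F (\<lambda>z. \<phi> (z, Y z)) z = (\<integral>y. \<phi> (z, y) \<partial>\<nu>)"
    and "integrable M (\<lambda>z. \<integral>y. \<phi> (z, y) \<partial>\<nu>)"
proof -
  have spF: "space F = space M" and setsF: "sets F \<subseteq> sets M"
    using sub by (auto simp: subalgebra_def)
  have idF[measurable]: "(\<lambda>z. z) \<in> measurable M F"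
    using measurable_from_subalg[OF sub measurable_ident] by (simp add: id_def)
  define FM where "FM = distr M F (\<lambda>z. z)"
  have sFM[measurable_cong, simp]: "sets FM = sets F" by (simp add: FM_def)
  have s\<nu>[measurable_cong, simp]: "sets \<nu> = sets D" by (simp add: law[symmetric])
  interpret FM: prob_space FM unfolding FM_def by (rule prob_space_distr) simp
  interpret \<nu>: prob_space \<nu> unfolding law[symmetric] by (rule prob_space_distr) simp
  interpret J: pair_prob_space FM \<nu> ..
  interpret finite_measure_subalgebra M F using sub by unfold_locales
  have joint: "FM \<Otimes>\<^sub>M \<nu> = distr M (F \<Otimes>\<^sub>M D) (\<lambda>z. (z, Y z))"
  proof (rule pair_measure_eqI)
    fix A B assume "A \<in> sets FM" "B \<in> sets \<nu>"
    then have A[measurable]: "A \<in> sets F" and B[measurable]: "B \<in> sets D" by simp_all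
    have AM: "A \<in> sets M" "A \<inter> space M = A"
      using A setsF sets.sets_into_space[OF A] spF by auto
    have BM: "Y -` B \<inter> space M \<in> sets M" by measurable
    have "emeasure FM A * emeasure \<nu> B = emeasure M A * emeasure M (Y -` B \<inter> space M)"
      unfolding FM_def law[symmetric] using AM by (simp add: emeasure_distr)
    also have "\<dots> = emeasure M (A \<inter> (Y -` B \<inter> space M))"
      using ind A B by (simp add: emeasure_eq_measure ennreal_mult[symmetric])
    also have "A \<inter> (Y -` B \<inter> space M) = (\<lambda>z. (z, Y z)) -` (A \<times> B) \<inter> space M" by auto
    also have "emeasure M \<dots> = emeasure (distr M (F \<Otimes>\<^sub>M D) (\<lambda>z. (z, Y z))) (A \<times> B)"
      by (subst emeasure_distr) auto
    finally show "emeasure FM A * emeasure \<nu> B = emeasure (distr M (F \<Otimes>\<^sub>M D) (\<lambda>z. (z, Y z))) (A \<times> B)" .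
  qed (auto intro: FM.sigma_finite_measure_axioms \<nu>.sigma_finite_measure_axioms)
  have abs_int: "integrable M (\<lambda>z. \<integral>y. \<bar>\<phi> (z, y)\<bar> \<partial>\<nu>)"
  proof (rule Bochner_Integration.integrable_bound[OF bnd(2)])
    have "(\<lambda>z. \<integral>y. \<bar>\<phi> (z, y)\<bar> \<partial>\<nu>) \<in> borel_measurable F" by measurable
    then show "(\<lambda>z. \<integral>y. \<bar>\<phi> (z, y)\<bar> \<partial>\<nu>) \<in> borel_measurable M"
      by (rule measurable_from_subalg[OF sub])
    show "AE z in M. norm (\<integral>y. \<bar>\<phi> (z, y)\<bar> \<partial>\<nu>) \<le> norm (b z)"
      using bnd(1) by (auto intro!: AE_I2 order_trans[OF _ abs_ge_self])
  qed
  have \<phi>int: "integrable (FM \<Otimes>\<^sub>M \<nu>) \<phi>"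
  proof (rule J.Fubini_integrable)
    show "\<phi> \<in> borel_measurable (FM \<Otimes>\<^sub>M \<nu>)" by measurable
    show "integrable FM (\<lambda>x. \<integral>y. norm (\<phi> (x, y)) \<partial>\<nu>)"
      unfolding FM_def using abs_int by (subst integrable_distr_eq) auto
    show "AE x in FM. integrable \<nu> (\<lambda>y. \<phi> (x, y))"
      using int by (intro AE_I2) (simp add: FM_def spF)
  qed
  show int1: "integrable M (\<lambda>z. \<phi> (z, Y z))"
    using \<phi>int unfolding joint by (subst (asm) integrable_distr_eq) auto
  have "integrable FM (\<lambda>z. \<integral>y. \<phi> (z, y) \<partial>\<nu>)" using J.integrable_fst'[OF \<phi>int] .
  then show int2: "integrable M (\<lambda>z. \<integral>y. \<phi> (z, y) \<partial>\<nu>)"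
    unfolding FM_def by (subst (asm) integrable_distr_eq) auto
  show "AE z in M. real_cond_exp M F (\<lambda>z. \<phi> (z, Y z)) z = (\<integral>y. \<phi> (z, y) \<partial>\<nu>)"
  proof (rule real_cond_exp_charact[OF _ int1 int2])
    fix A assume A[measurable]: "A \<in> sets F"
    let ?\<psi> = "\<lambda>u. indicator A (fst u) *\<^sub>R \<phi> u"
    have \<psi>: "integrable (FM \<Otimes>\<^sub>M \<nu>) ?\<psi>"
    proof (rule Bochner_Integration.integrable_bound[OF \<phi>int])
      show "?\<psi> \<in> borel_measurable (FM \<Otimes>\<^sub>M \<nu>)" by measurable
    qed (auto simp: indicator_def)
    have "(\<integral>z\<in>A. \<phi> (z, Y z) \<partial>M) = (\<integral>u. ?\<psi> u \<partial>(FM \<Otimes>\<^sub>M \<nu>))"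
      unfolding joint set_lebesgue_integral_def by (subst integral_distr) auto
    also have "\<dots> = (\<integral>z. (\<integral>y. ?\<psi> (z, y) \<partial>\<nu>) \<partial>FM)" using J.integral_fst'[OF \<psi>] by simp
    also have "\<dots> = (\<integral>z\<in>A. (\<integral>y. \<phi> (z, y) \<partial>\<nu>) \<partial>M)"
      unfolding FM_def set_lebesgue_integral_def by (subst integral_distr) auto
    finally show "(\<integral>z\<in>A. \<phi> (z, Y z) \<partial>M) = (\<integral>z\<in>A. (\<integral>y. \<phi> (z, y) \<partial>\<nu>) \<partial>M)" .
  qed measurable
qed

definition generated :: "'w measure \<Rightarrow> 'd measure \<Rightarrow> ('q \<Rightarrow> 'w \<Rightarrow> 'd) \<Rightarrow> 'q set \<Rightarrow> 'w measure" where
  "generated M D X J = sigma (space M) (\<Union>q\<in>J. {X q -` A \<inter> space M | A. A \<in> sets D})"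

lemma space_generated [simp]: "space (generated M D X J) = space M"
  unfolding generated_def by (rule space_measure_of) auto

lemma sets_generated:
  "sets (generated M D X J) = sigma_sets (space M) (\<Union>q\<in>J. {X q -` A \<inter> space M | A. A \<in> sets D})"
  unfolding generated_def by (rule sets_measure_of) auto

lemma generated_mono: "J \<subseteq> J' \<Longrightarrow> subalgebra (generated M D X J') (generated M D X J)"
  unfolding subalgebra_def sets_generated by (auto intro!: sigma_sets_mono')

lemma generated_subalgebra:
  assumes "\<And>q. q \<in> J \<Longrightarrow> X q \<in> measurable M D"
  shows "subalgebra M (generated M D X J)"
  unfolding subalgebra_def sets_generated
  using assms by (auto intro!: sets.sigma_sets_subset measurable_sets)

lemma generated_measurable:
  assumes "q \<in> J" "X q \<in> measurable M D"
  shows "X q \<in> measurable (generated M D X J) D"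
proof (rule measurableI)
  fix A assume "A \<in> sets D"
  then show "X q -` A \<inter> space (generated M D X J) \<in> sets (generated M D X J)"
    unfolding sets_generated space_generated using assms(1) by (intro sigma_sets.Basic) blast
qed (use assms(2) in \<open>auto dest: measurable_space\<close>)

lemma (in prob_space) indep_generated:
  assumes ind: "indep_vars (\<lambda>_. D) X I" and J: "J \<subseteq> I" "q \<in> I" "q \<notin> J"
    and A: "A \<in> sets (generated M D X J)" and B: "B \<in> sets D"
  shows "prob (A \<inter> (X q -` B \<inter> space M)) = prob A * prob (X q -` B \<inter> space M)"
proof -
  have rv: "\<And>q. q \<in> I \<Longrightarrow> X q \<in> measurable M D"
    and E: "indep_sets (\<lambda>q. {X q -` A \<inter> space M | A. A \<in> sets D}) I"
    using ind unfolding indep_vars_def2 by auto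
  let ?E = "\<lambda>q. {X q -` A \<inter> space M | A. A \<in> sets D}"
  let ?K = "case_bool J {q}"
  have "indep_sets (\<lambda>b. sigma_sets (space M) (\<Union>i\<in>?K b. ?E i)) UNIV"
  proof (rule indep_sets_collect_sigma)
    show "indep_sets ?E (\<Union>b\<in>UNIV. ?K b)"
      using J by (intro indep_sets_mono_index[OF _ E]) (auto split: bool.splits)
    show "Int_stable (?E i)" for i
    proof (rule Int_stableI)
      fix a b assume "a \<in> ?E i" "b \<in> ?E i"
      then obtain A B where "a = X i -` A \<inter> space M" "b = X i -` B \<inter> space M" "A \<in> sets D" "B \<in> sets D" by auto
      then show "a \<inter> b \<in> ?E i" by (auto intro!: exI[of _ "A \<inter> B"])
    qed
    show "disjoint_family_on ?K UNIV" using J by (auto simp: disjoint_family_on_def split: bool.splits)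
  qed
  moreover have "(\<lambda>b. sigma_sets (space M) (\<Union>i\<in>?K b. ?E i))
      = case_bool (sets (generated M D X J)) (sigma_sets (space M) (?E q))"
    by (auto simp: fun_eq_iff sets_generated split: bool.splits)
  ultimately have "indep_set (sets (generated M D X J)) (sigma_sets (space M) (?E q))"
    by (simp add: indep_set_def)
  then show ?thesis using A B by (intro indep_setD sigma_sets.Basic) auto
qed


section \<open>The law of one draw\<close>

definition draw_law :: "nat \<Rightarrow> 's measure \<Rightarrow> real \<Rightarrow> (nat \<times> 's \<times> bool) measure" where
  "draw_law m N p = measure_pmf (pmf_of_set {..<m}) \<Otimes>\<^sub>M N \<Otimes>\<^sub>M measure_pmf (bernoulli_pmf p)"

text \<open>The law of the draw is invisible outside \<open>{..<m}\<close>, so integrability is needed for those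
  indices only, while measurability is needed for every natural number.\<close>

lemma draw_law_index_seed:
  fixes \<phi> :: "nat \<Rightarrow> 's \<Rightarrow> real"
  assumes N: "prob_space N" and m: "m \<ge> 1"
    and meas[measurable]: "\<And>j. \<phi> j \<in> borel_measurable N"
    and int: "\<And>j. j < m \<Longrightarrow> integrable N (\<phi> j)"
  shows "integrable (draw_law m N p) (\<lambda>(j, t, b). \<phi> j t)"
    and "(\<integral>(j, t, b). \<phi> j t \<partial>draw_law m N p) = (\<Sum>j<m. \<integral>t. \<phi> j t \<partial>N) / real m"
proof -
  let ?U = "measure_pmf (pmf_of_set {..<m})"
  let ?B = "measure_pmf (bernoulli_pmf p)"
  let ?P = "N \<Otimes>\<^sub>M ?B"
  interpret N: prob_space N by fact
  interpret B: prob_space ?B by (rule prob_space_measure_pmf)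
  interpret U: prob_space ?U by (rule prob_space_measure_pmf)
  interpret NB: pair_prob_space N ?B ..
  interpret P: prob_space ?P by (rule NB.prob_space_axioms)
  interpret UP: pair_prob_space ?U ?P ..
  have set: "set_pmf (pmf_of_set {..<m}) = {..<m}" using m by (intro set_pmf_of_set) (auto simp: lessThan_empty_iff)
  have fst: "distr ?P N fst = N" by (rule prob_space.distr_pair_fst[OF prob_space_measure_pmf])
  have one: "integrable ?P (\<lambda>u. \<phi> j (fst u))" "(\<integral>u. \<phi> j (fst u) \<partial>?P) = (\<integral>t. \<phi> j t \<partial>N)"
    if "j < m" for j
  proof -
    have "integrable (distr ?P N fst) (\<phi> j)" using int[OF that] by (simp add: fst)
    then show "integrable ?P (\<lambda>u. \<phi> j (fst u))" by (subst (asm) integrable_distr_eq) auto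
    have "(\<integral>t. \<phi> j t \<partial>N) = (\<integral>t. \<phi> j t \<partial>distr ?P N fst)" by (simp add: fst)
    also have "\<dots> = (\<integral>u. \<phi> j (fst u) \<partial>?P)" by (rule integral_distr) auto
    finally show "(\<integral>u. \<phi> j (fst u) \<partial>?P) = (\<integral>t. \<phi> j t \<partial>N)" by simp
  qed
  have eq: "(\<lambda>(j, t, b). \<phi> j t) = (\<lambda>u. \<phi> (fst u) (fst (snd u)))" by (simp add: case_prod_beta')
  have int2: "integrable (?U \<Otimes>\<^sub>M ?P) (\<lambda>u. \<phi> (fst u) (fst (snd u)))"
  proof (rule UP.Fubini_integrable)
    have "(\<lambda>u. \<phi> (fst u) (fst (snd u))) \<in> borel_measurable (count_space UNIV \<Otimes>\<^sub>M ?P)"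
      by (rule measurable_compose_countable[where g = fst]) measurable
    then show "(\<lambda>u. \<phi> (fst u) (fst (snd u))) \<in> borel_measurable (?U \<Otimes>\<^sub>M ?P)"
      by (simp cong: measurable_cong_sets add: sets_pair_measure_cong[of ?U "count_space UNIV" ?P ?P])
    show "integrable ?U (\<lambda>j. \<integral>u. norm (\<phi> (fst (j, u)) (fst (snd (j, u)))) \<partial>?P)"
      by (rule integrable_measure_pmf_finite) (simp add: set)
    show "AE j in ?U. integrable ?P (\<lambda>u. \<phi> (fst (j, u)) (fst (snd (j, u))))"
      using one(1) by (simp add: AE_measure_pmf_iff set)
  qed
  show "integrable (draw_law m N p) (\<lambda>(j, t, b). \<phi> j t)" using int2 by (simp add: draw_law_def eq)
  have "(\<integral>(j, t, b). \<phi> j t \<partial>draw_law m N p) = (\<integral>j. (\<integral>u. \<phi> j (fst u) \<partial>?P) \<partial>?U)"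
    using UP.integral_fst'[OF int2] by (simp add: draw_law_def eq)
  also have "\<dots> = (\<Sum>j<m. \<integral>u. \<phi> j (fst u) \<partial>?P) / real m"
    using m by (subst integral_pmf_of_set) (auto simp: lessThan_empty_iff)
  finally show "(\<integral>(j, t, b). \<phi> j t \<partial>draw_law m N p) = (\<Sum>j<m. \<integral>t. \<phi> j t \<partial>N) / real m"
    using one(2) by simp
qed

lemma draw_law_coin:
  fixes \<phi> :: "bool \<Rightarrow> real"
  assumes N: "prob_space N" and p: "0 \<le> p" "p \<le> 1"
  shows "integrable (draw_law m N p) (\<lambda>(j, t, b). \<phi> b)"
    and "(\<integral>(j, t, b). \<phi> b \<partial>draw_law m N p) = p * \<phi> True + (1 - p) * \<phi> False"
proof -
  let ?U = "measure_pmf (pmf_of_set {..<m})"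
  let ?B = "measure_pmf (bernoulli_pmf p)"
  let ?P = "N \<Otimes>\<^sub>M ?B"
  interpret N: prob_space N by fact
  interpret B: prob_space ?B by (rule prob_space_measure_pmf)
  interpret U: prob_space ?U by (rule prob_space_measure_pmf)
  interpret NB: pair_prob_space N ?B ..
  interpret P: prob_space ?P by (rule NB.prob_space_axioms)
  interpret UP: pair_prob_space ?U ?P ..
  have eq: "(\<lambda>(j, t, b). \<phi> b) = (\<lambda>u. \<phi> (snd (snd u)))" by (simp add: case_prod_beta')
  have \<phi>[measurable]: "\<phi> \<in> borel_measurable ?B" by simp
  have bd: "norm (\<phi> b) \<le> \<bar>\<phi> True\<bar> + \<bar>\<phi> False\<bar>" for b by (cases b) auto
  show int: "integrable (draw_law m N p) (\<lambda>(j, t, b). \<phi> b)"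
    unfolding draw_law_def eq
    by (rule UP.P.integrable_const_bound[where B = "\<bar>\<phi> True\<bar> + \<bar>\<phi> False\<bar>"]) (use bd in \<open>auto\<close>)
  have int': "integrable ?P (\<lambda>u. \<phi> (snd u))"
    by (rule NB.P.integrable_const_bound[where B = "\<bar>\<phi> True\<bar> + \<bar>\<phi> False\<bar>"]) (use bd in \<open>auto\<close>)
  have "(\<integral>(j, t, b). \<phi> b \<partial>draw_law m N p) = (\<integral>j. (\<integral>u. \<phi> (snd u) \<partial>?P) \<partial>?U)"
    using UP.integral_fst'[of "\<lambda>u. \<phi> (snd (snd u))"] int by (simp add: draw_law_def eq)
  also have "\<dots> = (\<integral>u. \<phi> (snd u) \<partial>?P)" by (simp add: prob_space.prob_space[OF prob_space_measure_pmf])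
  also have "\<dots> = (\<integral>t. (\<integral>b. \<phi> b \<partial>?B) \<partial>N)" using NB.integral_fst'[OF int'] by simp
  also have "\<dots> = (\<integral>b. \<phi> b \<partial>?B)" by (simp add: N.prob_space)
  also have "\<dots> = p * \<phi> True + (1 - p) * \<phi> False" using p by simp
  finally show "(\<integral>(j, t, b). \<phi> b \<partial>draw_law m N p) = p * \<phi> True + (1 - p) * \<phi> False" .
qed

section \<open>Averages and Young's inequality\<close>

lemma norm_diff_young:
  fixes u v :: "'a::real_inner"
  assumes "\<beta> > 0"
  shows "(norm (u - v))\<^sup>2 \<le> (1 + \<beta>) * (norm u)\<^sup>2 + (1 + 1 / \<beta>) * (norm v)\<^sup>2"
proof -
  have "0 \<le> (norm (\<beta> *\<^sub>R u + v))\<^sup>2 / \<beta>" using assms by simp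
  also have "\<dots> = \<beta> * (norm u)\<^sup>2 + 2 * (u \<bullet> v) + (norm v)\<^sup>2 / \<beta>"
    using assms unfolding power2_norm_eq_inner
    by (simp add: inner_add_left inner_add_right inner_commute field_simps)
  finally show ?thesis
    unfolding power2_norm_eq_inner
    by (simp add: inner_diff_left inner_diff_right inner_commute algebra_simps)
qed

lemma norm_add_young: "(norm (u + v))\<^sup>2 \<le> 2 * (norm u)\<^sup>2 + 2 * (norm v)\<^sup>2" for u v :: "'a::real_inner"
  using norm_diff_young[of 1 u "- v"] by simp

text \<open>The parallel axis theorem for finite averages.\<close>

lemma worker_mean_variance:
  fixes u :: "nat \<Rightarrow> 'a::real_inner"
  assumes "m \<ge> 1"
  shows "1 / real m * (\<Sum>j<m. (norm (u j - v))\<^sup>2)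
     = (norm (worker_mean m u - v))\<^sup>2 + 1 / real m * (\<Sum>j<m. (norm (u j - worker_mean m u))\<^sup>2)"
proof -
  define a where "a = worker_mean m u"
  have m: "real m > 0" using assms by simp
  have sum_u: "(\<Sum>j<m. u j) = real m *\<^sub>R a" using m by (simp add: a_def worker_mean_def)
  have zero: "(\<Sum>j<m. u j - a) = 0" by (simp add: sum_subtractf sum_u sum_constant_scaleR)
  have "(\<Sum>j<m. (norm (u j - v))\<^sup>2)
      = (\<Sum>j<m. (norm (u j - a))\<^sup>2 + 2 * ((u j - a) \<bullet> (a - v)) + (norm (a - v))\<^sup>2)"
    unfolding power2_norm_eq_inner
    by (intro sum.cong) (auto simp: inner_diff_left inner_diff_right inner_commute algebra_simps)
  also have "\<dots> = (\<Sum>j<m. (norm (u j - a))\<^sup>2) + 2 * ((\<Sum>j<m. u j - a) \<bullet> (a - v)) + real m * (norm (a - v))\<^sup>2"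
    by (simp add: sum.distrib inner_sum_left sum_distrib_left)
  finally have "(\<Sum>j<m. (norm (u j - v))\<^sup>2) = (\<Sum>j<m. (norm (u j - a))\<^sup>2) + real m * (norm (a - v))\<^sup>2"
    by (simp add: zero)
  then show ?thesis using m by (simp add: a_def field_simps)
qed

lemma worker_mean_jensen:
  fixes u :: "nat \<Rightarrow> 'a::real_inner"
  assumes "m \<ge> 1"
  shows "(norm (worker_mean m u))\<^sup>2 \<le> 1 / real m * (\<Sum>j<m. (norm (u j))\<^sup>2)"
proof -
  have "0 \<le> 1 / real m * (\<Sum>j<m. (norm (u j - worker_mean m u))\<^sup>2)" by (simp add: sum_nonneg)
  then show ?thesis using worker_mean_variance[OF assms, of u 0] by simp
qed

lemma worker_mean_diff: "worker_mean n u - worker_mean n v = worker_mean n (\<lambda>i. u i - v i)"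
  by (simp add: worker_mean_def sum_subtractf scaleR_diff_right)

lemma norm_sum_squared_le:
  fixes u :: "nat \<Rightarrow> 'a::real_inner"
  assumes "finite I"
  shows "(norm (\<Sum>t\<in>I. u t))\<^sup>2 \<le> real (card I) * (\<Sum>t\<in>I. (norm (u t))\<^sup>2)"
proof -
  have "(norm (\<Sum>t\<in>I. u t))\<^sup>2 \<le> (\<Sum>t\<in>I. norm (u t))\<^sup>2"
    by (intro power_mono norm_sum) auto
  also have "\<dots> = (\<Sum>t\<in>I. 1 * norm (u t))\<^sup>2" by simp
  also have "\<dots> \<le> (\<Sum>t\<in>I. 1\<^sup>2) * (\<Sum>t\<in>I. (norm (u t))\<^sup>2)"
    by (rule Cauchy_Schwarz_ineq_sum)
  finally show ?thesis by simp
qed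


section \<open>One quantized step\<close>

text \<open>The summand index and the quantizer contribute orthogonal errors: the quantization error has
  mean zero for every fixed index.\<close>

lemma quantized_moments:
  fixes u :: "nat \<Rightarrow> 'a::euclidean_space"
  assumes Q: "quantizer N \<omega> Q" and m: "m \<ge> 1" and \<omega>: "\<omega> \<ge> 0"
  defines "a \<equiv> worker_mean m u"
  shows "integrable (draw_law m N p) (\<lambda>(j, t, b). (h + Q t (u j - h) - a) \<bullet> v)"
    and "(\<integral>(j, t, b). (h + Q t (u j - h) - a) \<bullet> v \<partial>draw_law m N p) = 0"
    and "integrable (draw_law m N p) (\<lambda>(j, t, b). (norm (h + Q t (u j - h) - a))\<^sup>2)"
    and "(\<integral>(j, t, b). (norm (h + Q t (u j - h) - a))\<^sup>2 \<partial>draw_law m N p)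
      \<le> \<omega> * (norm (a - h))\<^sup>2 + (\<omega> + 1) * (1 / real m * (\<Sum>j<m. (norm (u j - a))\<^sup>2))"
proof -
  interpret N: prob_space N using Q by (simp add: quantizer_def)
  have QI: "integrable N (\<lambda>t. Q t y)" "(\<integral>t. Q t y \<partial>N) = y"
    "integrable N (\<lambda>t. (norm (Q t y - y))\<^sup>2)" "(\<integral>t. (norm (Q t y - y))\<^sup>2 \<partial>N) \<le> \<omega> * (norm y)\<^sup>2" for y
    using Q by (auto simp: quantizer_def)
  have Qm[measurable]: "(\<lambda>t. Q t y) \<in> borel_measurable N" for y
    using QI(1)[of y] by (rule borel_measurable_integrable)
  have lin: "integrable N (\<lambda>t. (h + Q t (u j - h) - a) \<bullet> v)"
    "(\<integral>t. (h + Q t (u j - h) - a) \<bullet> v \<partial>N) = (u j - a) \<bullet> v" for j v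
  proof -
    have i: "integrable N (\<lambda>t. h + Q t (u j - h) - a)" using QI(1) by simp
    then show "integrable N (\<lambda>t. (h + Q t (u j - h) - a) \<bullet> v)" by simp
    have "(\<integral>t. (h + Q t (u j - h) - a) \<bullet> v \<partial>N) = (\<integral>t. h + Q t (u j - h) - a \<partial>N) \<bullet> v"
      using i by simp
    also have "(\<integral>t. h + Q t (u j - h) - a \<partial>N) = u j - a"
      using QI(1,2)[of "u j - h"] by (simp add: N.prob_space)
    finally show "(\<integral>t. (h + Q t (u j - h) - a) \<bullet> v \<partial>N) = (u j - a) \<bullet> v" .
  qed
  have Np: "prob_space N" by (rule N.prob_space_axioms)
  have sum_u: "(\<Sum>j<m. u j) = real m *\<^sub>R a" using m by (simp add: a_def worker_mean_def)
  show "integrable (draw_law m N p) (\<lambda>(j, t, b). (h + Q t (u j - h) - a) \<bullet> v)"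
    by (intro draw_law_index_seed[OF Np m] lin) measurable
  have "(\<integral>(j, t, b). (h + Q t (u j - h) - a) \<bullet> v \<partial>draw_law m N p)
      = (\<Sum>j<m. (u j - a) \<bullet> v) / real m"
    unfolding lin(2)[symmetric] by (intro draw_law_index_seed[OF Np m] lin) measurable
  also have "(\<Sum>j<m. (u j - a) \<bullet> v) = (\<Sum>j<m. u j - a) \<bullet> v" by (simp add: inner_sum_left)
  also have "(\<Sum>j<m. u j - a) = 0" by (simp add: sum_subtractf sum_u sum_constant_scaleR)
  finally show "(\<integral>(j, t, b). (h + Q t (u j - h) - a) \<bullet> v \<partial>draw_law m N p) = 0" by simp
  have split: "(norm (h + Q t (u j - h) - a))\<^sup>2 = (norm (Q t (u j - h) - (u j - h)))\<^sup>2
      + 2 * ((h + Q t (u j - h) - a) \<bullet> (u j - a)) - (norm (u j - a))\<^sup>2" for t j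
    unfolding power2_norm_eq_inner
    by (simp add: inner_diff_left inner_diff_right inner_add_left inner_add_right inner_commute algebra_simps)
  have sq: "integrable N (\<lambda>t. (norm (h + Q t (u j - h) - a))\<^sup>2)" for j
    unfolding split
    by (intro Bochner_Integration.integrable_diff Bochner_Integration.integrable_add
        integrable_mult_right lin QI) simp
  have sq_le: "(\<integral>t. (norm (h + Q t (u j - h) - a))\<^sup>2 \<partial>N)
      \<le> \<omega> * (norm (u j - h))\<^sup>2 + (norm (u j - a))\<^sup>2" for j
  proof -
    have "(\<integral>t. (norm (h + Q t (u j - h) - a))\<^sup>2 \<partial>N)
       = (\<integral>t. (norm (Q t (u j - h) - (u j - h)))\<^sup>2 \<partial>N) + 2 * ((u j - a) \<bullet> (u j - a)) - (norm (u j - a))\<^sup>2"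
      unfolding split using lin[of j "u j - a"] QI(3)[of "u j - h"]
      by (subst Bochner_Integration.integral_diff Bochner_Integration.integral_add; simp add: N.prob_space)+
    then show ?thesis using QI(4)[of "u j - h"] by (simp add: power2_norm_eq_inner)
  qed
  show "integrable (draw_law m N p) (\<lambda>(j, t, b). (norm (h + Q t (u j - h) - a))\<^sup>2)"
    by (intro draw_law_index_seed[OF Np m] sq) measurable
  have "(\<integral>(j, t, b). (norm (h + Q t (u j - h) - a))\<^sup>2 \<partial>draw_law m N p)
      = (\<Sum>j<m. \<integral>t. (norm (h + Q t (u j - h) - a))\<^sup>2 \<partial>N) / real m"
    by (intro draw_law_index_seed[OF Np m] sq) measurable
  also have "\<dots> \<le> (\<Sum>j<m. \<omega> * (norm (u j - h))\<^sup>2 + (norm (u j - a))\<^sup>2) / real m"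
    by (intro divide_right_mono sum_mono sq_le) simp
  also have "\<dots> = \<omega> * (1 / real m * (\<Sum>j<m. (norm (u j - h))\<^sup>2)) + 1 / real m * (\<Sum>j<m. (norm (u j - a))\<^sup>2)"
    by (simp only: sum.distrib sum_distrib_left[symmetric] add_divide_distrib) simp
  also have "\<dots> = \<omega> * (norm (a - h))\<^sup>2 + (\<omega> + 1) * (1 / real m * (\<Sum>j<m. (norm (u j - a))\<^sup>2))"
    unfolding worker_mean_variance[OF m, of u h] a_def by (simp add: algebra_simps add_divide_distrib)
  finally show "(\<integral>(j, t, b). (norm (h + Q t (u j - h) - a))\<^sup>2 \<partial>draw_law m N p)
      \<le> \<omega> * (norm (a - h))\<^sup>2 + (\<omega> + 1) * (1 / real m * (\<Sum>j<m. (norm (u j - a))\<^sup>2))" .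
qed


section \<open>Square integrable vectors and conditional bounds\<close>

definition in_L2 :: "'w measure \<Rightarrow> ('w \<Rightarrow> 'a::euclidean_space) \<Rightarrow> bool" where
  "in_L2 M X \<longleftrightarrow> X \<in> borel_measurable M \<and> integrable M (\<lambda>z. (norm (X z))\<^sup>2)"

lemma in_L2_dominated:
  assumes "X \<in> borel_measurable M" "integrable M b"
    and "\<And>z. z \<in> space M \<Longrightarrow> (norm (X z))\<^sup>2 \<le> b z"
  shows "in_L2 M X"
proof -
  have "integrable M (\<lambda>z. (norm (X z))\<^sup>2)"
  proof (rule Bochner_Integration.integrable_bound[OF assms(2)])
    show "(\<lambda>z. (norm (X z))\<^sup>2) \<in> borel_measurable M" using assms(1) by measurable
  qed (use assms(3) in \<open>auto intro!: AE_I2 order_trans[OF _ abs_ge_self]\<close>)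
  then show ?thesis using assms(1) by (simp add: in_L2_def)
qed

lemma in_L2_cong:
  assumes "\<And>z. z \<in> space M \<Longrightarrow> X z = Y z"
  shows "in_L2 M X \<longleftrightarrow> in_L2 M Y"
  unfolding in_L2_def
  using assms by (simp cong: measurable_cong Bochner_Integration.integrable_cong)

lemma in_L2_add:
  assumes "in_L2 M X" "in_L2 M Y"
  shows "in_L2 M (\<lambda>z. X z + Y z)"
  using assms unfolding in_L2_def
  by (intro in_L2_dominated[unfolded in_L2_def,
        where b = "\<lambda>z. 2 * (norm (X z))\<^sup>2 + 2 * (norm (Y z))\<^sup>2"]) (auto intro: norm_add_young)

lemma in_L2_scale:
  assumes "in_L2 M X"
  shows "in_L2 M (\<lambda>z. r *\<^sub>R X z)"
  using assms by (auto simp: in_L2_def power_mult_distrib)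

lemma in_L2_diff:
  assumes "in_L2 M X" "in_L2 M Y"
  shows "in_L2 M (\<lambda>z. X z - Y z)"
  using in_L2_add[OF assms(1) in_L2_scale[OF assms(2), of "-1"]] by simp

lemma (in finite_measure) in_L2_const: "in_L2 M (\<lambda>z. v)"
  by (simp add: in_L2_def)

lemma (in finite_measure) in_L2_sum:
  assumes "\<And>i. i \<in> I \<Longrightarrow> in_L2 M (X i)"
  shows "in_L2 M (\<lambda>z. \<Sum>i\<in>I. X i z)"
  using assms
proof (induction I rule: infinite_finite_induct)
  case (insert i I)
  then show ?case using in_L2_add[of M "X i" "\<lambda>z. \<Sum>i\<in>I. X i z"] by simp
qed (use in_L2_const[of 0] in simp_all)

lemma (in finite_measure) in_L2_mean:
  assumes "\<And>i. i < n \<Longrightarrow> in_L2 M (X i)"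
  shows "in_L2 M (\<lambda>z. worker_mean n (\<lambda>i. X i z))"
  unfolding worker_mean_def using assms by (intro in_L2_scale in_L2_sum) auto

lemma in_L2_inner:
  assumes "in_L2 M X" "in_L2 M Y"
  shows "integrable M (\<lambda>z. X z \<bullet> Y z)"
proof (rule Bochner_Integration.integrable_bound[where f = "\<lambda>z. (norm (X z))\<^sup>2 + (norm (Y z))\<^sup>2"])
  show "AE z in M. norm (X z \<bullet> Y z) \<le> norm ((norm (X z))\<^sup>2 + (norm (Y z))\<^sup>2)"
  proof (rule AE_I2)
    fix z
    have "\<bar>X z \<bullet> Y z\<bar> \<le> norm (X z) * norm (Y z)" by (rule Cauchy_Schwarz_ineq2)
    also have "\<dots> \<le> (norm (X z))\<^sup>2 + (norm (Y z))\<^sup>2"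
      using sum_squares_bound[of "norm (X z)" "norm (Y z)"] mult_nonneg_nonneg[of "norm (X z)" "norm (Y z)"]
      by (simp del: mult_nonneg_nonneg)
    finally show "norm (X z \<bullet> Y z) \<le> norm ((norm (X z))\<^sup>2 + (norm (Y z))\<^sup>2)" by simp
  qed
qed (use assms in \<open>auto simp: in_L2_def\<close>)

lemma (in finite_measure) in_L2_integrable:
  assumes "in_L2 M X"
  shows "integrable M X"
proof (rule Bochner_Integration.integrable_bound)
  show "integrable M (\<lambda>z. 1 + (norm (X z))\<^sup>2)" using assms by (simp add: in_L2_def)
  show "X \<in> borel_measurable M" using assms by (simp add: in_L2_def)
  have "norm (X z) \<le> 1 + (norm (X z))\<^sup>2" for z
    using sum_squares_bound[of "norm (X z)" 1] by simp (smt (verit) norm_ge_zero)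
  then show "AE z in M. norm (X z) \<le> norm (1 + (norm (X z))\<^sup>2)" by (auto intro: order_trans)
qed

lemma (in finite_measure) in_L2_lipschitz:
  assumes X: "in_L2 M X" and G: "G \<in> borel_measurable borel"
    and lip: "\<And>y. norm (G y - G v) \<le> C * norm (y - v)"
  shows "in_L2 M (\<lambda>z. G (X z))"
proof -
  have "in_L2 M (\<lambda>z. G (X z) - G v)"
  proof (rule in_L2_dominated)
    show "(\<lambda>z. G (X z) - G v) \<in> borel_measurable M"
      using X G by (auto simp: in_L2_def)
    show "integrable M (\<lambda>z. C\<^sup>2 * (norm (X z - v))\<^sup>2)"
      using in_L2_diff[OF X in_L2_const[of v]]
      by (simp add: in_L2_def)
    show "(norm (G (X z) - G v))\<^sup>2 \<le> C\<^sup>2 * (norm (X z - v))\<^sup>2" for z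
      using lip[of "X z"] unfolding power_mult_distrib[symmetric] by (intro power_mono) auto
  qed
  from in_L2_add[OF this in_L2_const[of "G v"]] show ?thesis by simp
qed

text \<open>Conditional second moments are needed as upper bounds only.  Carrying the integrability of both
  sides along closes these bounds under sums, scaling, weakening and coarser conditioning.\<close>

definition cond_le :: "'w measure \<Rightarrow> 'w measure \<Rightarrow> ('w \<Rightarrow> real) \<Rightarrow> ('w \<Rightarrow> real) \<Rightarrow> bool" where
  "cond_le M F X Y \<longleftrightarrow> integrable M X \<and> integrable M Y \<and> (AE z in M. real_cond_exp M F X z \<le> Y z)"

lemma (in finite_measure) cond_subalgebra:
  "subalgebra M F \<Longrightarrow> finite_measure_subalgebra M F"
  by unfold_locales

lemma (in finite_measure) cond_le_add:
  assumes F: "subalgebra M F" and 1: "cond_le M F X Y" and 2: "cond_le M F X' Y'"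
  shows "cond_le M F (\<lambda>z. X z + X' z) (\<lambda>z. Y z + Y' z)"
proof -
  interpret F: finite_measure_subalgebra M F using F by (rule cond_subalgebra)
  have "AE z in M. real_cond_exp M F (\<lambda>z. X z + X' z) z = real_cond_exp M F X z + real_cond_exp M F X' z"
    using 1 2 by (intro F.real_cond_exp_add) (auto simp: cond_le_def)
  moreover have "AE z in M. real_cond_exp M F X z \<le> Y z" "AE z in M. real_cond_exp M F X' z \<le> Y' z"
    using 1 2 by (auto simp: cond_le_def)
  ultimately have "AE z in M. real_cond_exp M F (\<lambda>z. X z + X' z) z \<le> Y z + Y' z" by eventually_elim simp
  then show ?thesis using 1 2 by (simp add: cond_le_def)
qed

lemma (in finite_measure) cond_le_scale:
  assumes F: "subalgebra M F" and 1: "cond_le M F X Y" and r: "r \<ge> 0"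
  shows "cond_le M F (\<lambda>z. r * X z) (\<lambda>z. r * Y z)"
proof -
  interpret F: finite_measure_subalgebra M F using F by (rule cond_subalgebra)
  have "AE z in M. real_cond_exp M F (\<lambda>z. r * X z) z = r * real_cond_exp M F X z"
    using 1 by (intro F.real_cond_exp_cmult) (auto simp: cond_le_def)
  moreover have "AE z in M. real_cond_exp M F X z \<le> Y z" using 1 by (auto simp: cond_le_def)
  ultimately have "AE z in M. real_cond_exp M F (\<lambda>z. r * X z) z \<le> r * Y z"
    by eventually_elim (use r in \<open>auto intro: mult_left_mono\<close>)
  then show ?thesis using 1 by (simp add: cond_le_def)
qed

lemma (in finite_measure) cond_le_refl:
  assumes F: "subalgebra M F" and "integrable M X" "X \<in> borel_measurable F"
  shows "cond_le M F X X"
proof -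
  interpret F: finite_measure_subalgebra M F using F by (rule cond_subalgebra)
  have "AE z in M. real_cond_exp M F X z = X z" using assms by (intro F.real_cond_exp_F_meas)
  then have "AE z in M. real_cond_exp M F X z \<le> X z" by eventually_elim simp
  then show ?thesis using assms by (simp add: cond_le_def)
qed

lemma (in finite_measure) cond_le_sum:
  assumes F: "subalgebra M F" and "\<And>i. i \<in> I \<Longrightarrow> cond_le M F (X i) (Y i)"
  shows "cond_le M F (\<lambda>z. \<Sum>i\<in>I. X i z) (\<lambda>z. \<Sum>i\<in>I. Y i z)"
  using assms(2)
proof (induction I rule: infinite_finite_induct)
  case (insert i I)
  then show ?case using cond_le_add[OF F, of "X i" "Y i"] by simp
qed (use cond_le_refl[OF F, of "\<lambda>z. 0"] in simp_all)

lemma cond_le_mono: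
  assumes "cond_le M F X Y" "integrable M Y'" "\<And>z. z \<in> space M \<Longrightarrow> Y z \<le> Y' z"
  shows "cond_le M F X Y'"
proof -
  have "AE z in M. real_cond_exp M F X z \<le> Y z" "AE z in M. Y z \<le> Y' z"
    using assms by (auto simp: cond_le_def)
  then have "AE z in M. real_cond_exp M F X z \<le> Y' z" by eventually_elim simp
  then show ?thesis using assms by (simp add: cond_le_def)
qed

lemma (in finite_measure) cond_le_cong:
  assumes F: "subalgebra M F" and 1: "cond_le M F X Y" and eq: "\<And>z. z \<in> space M \<Longrightarrow> X' z = X z"
  shows "cond_le M F X' Y"
proof -
  interpret F: finite_measure_subalgebra M F using F by (rule cond_subalgebra)
  have X: "integrable M X" using 1 by (simp add: cond_le_def)
  then have X': "integrable M X'" using eq by (simp cong: Bochner_Integration.integrable_cong)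
  have "AE z in M. real_cond_exp M F X' z \<le> real_cond_exp M F X z"
    using X X' eq by (intro F.real_cond_exp_mono) auto
  moreover have "AE z in M. real_cond_exp M F X z \<le> Y z" using 1 by (simp add: cond_le_def)
  ultimately have "AE z in M. real_cond_exp M F X' z \<le> Y z" by eventually_elim simp
  then show ?thesis using 1 X' by (simp add: cond_le_def)
qed

lemma (in finite_measure) cond_le_coarser:
  assumes G: "subalgebra M G" and GF: "subalgebra G F" and 1: "cond_le M G X Y" and Y: "Y \<in> borel_measurable F"
  shows "cond_le M F X Y"
proof -
  have F: "subalgebra M F" using G GF by (auto simp: subalgebra_def)
  interpret F: finite_measure_subalgebra M F using F by (rule cond_subalgebra)
  interpret G: finite_measure_subalgebra M G using G by (rule cond_subalgebra)
  have int: "integrable M X" "integrable M Y" using 1 by (auto simp: cond_le_def)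
  have "AE z in M. real_cond_exp M F (real_cond_exp M G X) z = real_cond_exp M F X z"
    using int by (intro F.real_cond_exp_nested_subalg G GF)
  moreover have "AE z in M. real_cond_exp M F (real_cond_exp M G X) z \<le> real_cond_exp M F Y z"
    using 1 int by (intro F.real_cond_exp_mono G.real_cond_exp_int) (auto simp: cond_le_def)
  moreover have "AE z in M. real_cond_exp M F Y z = Y z" using int Y by (intro F.real_cond_exp_F_meas)
  ultimately have "AE z in M. real_cond_exp M F X z \<le> Y z" by eventually_elim simp
  then show ?thesis using int by (simp add: cond_le_def)
qed

lemma (in finite_measure) cond_le_expectation:
  assumes F: "subalgebra M F" and 1: "cond_le M F X Y"
  shows "(\<integral>z. X z \<partial>M) \<le> (\<integral>z. Y z \<partial>M)"
proof -
  interpret F: finite_measure_subalgebra M F using F by (rule cond_subalgebra)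
  have "(\<integral>z. X z \<partial>M) = (\<integral>z. real_cond_exp M F X z \<partial>M)"
    using 1 by (intro F.real_cond_exp_int(2)[symmetric]) (simp add: cond_le_def)
  also have "\<dots> \<le> (\<integral>z. Y z \<partial>M)"
    using 1 by (intro integral_mono_AE F.real_cond_exp_int) (auto simp: cond_le_def)
  finally show ?thesis .
qed

section \<open>The iteration as a stochastic process\<close>

locale delayed_diana = prob_space M for M :: "'w measure" +
  fixes f :: "nat \<Rightarrow> nat \<Rightarrow> 'a::euclidean_space \<Rightarrow> real"
    and N :: "'s measure" and Q :: "'s \<Rightarrow> 'a \<Rightarrow> 'a"
    and n m \<tau> :: nat and L \<mu> \<omega> p \<alpha> \<gamma> :: real
    and l :: "nat \<Rightarrow> nat \<Rightarrow> 'w \<Rightarrow> nat" and s :: "nat \<Rightarrow> nat \<Rightarrow> 'w \<Rightarrow> 's"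
    and c :: "nat \<Rightarrow> nat \<Rightarrow> 'w \<Rightarrow> bool"
    and xs x0 :: 'a and h0 w0 :: "nat \<Rightarrow> 'a"
    and x :: "nat \<Rightarrow> 'w \<Rightarrow> 'a" and g h w e :: "nat \<Rightarrow> nat \<Rightarrow> 'w \<Rightarrow> 'a"
  assumes n: "n \<ge> 1" and m: "m \<ge> 1" and L: "L > 0" and \<mu>: "\<mu> \<ge> 0" and \<omega>: "\<omega> > 0"
    and convex: "\<And>i j. i < n \<Longrightarrow> j < m \<Longrightarrow> convex_on UNIV (f i j)"
    and smooth: "\<And>i j. i < n \<Longrightarrow> j < m \<Longrightarrow> smooth L (f i j)"
    and qsc: "quasi_strongly_convex \<mu> (total_loss n m f) xs"
    and quant: "quantizer N \<omega> Q"
    and \<tau>: "\<tau> \<ge> 1" and p: "0 < p" "p < 1" and \<alpha>: "0 < \<alpha>" "\<alpha> \<le> 1 / (\<omega> + 1)"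
    and \<gamma>: "0 < \<gamma>"
    and stepsize: "\<gamma> \<le> min (1 / (8 * L * (37 / 9 + 24 * \<omega> / (3 * real n))))
      (1 / (8 * L * sqrt (real \<tau> * (2 + real \<tau> + 4 / (1 - p)
         + 4 * \<omega> / real n * (1 + 3 / (1 - \<alpha>) + 2 / (1 - p) + 4 / ((1 - \<alpha>) * (1 - p)))))))"
    and draws: "fresh_draws M N n m p l s c"
    and framework: "\<And>z. z \<in> space M \<Longrightarrow>
      delayed_framework n \<gamma> \<tau> x0 (\<lambda>k. x k z) (\<lambda>k i. g k i z) (\<lambda>k i. e k i z)"
    and iterates: "\<And>z. z \<in> space M \<Longrightarrow>
      lsvrg_diana n m f Q \<alpha> h0 w0 (\<lambda>k i. l k i z) (\<lambda>k i. s k i z) (\<lambda>k i. c k i z)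
        (\<lambda>k. x k z) (\<lambda>k i. h k i z) (\<lambda>k i. w k i z) (\<lambda>k i. g k i z)"
begin

abbreviation "gw i \<equiv> grad (worker_loss m f i)"
abbreviation "gt \<equiv> grad (total_loss n m f)"
abbreviation "D \<equiv> draw_space N"
abbreviation "gbar k z \<equiv> worker_mean n (\<lambda>i. g k i z)"
abbreviation "ebar k z \<equiv> worker_mean n (\<lambda>i. e k i z)"

definition drawn :: "nat \<times> nat \<Rightarrow> 'w \<Rightarrow> nat \<times> 's \<times> bool" where
  "drawn = (\<lambda>(k, i). draw l s c k i)"

definition before :: "nat \<Rightarrow> (nat \<times> nat) set" where
  "before k = {..<k} \<times> {..<n}"

abbreviation "\<F> J \<equiv> generated M D drawn J"

abbreviation "\<P> k \<equiv> \<F> (before k)"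

lemma worker_GDERIV: "i < n \<Longrightarrow> GDERIV (worker_loss m f i) y :> worker_mean m (\<lambda>j. grad (f i j) y)"
  unfolding worker_loss_def worker_mean_def
  by (intro GDERIV_scaled_sum smooth_GDERIV[OF smooth]) auto

lemma gw_eq: "i < n \<Longrightarrow> gw i y = worker_mean m (\<lambda>j. grad (f i j) y)"
  by (intro grad_eqI worker_GDERIV)

lemma total_GDERIV: "GDERIV (total_loss n m f) y :> worker_mean n (\<lambda>i. gw i y)"
  unfolding total_loss_def worker_mean_def
  by (intro GDERIV_scaled_sum) (use worker_GDERIV gw_eq in auto)

lemma gt_eq: "gt y = worker_mean n (\<lambda>i. gw i y)"
  by (intro grad_eqI total_GDERIV)

lemma \<alpha>_less_1: "\<alpha> < 1"
  using \<alpha> \<omega> by (smt (verit) divide_less_eq_1)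

lemma drawn_measurable: "i < n \<Longrightarrow> drawn (k, i) \<in> measurable M D"
  using draws by (auto simp: fresh_draws_def indep_vars_def drawn_def)

lemma drawn_law: "i < n \<Longrightarrow> distr M D (drawn (k, i)) = draw_law m N p"
  using draws by (auto simp: fresh_draws_def drawn_def draw_law_def)

lemma drawn_indep:
  assumes J: "J \<subseteq> UNIV \<times> {..<n}" and i: "i < n" "(k, i) \<notin> J"
  shows "\<forall>A\<in>sets (\<F> J). \<forall>B\<in>sets D.
    prob (A \<inter> (drawn (k, i) -` B \<inter> space M)) = prob A * prob (drawn (k, i) -` B \<inter> space M)"
proof (intro ballI indep_generated[OF _ J])
  show "indep_vars (\<lambda>_. D) drawn (UNIV \<times> {..<n})"
    using draws by (simp add: fresh_draws_def drawn_def)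
qed (use i in auto)

lemma \<F>_subalgebra: "J \<subseteq> UNIV \<times> {..<n} \<Longrightarrow> subalgebra M (\<F> J)"
  by (rule generated_subalgebra) (use drawn_measurable in auto)

lemma \<F>_mono_measurable: "X \<in> measurable (\<F> J) D' \<Longrightarrow> J \<subseteq> J' \<Longrightarrow> X \<in> measurable (\<F> J') D'"
  using generated_mono measurable_from_subalg by blast

lemma before_mono: "k \<le> k' \<Longrightarrow> before k \<subseteq> before k'"
  by (auto simp: before_def)

lemma before_subset: "before k \<subseteq> UNIV \<times> {..<n}"
  by (auto simp: before_def)

lemma \<F>_before_subalgebra: "subalgebra M (\<P> k)"
  by (intro \<F>_subalgebra before_subset)

section \<open>The recursions along a sample path\<close>

definition estimate :: "nat \<Rightarrow> nat \<Rightarrow> nat \<Rightarrow> 'w \<Rightarrow> 'a" where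
  "estimate k i j z = grad (f i j) (x k z) - grad (f i j) (w k i z) + gw i (w k i z)"

lemma
  assumes "z \<in> space M" "i < n"
  shows h_0: "h 0 i z = h0 i" and w_0: "w 0 i z = w0 i"
    and g_eq: "g k i z = h k i z + Q (s k i z) (estimate k i (l k i z) z - h k i z)"
    and h_Suc: "h (Suc k) i z = h k i z + \<alpha> *\<^sub>R (g k i z - h k i z)"
    and w_Suc: "w (Suc k) i z = (if c k i z then x k z else w k i z)"
  using iterates[OF assms(1)] assms(2) by (auto simp: lsvrg_diana_def Let_def estimate_def)

lemma
  assumes "z \<in> space M"
  shows x_0: "x 0 z = x0"
    and x_Suc: "x (Suc k) z = x k z - (if k \<ge> \<tau> then \<gamma> *\<^sub>R gbar (k - \<tau>) z else 0)"
    and e_0: "i < n \<Longrightarrow> e 0 i z = 0"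
    and e_Suc: "i < n \<Longrightarrow> e (Suc k) i z = e k i z + \<gamma> *\<^sub>R g k i z - (if k \<ge> \<tau> then \<gamma> *\<^sub>R g (k - \<tau>) i z else 0)"
  using framework[OF assms]
  by (auto simp: delayed_framework_def delayed_step_def worker_mean_def scaleR_sum_right[symmetric] scaleR_left_commute)

lemma ebar_0: "z \<in> space M \<Longrightarrow> ebar 0 z = 0"
  by (simp add: worker_mean_def e_0)

lemma ebar_Suc:
  assumes "z \<in> space M"
  shows "ebar (Suc k) z = ebar k z + \<gamma> *\<^sub>R gbar k z - (if k \<ge> \<tau> then \<gamma> *\<^sub>R gbar (k - \<tau>) z else 0)"
  using assms
  by (simp add: worker_mean_def e_Suc sum.distrib sum_subtractf scaleR_add_right scaleR_diff_right
      scaleR_sum_right[symmetric] scaleR_left_commute)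

text \<open>What enters the error leaves it again \<open>\<tau>\<close> iterations later, when it is applied.\<close>

lemma ebar_eq:
  assumes "z \<in> space M"
  shows "ebar k z = \<gamma> *\<^sub>R (\<Sum>t\<in>{k - \<tau>..<k}. gbar t z)"
proof (induction k)
  case (Suc k)
  show ?case
  proof (cases "k \<ge> \<tau>")
    case True
    have "(\<Sum>t\<in>{k - \<tau>..<Suc k}. gbar t z) = gbar (k - \<tau>) z + (\<Sum>t\<in>{Suc k - \<tau>..<Suc k}. gbar t z)"
      using True by (subst sum.atLeast_Suc_lessThan) (auto simp: Suc_diff_le)
    moreover have "(\<Sum>t\<in>{k - \<tau>..<Suc k}. gbar t z) = (\<Sum>t\<in>{k - \<tau>..<k}. gbar t z) + gbar k z"
      by (subst sum.atLeastLessThan_Suc) auto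
    ultimately have "(\<Sum>t\<in>{Suc k - \<tau>..<Suc k}. gbar t z) = (\<Sum>t\<in>{k - \<tau>..<k}. gbar t z) + gbar k z - gbar (k - \<tau>) z"
      by (simp add: algebra_simps)
    then show ?thesis using True by (simp add: ebar_Suc[OF assms] Suc scaleR_add_right scaleR_diff_right)
  next
    case False
    then have "k - \<tau> = 0" "Suc k - \<tau> = 0" by auto
    then show ?thesis using False by (simp add: ebar_Suc[OF assms] Suc scaleR_add_right)
  qed
qed (simp add: ebar_0[OF assms])

section \<open>Measurability with respect to past draws\<close>

lemma estimate_measurable:
  assumes "x k \<in> borel_measurable F" "w k i \<in> borel_measurable F"
  shows "estimate k i j \<in> borel_measurable F"
proof -
  note [measurable] = assms
  show ?thesis unfolding estimate_def[abs_def] by measurable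
qed

text \<open>The stochastic vector with its draw as a separate argument, which is the form that
  \<open>cond_exp_independent\<close> asks for.\<close>

definition fresh_g :: "nat \<Rightarrow> nat \<Rightarrow> 'w \<times> nat \<times> 's \<times> bool \<Rightarrow> 'a" where
  "fresh_g k i = (\<lambda>(z, j, t, b). h k i z + Q t (estimate k i j z - h k i z))"

lemma fresh_g_measurable:
  assumes [measurable]: "x k \<in> borel_measurable F" "w k i \<in> borel_measurable F" "h k i \<in> borel_measurable F"
  shows "fresh_g k i \<in> borel_measurable (F \<Otimes>\<^sub>M D)"
proof -
  have Q: "(\<lambda>(t, y). Q t y) \<in> borel_measurable (N \<Otimes>\<^sub>M borel)" using quant by (simp add: quantizer_def)
  have [measurable]: "estimate k i j \<in> borel_measurable F" for j by (rule estimate_measurable) fact+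
  have "(\<lambda>u. (fst (snd (snd u)), estimate k i j (fst u) - h k i (fst u))) \<in> measurable (F \<Otimes>\<^sub>M D) (N \<Otimes>\<^sub>M borel)" for j
    unfolding draw_space_def by measurable
  from measurable_compose[OF this Q]
  have 1: "(\<lambda>u. h k i (fst u) + Q (fst (snd (snd u))) (estimate k i j (fst u) - h k i (fst u)))
      \<in> borel_measurable (F \<Otimes>\<^sub>M D)" for j
    by (intro borel_measurable_add) simp_all
  have "(\<lambda>u. fst (snd u)) \<in> measurable (F \<Otimes>\<^sub>M D) (count_space UNIV)" unfolding draw_space_def by measurable
  from measurable_compose_countable[OF 1 this]
  show ?thesis by (simp add: fresh_g_def case_prod_beta')
qed

lemma g_fresh: "z \<in> space M \<Longrightarrow> i < n \<Longrightarrow> g k i z = fresh_g k i (z, drawn (k, i) z)"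
  by (simp add: g_eq fresh_g_def drawn_def draw_def)

lemma g_measurable_fresh:
  assumes "i < n" "(k, i) \<in> J" "x k \<in> borel_measurable (\<F> J)" "w k i \<in> borel_measurable (\<F> J)"
    "h k i \<in> borel_measurable (\<F> J)"
  shows "g k i \<in> borel_measurable (\<F> J)"
proof -
  have [measurable]: "drawn (k, i) \<in> measurable (\<F> J) D"
    using assms by (intro generated_measurable drawn_measurable)
  have pair: "(\<lambda>z. (z, drawn (k, i) z)) \<in> measurable (\<F> J) (\<F> J \<Otimes>\<^sub>M D)" by measurable
  have "fresh_g k i \<in> borel_measurable (\<F> J \<Otimes>\<^sub>M D)" using assms by (intro fresh_g_measurable)
  from measurable_compose[OF pair this]
  have "(\<lambda>z. fresh_g k i (z, drawn (k, i) z)) \<in> borel_measurable (\<F> J)" .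
  moreover have "g k i \<in> borel_measurable (\<F> J) \<longleftrightarrow> (\<lambda>z. fresh_g k i (z, drawn (k, i) z)) \<in> borel_measurable (\<F> J)"
    using assms(1) by (intro measurable_cong) (simp add: g_fresh)
  ultimately show ?thesis by simp
qed

lemma state_measurable:
  "x k \<in> borel_measurable (\<P> k) \<and>
   (\<forall>i<n. h k i \<in> borel_measurable (\<P> k) \<and> w k i \<in> borel_measurable (\<P> k)) \<and>
   (\<forall>t<k. \<forall>i<n. g t i \<in> borel_measurable (\<P> k))"
proof (induction k)
  case 0
  have "x 0 \<in> borel_measurable (\<P> 0) \<longleftrightarrow> (\<lambda>_. x0) \<in> borel_measurable (\<P> 0)"
    by (rule measurable_cong) (simp add: x_0)
  moreover have "h 0 i \<in> borel_measurable (\<P> 0) \<longleftrightarrow> (\<lambda>_. h0 i) \<in> borel_measurable (\<P> 0)"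
    "w 0 i \<in> borel_measurable (\<P> 0) \<longleftrightarrow> (\<lambda>_. w0 i) \<in> borel_measurable (\<P> 0)" if "i < n" for i
    using that by (intro measurable_cong; simp add: h_0 w_0)+
  ultimately show ?case by simp
next
  case (Suc k)
  let ?F = "\<P> k" and ?F' = "\<P> (Suc k)"
  have sub: "before k \<subseteq> before (Suc k)" by (rule before_mono) simp
  have up: "X \<in> borel_measurable ?F'" if "X \<in> borel_measurable ?F" for X :: "'w \<Rightarrow> 'a"
    using that sub by (rule \<F>_mono_measurable)
  have xm[measurable]: "x k \<in> borel_measurable ?F'" using Suc by (auto intro: up)
  have hm[measurable]: "h k i \<in> borel_measurable ?F'" and wm[measurable]: "w k i \<in> borel_measurable ?F'"
    if "i < n" for i
    using Suc that by (auto intro: up)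
  have dm[measurable]: "drawn (k, i) \<in> measurable ?F' D" if "i < n" for i
    using that by (intro generated_measurable drawn_measurable) (auto simp: before_def)
  have gk: "g k i \<in> borel_measurable ?F'" if i: "i < n" for i
    using i by (intro g_measurable_fresh xm hm wm) (auto simp: before_def)
  have gm: "g t i \<in> borel_measurable ?F'" if "t < Suc k" "i < n" for t i
    using that gk Suc by (cases "t = k") (auto intro: up)
  have "x (Suc k) \<in> borel_measurable ?F' \<longleftrightarrow>
      (\<lambda>z. x k z - (if k \<ge> \<tau> then \<gamma> *\<^sub>R gbar (k - \<tau>) z else 0)) \<in> borel_measurable ?F'"
    by (rule measurable_cong) (simp add: x_Suc)
  moreover have "(\<lambda>z. if k \<ge> \<tau> then \<gamma> *\<^sub>R gbar (k - \<tau>) z else 0) \<in> borel_measurable ?F'"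
  proof (cases "k \<ge> \<tau>")
    case True
    have "(\<lambda>z. gbar (k - \<tau>) z) \<in> borel_measurable ?F'"
      unfolding worker_mean_def using gm by (intro borel_measurable_scaleR borel_measurable_sum) auto
    then show ?thesis using True by simp
  qed simp
  ultimately have "x (Suc k) \<in> borel_measurable ?F'" using xm by simp
  moreover have "h (Suc k) i \<in> borel_measurable ?F'" if i: "i < n" for i
  proof -
    have "h (Suc k) i \<in> borel_measurable ?F' \<longleftrightarrow> (\<lambda>z. h k i z + \<alpha> *\<^sub>R (g k i z - h k i z)) \<in> borel_measurable ?F'"
      using i by (intro measurable_cong) (simp add: h_Suc)
    then show ?thesis using hm[OF i] gk[OF i] by simp
  qed
  moreover have "w (Suc k) i \<in> borel_measurable ?F'" if i: "i < n" for i
  proof -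
    have "w (Suc k) i \<in> borel_measurable ?F' \<longleftrightarrow>
        (\<lambda>z. if snd (snd (drawn (k, i) z)) then x k z else w k i z) \<in> borel_measurable ?F'"
      using i by (intro measurable_cong) (simp add: w_Suc drawn_def draw_def)
    moreover have "(\<lambda>z. snd (snd (drawn (k, i) z))) \<in> measurable ?F' (count_space UNIV)"
      using dm[OF i] unfolding draw_space_def by measurable
    ultimately show ?thesis using wm[OF i] xm by simp
  qed
  ultimately show ?case using gm by blast
qed

lemma
  shows x_measurable: "x k \<in> borel_measurable (\<P> k)"
    and h_measurable: "i < n \<Longrightarrow> h k i \<in> borel_measurable (\<P> k)"
    and w_measurable: "i < n \<Longrightarrow> w k i \<in> borel_measurable (\<P> k)"
    and g_measurable: "i < n \<Longrightarrow> g k i \<in> borel_measurable (\<P> (Suc k))"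
  using state_measurable[of k] state_measurable[of "Suc k"] by auto

lemma gbar_measurable: "t < k \<Longrightarrow> gbar t \<in> borel_measurable (\<P> k)"
  unfolding worker_mean_def
  using \<F>_mono_measurable[OF g_measurable before_mono[of "Suc t" k]]
  by (intro borel_measurable_scaleR borel_measurable_sum) auto

text \<open>The point \<open>x k\<close> is itself a function of the draws before iteration \<open>k\<close>, so having it among the
  generators changes nothing.\<close>

lemma past_eq: "past M N n l s c x k = \<P> k"
proof (rule measure_eqI)
  let ?G = "\<Union>t\<in>{..<k}. \<Union>i\<in>{..<n}. {draw l s c t i -` A \<inter> space M |A. A \<in> sets D}"
  let ?X = "{x k -` A \<inter> space M | A. A \<in> sets (borel :: 'a measure)}"
  have G: "(\<Union>q\<in>before k. {drawn q -` A \<inter> space M |A. A \<in> sets D}) = ?G"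
  proof -
    have times: "(\<Union>q\<in>A \<times> B. H q) = (\<Union>t\<in>A. \<Union>i\<in>B. H (t, i))"
      for A :: "nat set" and B :: "nat set" and H :: "nat \<times> nat \<Rightarrow> 'w set set" by auto
    show ?thesis unfolding before_def times drawn_def by simp
  qed
  have "?X \<subseteq> sets (\<P> k)"
    using measurable_sets[OF x_measurable[of k]] by auto
  then have "sigma_sets (space M) (?X \<union> ?G) \<subseteq> sets (\<P> k)"
    unfolding sets_generated G[symmetric] using sets.space_closed[of M]
    by (intro sigma_sets_mono) (auto simp: intro: sigma_sets.Basic)
  moreover have "sets (\<P> k) \<subseteq> sigma_sets (space M) (?X \<union> ?G)"
    unfolding sets_generated G by (intro sigma_sets_mono') auto
  moreover have "sets (past M N n l s c x k) = sigma_sets (space M) (?X \<union> ?G)"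
    unfolding past_def by (rule sets_measure_of) auto
  ultimately show "sets (past M N n l s c x k) = sets (\<P> k)" by auto
  show "emeasure (past M N n l s c x k) A = emeasure (\<P> k) A" for A
    by (simp add: past_def generated_def emeasure_sigma)
qed

end

context delayed_diana begin

section \<open>Conditional moments\<close>

definition noise :: "nat \<Rightarrow> nat \<Rightarrow> 'w \<Rightarrow> 'a" where
  "noise k i z = g k i z - gw i (x k z)"

definition estimate_var :: "nat \<Rightarrow> nat \<Rightarrow> 'w \<Rightarrow> real" where
  "estimate_var k i z = 1 / real m * (\<Sum>j<m. (norm (estimate k i j z - gw i (x k z)))\<^sup>2)"

text \<open>An upper bound for the conditional variance rather than the variance itself.\<close>

definition noise_var :: "nat \<Rightarrow> nat \<Rightarrow> 'w \<Rightarrow> real" where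
  "noise_var k i z = \<omega> * (norm (gw i (x k z) - h k i z))\<^sup>2 + (\<omega> + 1) * estimate_var k i z"

lemma estimate_mean: "i < n \<Longrightarrow> worker_mean m (\<lambda>j. estimate k i j z) = gw i (x k z)"
  using m by (simp add: worker_mean_def estimate_def gw_eq sum.distrib sum_subtractf
      sum_constant_scaleR scaleR_add_right scaleR_diff_right)

definition finite_moments :: "nat \<Rightarrow> bool" where
  "finite_moments k \<longleftrightarrow> in_L2 M (x k) \<and>
     (\<forall>i<n. in_L2 M (h k i) \<and> in_L2 M (w k i))"

lemma grad_in_L2:
  assumes "i < n" "j < m" "in_L2 M X"
  shows "in_L2 M (\<lambda>z. grad (f i j) (X z))"
  using assms(3) grad_borel_measurable
  by (rule in_L2_lipschitz[where v = 0]) (rule smooth_lipschitz[OF smooth[OF assms(1,2)]])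

lemma gw_in_L2:
  assumes "i < n" "in_L2 M X"
  shows "in_L2 M (\<lambda>z. gw i (X z))"
  unfolding gw_eq[OF assms(1)] using assms by (intro in_L2_mean grad_in_L2)

lemma gt_in_L2:
  assumes "in_L2 M X"
  shows "in_L2 M (\<lambda>z. gt (X z))"
  unfolding gt_eq using assms by (intro in_L2_mean gw_in_L2)

lemma estimate_in_L2:
  assumes "finite_moments k" "i < n" "j < m"
  shows "in_L2 M (estimate k i j)"
  unfolding estimate_def[abs_def] using assms
  by (intro in_L2_add in_L2_diff grad_in_L2 gw_in_L2)
    (auto simp: finite_moments_def)

lemma estimate_var_integrable:
  assumes "finite_moments k" "i < n"
  shows "integrable M (estimate_var k i)"
proof -
  have "in_L2 M (\<lambda>z. estimate k i j z - gw i (x k z))" if "j < m" for j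
    using assms that
    by (intro in_L2_diff estimate_in_L2 gw_in_L2) (auto simp: finite_moments_def)
  then show ?thesis unfolding estimate_var_def[abs_def] in_L2_def
    by (intro integrable_mult_right Bochner_Integration.integrable_sum) auto
qed

lemma noise_var_integrable:
  assumes "finite_moments k" "i < n"
  shows "integrable M (noise_var k i)"
proof -
  have "in_L2 M (\<lambda>z. gw i (x k z) - h k i z)"
    using assms by (intro in_L2_diff gw_in_L2) (auto simp: finite_moments_def)
  then show ?thesis
    unfolding noise_var_def[abs_def] using estimate_var_integrable[OF assms] by (simp add: in_L2_def)
qed

text \<open>Besides the past, \<open>J\<close> may contain the draws of other workers in iteration \<open>k\<close>.  This freedom gives
  the orthogonality of the noises of different workers.\<close>

lemma
  assumes k: "finite_moments k" and i: "i < n"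
    and J: "before k \<subseteq> J" "J \<subseteq> UNIV \<times> {..<n}" "(k, i) \<notin> J"
  shows noise_variance: "cond_le M (\<F> J) (\<lambda>z. (norm (noise k i z))\<^sup>2) (noise_var k i)"
    and noise_orthogonal: "Z \<in> borel_measurable (\<F> J) \<Longrightarrow> in_L2 M Z \<Longrightarrow>
      integrable M (\<lambda>z. noise k i z \<bullet> Z z) \<and>
      (AE z in M. real_cond_exp M (\<F> J) (\<lambda>z. noise k i z \<bullet> Z z) z = 0)"
proof -
  interpret F: finite_measure_subalgebra M "\<F> J" using J by (intro cond_subalgebra \<F>_subalgebra)
  note sub = \<F>_subalgebra[OF J(2)]
  have st[measurable]: "x k \<in> borel_measurable (\<F> J)" "h k i \<in> borel_measurable (\<F> J)" "w k i \<in> borel_measurable (\<F> J)"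
    using \<F>_mono_measurable[OF x_measurable J(1)] \<F>_mono_measurable[OF h_measurable[OF i] J(1)]
      \<F>_mono_measurable[OF w_measurable[OF i] J(1)] by auto
  have fm[measurable]: "fresh_g k i \<in> borel_measurable (\<F> J \<Otimes>\<^sub>M D)" by (intro fresh_g_measurable st)
  note fresh = cond_exp_independent[OF sub drawn_measurable[OF i] drawn_indep[OF J(2) i J(3)] _ drawn_law[OF i]]
  have fg: "fresh_g k i (z, y) = (case y of (j, t, b) \<Rightarrow> h k i z + Q t (estimate k i j z - h k i z))" for z y
    by (simp add: fresh_g_def)
  note mom = quantized_moments[OF quant m less_imp_le[OF \<omega>], where u = "\<lambda>j. estimate k i j z" and h = "h k i z" and p = p for z,
      unfolded estimate_mean[OF i]]
  let ?E = "\<lambda>z y. fresh_g k i (z, y) - gw i (x k z)"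
  have sq: "integrable (draw_law m N p) (\<lambda>y. (norm (?E z y))\<^sup>2)"
    "(\<integral>y. (norm (?E z y))\<^sup>2 \<partial>draw_law m N p) \<le> noise_var k i z" for z
    using mom(3,4)[of z] by (simp_all add: fg noise_var_def estimate_var_def case_prod_beta')
  have noise_eq: "noise k i z = ?E z (drawn (k, i) z)" if "z \<in> space M" for z
    using that i by (simp add: noise_def g_fresh)
  have sq': "integrable M (\<lambda>z. (norm (?E z (drawn (k, i) z)))\<^sup>2)"
    "AE z in M. real_cond_exp M (\<F> J) (\<lambda>z. (norm (?E z (drawn (k, i) z)))\<^sup>2) z
      = (\<integral>y. (norm (?E z y))\<^sup>2 \<partial>draw_law m N p)"
  proof -
    have m: "(\<lambda>u. (norm (fresh_g k i u - gw i (x k (fst u))))\<^sup>2) \<in> borel_measurable (\<F> J \<Otimes>\<^sub>M D)"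
      by measurable
    have i1: "integrable (draw_law m N p) (\<lambda>y. (norm (fresh_g k i (z, y) - gw i (x k (fst (z, y)))))\<^sup>2)"
      "(\<integral>y. \<bar>(norm (fresh_g k i (z, y) - gw i (x k (fst (z, y)))))\<^sup>2\<bar> \<partial>draw_law m N p) \<le> noise_var k i z" for z
      using sq[of z] by simp_all
    note r = fresh[OF m i1(1) i1(2) noise_var_integrable[OF k i]]
    show "integrable M (\<lambda>z. (norm (?E z (drawn (k, i) z)))\<^sup>2)"
      "AE z in M. real_cond_exp M (\<F> J) (\<lambda>z. (norm (?E z (drawn (k, i) z)))\<^sup>2) z
      = (\<integral>y. (norm (?E z y))\<^sup>2 \<partial>draw_law m N p)"
      using r(1,2) by (simp_all only: fst_conv)
  qed
  have "cond_le M (\<F> J) (\<lambda>z. (norm (?E z (drawn (k, i) z)))\<^sup>2) (noise_var k i)"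
    unfolding cond_le_def
  proof (intro conjI sq' noise_var_integrable k i)
    show "AE z in M. real_cond_exp M (\<F> J) (\<lambda>z. (norm (?E z (drawn (k, i) z)))\<^sup>2) z
        \<le> noise_var k i z"
      using sq'(2) by eventually_elim (use sq(2) in simp)
  qed
  from cond_le_cong[OF sub this]
  show var: "cond_le M (\<F> J) (\<lambda>z. (norm (noise k i z))\<^sup>2) (noise_var k i)" using noise_eq by simp
  assume Z[measurable]: "Z \<in> borel_measurable (\<F> J)" and ZI: "in_L2 M Z"
  have lin: "integrable (draw_law m N p) (\<lambda>y. ?E z y \<bullet> Z z)"
    "(\<integral>y. ?E z y \<bullet> Z z \<partial>draw_law m N p) = 0" for z
    using mom(1,2)[of z "Z z"] by (simp_all add: fg case_prod_beta')
  interpret law: prob_space "draw_law m N p"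
    unfolding drawn_law[OF i, of k, symmetric] by (rule prob_space_distr) (rule drawn_measurable[OF i])
  have bound: "(\<integral>y. \<bar>?E z y \<bullet> Z z\<bar> \<partial>draw_law m N p) \<le> noise_var k i z + (norm (Z z))\<^sup>2"
    for z
  proof -
    have "(\<integral>y. \<bar>?E z y \<bullet> Z z\<bar> \<partial>draw_law m N p)
      \<le> (\<integral>y. (norm (?E z y))\<^sup>2 + (norm (Z z))\<^sup>2 \<partial>draw_law m N p)"
    proof (intro integral_mono integrable_abs lin Bochner_Integration.integrable_add sq law.integrable_const)
      fix y
      let ?u = "?E z y"
      have "\<bar>?u \<bullet> Z z\<bar> \<le> norm ?u * norm (Z z)" by (rule Cauchy_Schwarz_ineq2)
      also have "2 * (norm ?u * norm (Z z)) \<le> (norm ?u)\<^sup>2 + (norm (Z z))\<^sup>2"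
        using sum_squares_bound[of "norm ?u" "norm (Z z)"] by simp
      finally have "2 * \<bar>?u \<bullet> Z z\<bar> \<le> (norm ?u)\<^sup>2 + (norm (Z z))\<^sup>2" by simp
      then show "\<bar>?u \<bullet> Z z\<bar> \<le> (norm ?u)\<^sup>2 + (norm (Z z))\<^sup>2" by linarith
    qed
    also have "\<dots> = (\<integral>y. (norm (?E z y))\<^sup>2 \<partial>draw_law m N p) + (norm (Z z))\<^sup>2"
      using sq(1)[of z] by (simp add: law.prob_space)
    finally show ?thesis using sq(2)[of z] by simp
  qed
  have bi: "integrable M (\<lambda>z. noise_var k i z + (norm (Z z))\<^sup>2)"
    using noise_var_integrable[OF k i] ZI by (simp add: in_L2_def)
  have lin': "integrable M (\<lambda>z. ?E z (drawn (k, i) z) \<bullet> Z z)"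
    "AE z in M. real_cond_exp M (\<F> J) (\<lambda>z. ?E z (drawn (k, i) z) \<bullet> Z z) z = 0"
  proof -
    have m: "(\<lambda>u. (fresh_g k i u - gw i (x k (fst u))) \<bullet> Z (fst u)) \<in> borel_measurable (\<F> J \<Otimes>\<^sub>M D)"
      by measurable
    have i1: "integrable (draw_law m N p) (\<lambda>y. (fresh_g k i (z, y) - gw i (x k (fst (z, y)))) \<bullet> Z (fst (z, y)))"
      "(\<integral>y. \<bar>(fresh_g k i (z, y) - gw i (x k (fst (z, y)))) \<bullet> Z (fst (z, y))\<bar> \<partial>draw_law m N p)
        \<le> noise_var k i z + (norm (Z z))\<^sup>2" for z
      using lin(1)[of z] bound[of z] by simp_all
    note r = fresh[OF m i1(1) i1(2) bi]
    show "integrable M (\<lambda>z. ?E z (drawn (k, i) z) \<bullet> Z z)"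
      "AE z in M. real_cond_exp M (\<F> J) (\<lambda>z. ?E z (drawn (k, i) z) \<bullet> Z z) z = 0"
      using r(1,2) by (simp_all only: fst_conv lin(2))
  qed
  have int: "integrable M (\<lambda>z. noise k i z \<bullet> Z z)"
    using lin'(1) by (simp add: noise_eq cong: Bochner_Integration.integrable_cong)
  have "AE z in M. real_cond_exp M (\<F> J) (\<lambda>z. noise k i z \<bullet> Z z) z
      = real_cond_exp M (\<F> J) (\<lambda>z. ?E z (drawn (k, i) z) \<bullet> Z z) z"
    using int lin'(1) by (intro F.real_cond_exp_cong AE_I2) (auto simp: noise_eq)
  then have "AE z in M. real_cond_exp M (\<F> J) (\<lambda>z. noise k i z \<bullet> Z z) z = 0"
    using lin'(2) by eventually_elim simp
  then show "integrable M (\<lambda>z. noise k i z \<bullet> Z z) \<and>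
      (AE z in M. real_cond_exp M (\<F> J) (\<lambda>z. noise k i z \<bullet> Z z) z = 0)" using int by simp
qed

lemma current_not_before: "(k, i) \<notin> before k"
  by (simp add: before_def)

lemma measurable_M: "X \<in> borel_measurable (\<P> k) \<Longrightarrow> X \<in> borel_measurable M"
  by (rule measurable_from_subalg[OF \<F>_before_subalgebra])

lemma noise_in_L2:
  assumes "finite_moments k" "i < n"
  shows "in_L2 M (noise k i)"
proof -
  have "noise k i \<in> borel_measurable M"
    unfolding noise_def[abs_def]
    using measurable_M[OF g_measurable[OF assms(2)]] measurable_M[OF x_measurable]
    by measurable
  then show ?thesis
    using noise_variance[OF assms order_refl before_subset current_not_before]
    by (simp add: in_L2_def cond_le_def)
qed

lemma g_in_L2':
  assumes "finite_moments k" "i < n"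
  shows "in_L2 M (g k i)"
proof -
  have "in_L2 M (\<lambda>z. noise k i z + gw i (x k z))"
    using assms by (intro in_L2_add noise_in_L2 gw_in_L2)
      (auto simp: finite_moments_def)
  then show ?thesis by (simp add: noise_def)
qed

text \<open>The state of iteration \<open>k\<close> determines the moments of the stochastic vectors of iteration \<open>k\<close>,
  and these enter the state at most linearly; so second moments stay finite.\<close>

lemma moments: "finite_moments k \<and> (\<forall>t<k. \<forall>i<n. in_L2 M (g t i))"
proof (induction k)
  case 0
  have "in_L2 M (x 0)"
    using in_L2_const[of x0] x_0 by (simp cong: in_L2_cong)
  moreover have "in_L2 M (h 0 i)" "in_L2 M (w 0 i)" if "i < n" for i
    using in_L2_const[of "h0 i"] in_L2_const[of "w0 i"] h_0[OF _ that] w_0[OF _ that]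
    by (simp_all cong: in_L2_cong)
  ultimately show ?case by (simp add: finite_moments_def)
next
  case (Suc k)
  then have k: "finite_moments k" by simp
  then have st: "in_L2 M (x k)" "\<And>i. i < n \<Longrightarrow> in_L2 M (h k i)"
    "\<And>i. i < n \<Longrightarrow> in_L2 M (w k i)" by (auto simp: finite_moments_def)
  have g: "in_L2 M (g t i)" if "t < Suc k" "i < n" for t i
    using that Suc g_in_L2'[OF k] by (cases "t = k") auto
  have "in_L2 M (\<lambda>z. x k z - (if k \<ge> \<tau> then \<gamma> *\<^sub>R gbar (k - \<tau>) z else 0))"
  proof (cases "k \<ge> \<tau>")
    case True
    have "in_L2 M (\<lambda>z. x k z - \<gamma> *\<^sub>R gbar (k - \<tau>) z)"
      by (intro in_L2_diff in_L2_scale in_L2_mean g st) auto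
    then show ?thesis using True by simp
  qed (use st in simp)
  then have "in_L2 M (x (Suc k))" using x_Suc by (simp cong: in_L2_cong)
  moreover have "in_L2 M (h (Suc k) i)" if i: "i < n" for i
  proof -
    have "in_L2 M (\<lambda>z. h k i z + \<alpha> *\<^sub>R (g k i z - h k i z))"
      using i by (intro in_L2_add in_L2_diff in_L2_scale g st) auto
    then show ?thesis using h_Suc[OF _ i] by (simp cong: in_L2_cong)
  qed
  moreover have "in_L2 M (w (Suc k) i)" if i: "i < n" for i
  proof (rule in_L2_dominated)
    show "w (Suc k) i \<in> borel_measurable M" using measurable_M[OF w_measurable[OF i]] .
    show "integrable M (\<lambda>z. (norm (x k z))\<^sup>2 + (norm (w k i z))\<^sup>2)"
      using st i by (auto simp: in_L2_def)
  qed (use w_Suc[OF _ i] in auto)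
  ultimately show ?case using g by (auto simp: finite_moments_def)
qed

lemma
  shows finite_moments: "finite_moments k"
    and x_in_L2: "in_L2 M (x k)"
    and h_in_L2: "i < n \<Longrightarrow> in_L2 M (h k i)"
    and w_in_L2: "i < n \<Longrightarrow> in_L2 M (w k i)"
    and g_in_L2: "i < n \<Longrightarrow> in_L2 M (g k i)"
  using moments[of k] moments[of "Suc k"] by (auto simp: finite_moments_def)

lemma gbar_in_L2: "in_L2 M (gbar k)"
  by (intro in_L2_mean g_in_L2)

definition noise_bar :: "nat \<Rightarrow> 'w \<Rightarrow> 'a" where
  "noise_bar k z = gbar k z - gt (x k z)"

lemma noise_bar_eq: "noise_bar k z = worker_mean n (\<lambda>i. noise k i z)"
  by (simp add: noise_bar_def noise_def gt_eq worker_mean_diff)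

lemma noise_bar_in_L2: "in_L2 M (noise_bar k)"
  unfolding noise_bar_eq[abs_def] by (intro in_L2_mean noise_in_L2 finite_moments)

lemma noise_bar_orthogonal:
  assumes "Z \<in> borel_measurable (\<P> k)" "in_L2 M Z"
  shows "AE z in M. real_cond_exp M (\<P> k) (\<lambda>z. noise_bar k z \<bullet> Z z) z = 0"
    and "integrable M (\<lambda>z. noise_bar k z \<bullet> Z z)"
proof -
  interpret F: finite_measure_subalgebra M "\<P> k" by (intro cond_subalgebra \<F>_before_subalgebra)
  note orth = noise_orthogonal[OF finite_moments _ order_refl before_subset current_not_before assms]
  have eq: "(\<lambda>z. noise_bar k z \<bullet> Z z) = (\<lambda>z. 1 / real n * (\<Sum>i\<in>{..<n}. noise k i z \<bullet> Z z))"
    by (simp add: noise_bar_eq worker_mean_def inner_sum_left)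
  have int: "integrable M (\<lambda>z. \<Sum>i\<in>{..<n}. noise k i z \<bullet> Z z)"
    using orth by (intro Bochner_Integration.integrable_sum) auto
  have "AE z in M. real_cond_exp M (\<P> k) (\<lambda>z. \<Sum>i\<in>{..<n}. noise k i z \<bullet> Z z) z
     = (\<Sum>i\<in>{..<n}. real_cond_exp M (\<P> k) (\<lambda>z. noise k i z \<bullet> Z z) z)"
  proof -
    have "AE z in M. real_cond_exp M (\<P> k) (\<lambda>z. \<Sum>i\<in>{..<n}. (if i < n then noise k i z \<bullet> Z z else 0)) z
     = (\<Sum>i\<in>{..<n}. real_cond_exp M (\<P> k) (\<lambda>z. if i < n then noise k i z \<bullet> Z z else 0) z)"
    proof (rule F.real_cond_exp_sum)
      show "integrable M (\<lambda>z. if i < n then noise k i z \<bullet> Z z else 0)" for i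
        using orth by (cases "i < n") auto
    qed
    moreover have "(\<Sum>i\<in>{..<n}. if i < n then noise k i z \<bullet> Z z else 0) = (\<Sum>i\<in>{..<n}. noise k i z \<bullet> Z z)" for z
      by (rule sum.cong) auto
    moreover have "(\<Sum>i\<in>{..<n}. real_cond_exp M (\<P> k) (\<lambda>z. if i < n then noise k i z \<bullet> Z z else 0) z)
        = (\<Sum>i\<in>{..<n}. real_cond_exp M (\<P> k) (\<lambda>z. noise k i z \<bullet> Z z) z)" for z
      by (rule sum.cong) auto
    ultimately show ?thesis by simp
  qed
  moreover have "AE z in M. \<forall>i\<in>{..<n}. real_cond_exp M (\<P> k) (\<lambda>z. noise k i z \<bullet> Z z) z = 0"
    using orth by (intro AE_finite_allI) auto
  moreover have "AE z in M. real_cond_exp M (\<P> k) (\<lambda>z. noise_bar k z \<bullet> Z z) z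
      = 1 / real n * real_cond_exp M (\<P> k) (\<lambda>z. \<Sum>i\<in>{..<n}. noise k i z \<bullet> Z z) z"
    unfolding eq by (rule F.real_cond_exp_cmult[OF int])
  ultimately show "AE z in M. real_cond_exp M (\<P> k) (\<lambda>z. noise_bar k z \<bullet> Z z) z = 0"
    by eventually_elim simp
  show "integrable M (\<lambda>z. noise_bar k z \<bullet> Z z)" unfolding eq using int by simp
qed

lemma gt_x_measurable: "(\<lambda>z. gt (x k z)) \<in> borel_measurable (\<P> k)"
  using x_measurable by measurable

lemma gbar_cond_exp:
  "AE z in M. vector_cond_exp M (\<P> k) (gbar k) z = gt (x k z)"
proof -
  interpret F: finite_measure_subalgebra M "\<P> k" by (intro cond_subalgebra \<F>_before_subalgebra)
  have "AE z in M. real_cond_exp M (\<P> k) (\<lambda>z. gbar k z \<bullet> b) z = gt (x k z) \<bullet> b" for b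
  proof -
    have 1: "integrable M (\<lambda>z. gt (x k z) \<bullet> b)"
      by (intro in_L2_inner gt_in_L2 x_in_L2 in_L2_const)
    have 2: "integrable M (\<lambda>z. noise_bar k z \<bullet> b)"
      "AE z in M. real_cond_exp M (\<P> k) (\<lambda>z. noise_bar k z \<bullet> b) z = 0"
      using noise_bar_orthogonal[of "\<lambda>_. b" k] by (simp_all add: in_L2_const)
    have "AE z in M. real_cond_exp M (\<P> k) (\<lambda>z. noise_bar k z \<bullet> b + gt (x k z) \<bullet> b) z
        = real_cond_exp M (\<P> k) (\<lambda>z. noise_bar k z \<bullet> b) z
          + real_cond_exp M (\<P> k) (\<lambda>z. gt (x k z) \<bullet> b) z"
      using 2(1) 1 by (rule F.real_cond_exp_add)
    moreover have "AE z in M. real_cond_exp M (\<P> k) (\<lambda>z. gt (x k z) \<bullet> b) z = gt (x k z) \<bullet> b"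
      using 1 gt_x_measurable by (intro F.real_cond_exp_F_meas) auto
    ultimately have "AE z in M. real_cond_exp M (\<P> k) (\<lambda>z. noise_bar k z \<bullet> b + gt (x k z) \<bullet> b) z
        = gt (x k z) \<bullet> b"
      using 2(2) by eventually_elim simp
    then show ?thesis by (simp add: noise_bar_def inner_diff_left)
  qed
  then have "AE z in M. \<forall>b\<in>Basis. real_cond_exp M (\<P> k) (\<lambda>z. gbar k z \<bullet> b) z = gt (x k z) \<bullet> b"
    by (intro AE_finite_allI) auto
  then show ?thesis
    by eventually_elim (simp add: vector_cond_exp_def euclidean_representation)
qed

text \<open>Like \<open>noise_var\<close>, an upper bound.\<close>

definition noise_bar_var :: "nat \<Rightarrow> 'w \<Rightarrow> real" where
  "noise_bar_var k z = 1 / (real n)\<^sup>2 * (\<Sum>i<n. noise_var k i z)"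

text \<open>The summands of the averaged noise are orthogonal: each has conditional mean zero even when all
  other draws of the same iteration are known.  Averaging therefore gains the factor \<open>1 / n\<close>.\<close>

lemma noise_bar_variance: "cond_le M (\<P> k) (\<lambda>z. (norm (noise_bar k z))\<^sup>2) (noise_bar_var k)"
proof -
  note sub = \<F>_before_subalgebra[of k]
  have pair: "cond_le M (\<P> k) (\<lambda>z. noise k i z \<bullet> noise k j z) (\<lambda>z. if i = j then noise_var k i z else 0)"
    if i: "i < n" and j: "j < n" for i j
  proof (cases "i = j")
    case True
    then show ?thesis
      using noise_variance[OF finite_moments i order_refl before_subset current_not_before]
      by (simp add: power2_norm_eq_inner)
  next
    case False
    define J where "J = before (Suc k) - {(k, i)}"
    have J: "before k \<subseteq> J" "J \<subseteq> UNIV \<times> {..<n}" "(k, i) \<notin> J" "(k, j) \<in> J"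
      using j False by (auto simp: J_def before_def)
    have "g k j \<in> borel_measurable (\<F> J)"
      by (intro g_measurable_fresh j J(4) \<F>_mono_measurable[OF x_measurable J(1)]
          \<F>_mono_measurable[OF h_measurable[OF j] J(1)] \<F>_mono_measurable[OF w_measurable[OF j] J(1)])
    moreover have "x k \<in> borel_measurable (\<F> J)" using x_measurable J(1) by (rule \<F>_mono_measurable)
    ultimately have "noise k j \<in> borel_measurable (\<F> J)" unfolding noise_def[abs_def] by measurable
    then have *: "integrable M (\<lambda>z. noise k i z \<bullet> noise k j z)"
      "AE z in M. real_cond_exp M (\<F> J) (\<lambda>z. noise k i z \<bullet> noise k j z) z = 0"
      using noise_orthogonal[OF finite_moments i J(1-3)] noise_in_L2[OF finite_moments j] by auto
    have "AE z in M. real_cond_exp M (\<F> J) (\<lambda>z. noise k i z \<bullet> noise k j z) z \<le> 0"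
      using *(2) by eventually_elim simp
    then have "cond_le M (\<F> J) (\<lambda>z. noise k i z \<bullet> noise k j z) (\<lambda>z. 0)"
      using *(1) by (simp add: cond_le_def)
    then have "cond_le M (\<P> k) (\<lambda>z. noise k i z \<bullet> noise k j z) (\<lambda>z. 0)"
      by (intro cond_le_coarser[OF \<F>_subalgebra[OF J(2)] generated_mono[OF J(1)]]) auto
    then show ?thesis using False by simp
  qed
  have "cond_le M (\<P> k) (\<lambda>z. 1 / (real n)\<^sup>2 * (\<Sum>i\<in>{..<n}. \<Sum>j\<in>{..<n}. noise k i z \<bullet> noise k j z))
      (\<lambda>z. 1 / (real n)\<^sup>2 * (\<Sum>i\<in>{..<n}. \<Sum>j\<in>{..<n}. if i = j then noise_var k i z else 0))"
    using pair by (intro cond_le_scale[OF sub] cond_le_sum[OF sub]) auto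
  moreover have "1 / (real n)\<^sup>2 * (\<Sum>i\<in>{..<n}. \<Sum>j\<in>{..<n}. noise k i z \<bullet> noise k j z) = (norm (noise_bar k z))\<^sup>2" for z
  proof -
    have "(norm (noise_bar k z))\<^sup>2 = (1 / real n)\<^sup>2 * (norm (\<Sum>i\<in>{..<n}. noise k i z))\<^sup>2"
      by (simp add: noise_bar_eq worker_mean_def power_divide)
    also have "(norm (\<Sum>i\<in>{..<n}. noise k i z))\<^sup>2 = (\<Sum>i\<in>{..<n}. \<Sum>j\<in>{..<n}. noise k i z \<bullet> noise k j z)"
      unfolding power2_norm_eq_inner inner_sum_left inner_sum_right by (subst sum.swap) simp
    finally show ?thesis by (simp add: power_divide)
  qed
  ultimately show ?thesis by (simp add: noise_bar_var_def[abs_def])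
qed

lemma gbar_second_moment:
  "cond_le M (\<P> k) (\<lambda>z. (norm (gbar k z))\<^sup>2) (\<lambda>z. (norm (gt (x k z)))\<^sup>2 + noise_bar_var k z)"
proof -
  note sub = \<F>_before_subalgebra[of k]
  have gt: "in_L2 M (\<lambda>z. gt (x k z))" by (intro gt_in_L2 x_in_L2)
  have "cond_le M (\<P> k) (\<lambda>z. noise_bar k z \<bullet> gt (x k z)) (\<lambda>z. 0)"
  proof -
    have "AE z in M. real_cond_exp M (\<P> k) (\<lambda>z. noise_bar k z \<bullet> gt (x k z)) z \<le> 0"
      using noise_bar_orthogonal(1)[OF gt_x_measurable gt] by eventually_elim simp
    then show ?thesis using noise_bar_orthogonal(2)[OF gt_x_measurable gt] by (simp add: cond_le_def)
  qed
  then have cross: "cond_le M (\<P> k) (\<lambda>z. 2 * (noise_bar k z \<bullet> gt (x k z))) (\<lambda>z. 2 * 0)"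
    by (intro cond_le_scale[OF sub]) auto
  have "cond_le M (\<P> k) (\<lambda>z. (norm (gt (x k z)))\<^sup>2) (\<lambda>z. (norm (gt (x k z)))\<^sup>2)"
    using gt gt_x_measurable by (intro cond_le_refl[OF sub]) (auto simp: in_L2_def)
  from cond_le_add[OF sub cond_le_add[OF sub this noise_bar_variance] cross]
  have "cond_le M (\<P> k)
      (\<lambda>z. (norm (gt (x k z)))\<^sup>2 + (norm (noise_bar k z))\<^sup>2 + 2 * (noise_bar k z \<bullet> gt (x k z)))
      (\<lambda>z. (norm (gt (x k z)))\<^sup>2 + noise_bar_var k z)" by simp
  moreover have "(norm (gbar k z))\<^sup>2 = (norm (gt (x k z)))\<^sup>2 + (norm (noise_bar k z))\<^sup>2 + 2 * (noise_bar k z \<bullet> gt (x k z))" for z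
    unfolding noise_bar_def power2_norm_eq_inner
    by (simp add: inner_diff_left inner_diff_right inner_commute algebra_simps)
  ultimately show ?thesis by simp
qed

end

context delayed_diana begin

section \<open>Recursions for the two auxiliary processes\<close>

text \<open>Two distances of gradients to their values at the minimizer: \<open>mean_gap\<close> averages over all
  summands, \<open>worker_gap\<close> over the workers after averaging within each worker.\<close>

definition gap :: "nat \<Rightarrow> 'a \<Rightarrow> real" where
  "gap i y = 1 / real m * (\<Sum>j<m. (norm (grad (f i j) y - grad (f i j) xs))\<^sup>2)"

definition mean_gap :: "'a \<Rightarrow> real" where
  "mean_gap y = 1 / real n * (\<Sum>i<n. gap i y)"

definition worker_gap :: "'a \<Rightarrow> real" where
  "worker_gap y = 1 / real n * (\<Sum>i<n. (norm (gw i y - gw i xs))\<^sup>2)"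

definition subopt :: "'a \<Rightarrow> real" where
  "subopt y = total_loss n m f y - total_loss n m f xs"

definition sig1 :: "nat \<Rightarrow> 'w \<Rightarrow> real" where
  "sig1 k z = 1 / real n * (\<Sum>i<n. (norm (h k i z - gw i xs))\<^sup>2)"

definition sig2 :: "nat \<Rightarrow> 'w \<Rightarrow> real" where
  "sig2 k z = 1 / real n * (\<Sum>i<n. gap i (w k i z))"

definition mean_estimate_var :: "nat \<Rightarrow> 'w \<Rightarrow> real" where
  "mean_estimate_var k z = 1 / real n * (\<Sum>i<n. estimate_var k i z)"

lemma gap_nonneg: "gap i y \<ge> 0"
  by (simp add: gap_def sum_nonneg)

lemma gap_measurable [measurable]: "gap i \<in> borel_measurable borel"
  unfolding gap_def[abs_def] by measurable

lemma gap_integrable: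
  assumes "i < n" "in_L2 M X"
  shows "integrable M (\<lambda>z. gap i (X z))"
proof -
  have "in_L2 M (\<lambda>z. grad (f i j) (X z) - grad (f i j) xs)" if "j < m" for j
    using assms that by (intro in_L2_diff grad_in_L2 in_L2_const)
  then show ?thesis unfolding gap_def in_L2_def
    by (intro integrable_mult_right Bochner_Integration.integrable_sum) auto
qed

lemma sig1_integrable: "integrable M (sig1 k)"
proof -
  have "in_L2 M (\<lambda>z. h k i z - gw i xs)" if "i < n" for i
    using that by (intro in_L2_diff h_in_L2 in_L2_const)
  then show ?thesis unfolding sig1_def[abs_def] in_L2_def
    by (intro integrable_mult_right Bochner_Integration.integrable_sum) auto
qed

lemma sig2_integrable: "integrable M (sig2 k)"
  unfolding sig2_def[abs_def]
  by (intro integrable_mult_right Bochner_Integration.integrable_sum gap_integrable w_in_L2) auto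

text \<open>The shift \<open>h\<close> moves the fraction \<open>\<alpha>\<close> of the way to a noisy gradient.  Since \<open>\<alpha> (\<omega> + 1) \<le> 1\<close>, the
  noise of size \<open>\<alpha>\<^sup>2 (\<omega> + 1)\<close> costs no more than a term of first order in \<open>\<alpha>\<close>, and the quantization
  error is absorbed by the strict convexity of the squared norm.\<close>

lemma sig1_step_worker:
  assumes i: "i < n"
  shows "cond_le M (\<P> k) (\<lambda>z. (norm (h (Suc k) i z - gw i xs))\<^sup>2)
    (\<lambda>z. (1 - \<alpha>) * (norm (h k i z - gw i xs))\<^sup>2
      + \<alpha> * ((norm (gw i (x k z) - gw i xs))\<^sup>2 + estimate_var k i z))"
proof -
  note sub = \<F>_before_subalgebra[of k]
  define B where "B z = (h k i z - gw i xs) + \<alpha> *\<^sub>R (gw i (x k z) - h k i z)" for z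
  have BF: "B \<in> borel_measurable (\<P> k)"
    unfolding B_def[abs_def] using x_measurable h_measurable[OF i] by measurable
  have BI: "in_L2 M B"
    unfolding B_def[abs_def] using i
    by (intro in_L2_add in_L2_diff in_L2_scale gw_in_L2
        x_in_L2 h_in_L2 in_L2_const)
  have 1: "cond_le M (\<P> k) (\<lambda>z. (norm (B z))\<^sup>2) (\<lambda>z. (norm (B z))\<^sup>2)"
    using BF BI by (intro cond_le_refl[OF sub]) (auto simp: in_L2_def)
  have 2: "cond_le M (\<P> k) (\<lambda>z. (2 * \<alpha>) * (noise k i z \<bullet> B z)) (\<lambda>z. (2 * \<alpha>) * 0)"
  proof (rule cond_le_scale[OF sub])
    note orth = noise_orthogonal[OF finite_moments i order_refl before_subset current_not_before BF BI]
    have "AE z in M. real_cond_exp M (\<P> k) (\<lambda>z. noise k i z \<bullet> B z) z \<le> 0"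
      using conjunct2[OF orth] by eventually_elim simp
    then show "cond_le M (\<P> k) (\<lambda>z. noise k i z \<bullet> B z) (\<lambda>z. 0)" using orth by (simp add: cond_le_def)
  qed (use \<alpha> in simp)
  have 3: "cond_le M (\<P> k) (\<lambda>z. \<alpha>\<^sup>2 * (norm (noise k i z))\<^sup>2) (\<lambda>z. \<alpha>\<^sup>2 * noise_var k i z)"
    by (intro cond_le_scale[OF sub] noise_variance[OF finite_moments i order_refl before_subset current_not_before]) simp
  have "cond_le M (\<P> k) (\<lambda>z. (norm (h (Suc k) i z - gw i xs))\<^sup>2)
      (\<lambda>z. (norm (B z))\<^sup>2 + (2 * \<alpha>) * 0 + \<alpha>\<^sup>2 * noise_var k i z)"
  proof (rule cond_le_cong[OF sub cond_le_add[OF sub cond_le_add[OF sub 1 2] 3]])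
    fix z assume z: "z \<in> space M"
    have "h (Suc k) i z - gw i xs = B z + \<alpha> *\<^sub>R noise k i z"
      by (simp add: h_Suc[OF z i] B_def noise_def algebra_simps)
    then show "(norm (h (Suc k) i z - gw i xs))\<^sup>2
        = (norm (B z))\<^sup>2 + (2 * \<alpha>) * (noise k i z \<bullet> B z) + \<alpha>\<^sup>2 * (norm (noise k i z))\<^sup>2"
      unfolding power2_norm_eq_inner
      by (simp add: inner_add_left inner_add_right inner_commute power2_eq_square)
  qed
  then show ?thesis
  proof (rule cond_le_mono)
    show "integrable M (\<lambda>z. (1 - \<alpha>) * (norm (h k i z - gw i xs))\<^sup>2
      + \<alpha> * ((norm (gw i (x k z) - gw i xs))\<^sup>2 + estimate_var k i z))"
    proof (intro Bochner_Integration.integrable_add integrable_mult_right estimate_var_integrable finite_moments i)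
      show "integrable M (\<lambda>z. (norm (h k i z - gw i xs))\<^sup>2)"
        using in_L2_diff[OF h_in_L2[OF i] in_L2_const] by (simp add: in_L2_def)
      show "integrable M (\<lambda>z. (norm (gw i (x k z) - gw i xs))\<^sup>2)"
        using in_L2_diff[OF gw_in_L2[OF i x_in_L2] in_L2_const]
        by (simp add: in_L2_def)
    qed
    fix z
    define u where "u = h k i z - gw i xs"
    define d where "d = gw i (x k z) - gw i xs"
    define V where "V = estimate_var k i z"
    have V: "V \<ge> 0" by (simp add: V_def estimate_var_def sum_nonneg)
    have \<alpha>\<omega>: "\<alpha> * (\<omega> + 1) \<le> 1" using \<alpha> \<omega> by (simp add: field_simps)
    have eq: "(norm (B z))\<^sup>2 = (norm u)\<^sup>2 + 2 * \<alpha> * (u \<bullet> (d - u)) + \<alpha>\<^sup>2 * (norm (d - u))\<^sup>2"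
      unfolding B_def u_def d_def power2_norm_eq_inner
      by (simp add: inner_add_left inner_add_right inner_commute power2_eq_square)
    have nv: "noise_var k i z = \<omega> * (norm (d - u))\<^sup>2 + (\<omega> + 1) * V"
      by (simp add: noise_var_def u_def d_def V_def)
    have "(\<alpha> * (\<omega> + 1)) * (\<alpha> * ((norm (d - u))\<^sup>2 + V)) \<le> 1 * (\<alpha> * ((norm (d - u))\<^sup>2 + V))"
      using \<alpha>\<omega> \<alpha> V by (intro mult_right_mono) auto
    then have "\<alpha>\<^sup>2 * (norm (d - u))\<^sup>2 + \<alpha>\<^sup>2 * noise_var k i z \<le> \<alpha> * (norm (d - u))\<^sup>2 + \<alpha> * V"
      unfolding nv by (simp add: power2_eq_square algebra_simps)
    then have "(norm (B z))\<^sup>2 + \<alpha>\<^sup>2 * noise_var k i z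
        \<le> (norm u)\<^sup>2 + 2 * \<alpha> * (u \<bullet> (d - u)) + \<alpha> * (norm (d - u))\<^sup>2 + \<alpha> * V"
      unfolding eq by linarith
    also have "\<dots> = (1 - \<alpha>) * (norm u)\<^sup>2 + \<alpha> * ((norm d)\<^sup>2 + V)"
      unfolding power2_norm_eq_inner
      by (simp add: inner_diff_left inner_diff_right inner_commute algebra_simps)
    finally show "(norm (B z))\<^sup>2 + (2 * \<alpha>) * 0 + \<alpha>\<^sup>2 * noise_var k i z
        \<le> (1 - \<alpha>) * (norm (h k i z - gw i xs))\<^sup>2
          + \<alpha> * ((norm (gw i (x k z) - gw i xs))\<^sup>2 + estimate_var k i z)"
      by (simp add: u_def d_def V_def)
  qed
qed

lemma sig1_step:
  "cond_le M (\<P> k) (sig1 (Suc k))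
    (\<lambda>z. (1 - \<alpha>) * sig1 k z + \<alpha> * (worker_gap (x k z) + mean_estimate_var k z))"
proof -
  note sub = \<F>_before_subalgebra[of k]
  have "cond_le M (\<P> k) (\<lambda>z. 1 / real n * (\<Sum>i\<in>{..<n}. (norm (h (Suc k) i z - gw i xs))\<^sup>2))
    (\<lambda>z. 1 / real n * (\<Sum>i\<in>{..<n}. (1 - \<alpha>) * (norm (h k i z - gw i xs))\<^sup>2
      + \<alpha> * ((norm (gw i (x k z) - gw i xs))\<^sup>2 + estimate_var k i z)))"
    using sig1_step_worker by (intro cond_le_scale[OF sub] cond_le_sum[OF sub]) auto
  moreover have "1 / real n * (\<Sum>i\<in>{..<n}. (1 - \<alpha>) * (norm (h k i z - gw i xs))\<^sup>2
      + \<alpha> * ((norm (gw i (x k z) - gw i xs))\<^sup>2 + estimate_var k i z))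
     = (1 - \<alpha>) * sig1 k z + \<alpha> * (worker_gap (x k z) + mean_estimate_var k z)" for z
    by (simp add: sig1_def worker_gap_def mean_estimate_var_def sum.distrib sum_distrib_left[symmetric]
        add_divide_distrib distrib_left)
  ultimately show ?thesis by (simp add: sig1_def[abs_def])
qed

lemma sig2_step_worker:
  assumes i: "i < n"
  shows "cond_le M (\<P> k) (\<lambda>z. gap i (w (Suc k) i z))
    (\<lambda>z. (1 - p) * gap i (w k i z) + p * gap i (x k z))"
proof -
  note sub = \<F>_before_subalgebra[of k]
  let ?b = "\<lambda>z. gap i (w k i z) + gap i (x k z)"
  let ?\<phi> = "\<lambda>u :: 'w \<times> nat \<times> 's \<times> bool.
    if snd (snd (snd u)) then gap i (x k (fst u)) else gap i (w k i (fst u))"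
  note [measurable] = x_measurable w_measurable[OF i]
  have N: "prob_space N" using quant by (simp add: quantizer_def)
  have \<phi>: "?\<phi> \<in> borel_measurable (\<P> k \<Otimes>\<^sub>M D)" 
  proof -
    have c: "(\<lambda>u. snd (snd (snd u))) \<in> measurable (F' \<Otimes>\<^sub>M D) (count_space UNIV)" for F' :: "'w measure"
      unfolding draw_space_def by measurable
    note [measurable] = c[of "\<P> k"]
    show ?thesis by measurable
  qed
  have int: "integrable (draw_law m N p) (\<lambda>y. ?\<phi> (z, y))"
    and val: "(\<integral>y. ?\<phi> (z, y) \<partial>draw_law m N p) = p * gap i (x k z) + (1 - p) * gap i (w k i z)" for z
    using draw_law_coin[OF N, of p m "\<lambda>b. if b then gap i (x k z) else gap i (w k i z)"] p
    by (simp_all add: case_prod_beta' cong: if_cong)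
  have abs: "(\<integral>y. \<bar>?\<phi> (z, y)\<bar> \<partial>draw_law m N p) \<le> ?b z" for z
  proof -
    have "(\<integral>y. \<bar>?\<phi> (z, y)\<bar> \<partial>draw_law m N p) = (\<integral>y. ?\<phi> (z, y) \<partial>draw_law m N p)"
      using gap_nonneg by (intro Bochner_Integration.integral_cong) auto
    also have "\<dots> \<le> 1 * gap i (x k z) + 1 * gap i (w k i z)"
      unfolding val using p gap_nonneg by (intro add_mono mult_right_mono) auto
    finally show ?thesis by simp
  qed
  have b: "integrable M ?b"
    using i by (intro Bochner_Integration.integrable_add gap_integrable x_in_L2 w_in_L2)
  note r = cond_exp_independent[OF sub drawn_measurable[OF i] drawn_indep[OF before_subset i current_not_before]
      \<phi> drawn_law[OF i] int abs b]
  have "cond_le M (\<P> k) (\<lambda>z. ?\<phi> (z, drawn (k, i) z)) (\<lambda>z. (1 - p) * gap i (w k i z) + p * gap i (x k z))"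
    unfolding cond_le_def
  proof (intro conjI r(1))
    show "integrable M (\<lambda>z. (1 - p) * gap i (w k i z) + p * gap i (x k z))"
      using i by (intro Bochner_Integration.integrable_add integrable_mult_right gap_integrable x_in_L2 w_in_L2)
    show "AE z in M. real_cond_exp M (\<P> k) (\<lambda>z. ?\<phi> (z, drawn (k, i) z)) z
        \<le> (1 - p) * gap i (w k i z) + p * gap i (x k z)"
      using r(2) unfolding val by eventually_elim simp
  qed
  then show ?thesis
    by (rule cond_le_cong[OF sub]) (simp add: w_Suc[OF _ i] drawn_def draw_def)
qed

lemma sig2_step:
  "cond_le M (\<P> k) (sig2 (Suc k)) (\<lambda>z. (1 - p) * sig2 k z + p * mean_gap (x k z))"
proof -
  note sub = \<F>_before_subalgebra[of k]
  have "cond_le M (\<P> k) (\<lambda>z. 1 / real n * (\<Sum>i\<in>{..<n}. gap i (w (Suc k) i z)))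
    (\<lambda>z. 1 / real n * (\<Sum>i\<in>{..<n}. (1 - p) * gap i (w k i z) + p * gap i (x k z)))"
    using sig2_step_worker by (intro cond_le_scale[OF sub] cond_le_sum[OF sub]) auto
  moreover have "1 / real n * (\<Sum>i\<in>{..<n}. (1 - p) * gap i (w k i z) + p * gap i (x k z))
      = (1 - p) * sig2 k z + p * mean_gap (x k z)" for z
    by (simp add: sig2_def mean_gap_def sum.distrib sum_distrib_left[symmetric] add_divide_distrib)
  ultimately show ?thesis by (simp add: sig2_def[abs_def])
qed


section \<open>Pointwise estimates\<close>

lemma minimizer: "total_loss n m f xs \<le> total_loss n m f y"
  using qsc by (auto simp: quasi_strongly_convex_def is_arg_min_linorder)

lemma gt_minimizer: "gt xs = 0"
  using GDERIV_minimum[OF total_GDERIV minimizer] grad_eqI[OF total_GDERIV] by metis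

lemma subopt_nonneg: "subopt y \<ge> 0"
  using minimizer by (simp add: subopt_def)

text \<open>The linear terms of the Bregman distances average to \<open>gt xs\<close>, which vanishes.\<close>

lemma mean_gap_le_subopt: "mean_gap y \<le> 2 * L * subopt y"
proof -
  have "mean_gap y \<le> 1 / real n * (\<Sum>i<n. 1 / real m * (\<Sum>j<m.
      2 * L * (f i j y - f i j xs - grad (f i j) xs \<bullet> (y - xs))))"
    unfolding mean_gap_def gap_def
    by (intro mult_left_mono sum_mono gradient_gap_le_bregman convex smooth L) auto
  also have "\<dots> = 2 * L * (total_loss n m f y - total_loss n m f xs
      - 1 / real n * (\<Sum>i<n. worker_mean m (\<lambda>j. grad (f i j) xs) \<bullet> (y - xs)))"
    by (simp add: total_loss_def worker_loss_def worker_mean_def inner_sum_left sum_subtractf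
        sum_distrib_left[symmetric] right_diff_distrib diff_divide_distrib sum_divide_distrib[symmetric])
  also have "1 / real n * (\<Sum>i<n. worker_mean m (\<lambda>j. grad (f i j) xs) \<bullet> (y - xs)) = gt xs \<bullet> (y - xs)"
    by (simp add: gt_eq worker_mean_def gw_eq inner_sum_left)
  also have "\<dots> = 0" by (simp add: gt_minimizer)
  finally show ?thesis by (simp add: subopt_def)
qed

lemma gap_mean:
  assumes "i < n"
  shows "worker_mean m (\<lambda>j. grad (f i j) y - grad (f i j) xs) = gw i y - gw i xs"
  using assms by (simp add: gw_eq worker_mean_diff)

lemma worker_gap_le: "worker_gap y \<le> mean_gap y"
  unfolding worker_gap_def mean_gap_def gap_def
proof (intro mult_left_mono sum_mono)
  fix i assume "i \<in> {..<n}"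
  then show "(norm (gw i y - gw i xs))\<^sup>2 \<le> 1 / real m * (\<Sum>j<m. (norm (grad (f i j) y - grad (f i j) xs))\<^sup>2)"
    using worker_mean_jensen[OF m, of "\<lambda>j. grad (f i j) y - grad (f i j) xs"] gap_mean by simp
qed simp

lemma gt_le_worker_gap: "(norm (gt y))\<^sup>2 \<le> worker_gap y"
proof -
  have "gt y = worker_mean n (\<lambda>i. gw i y - gw i xs)"
    using gt_minimizer by (simp add: gt_eq worker_mean_diff[symmetric])
  then show ?thesis unfolding worker_gap_def using worker_mean_jensen[OF n] by simp
qed

text \<open>Young's inequality is applied after centering, so that only the part of \<open>mean_gap\<close> that is not
  already in \<open>worker_gap\<close> contributes.  The final constants depend on this saving.\<close>

lemma mean_estimate_var_le:
  assumes "\<beta> > 0"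
  shows "mean_estimate_var k z \<le> (1 + \<beta>) * (mean_gap (x k z) - worker_gap (x k z)) + (1 + 1 / \<beta>) * sig2 k z"
proof -
  have "estimate_var k i z \<le> (1 + \<beta>) * (gap i (x k z) - (norm (gw i (x k z) - gw i xs))\<^sup>2)
      + (1 + 1 / \<beta>) * gap i (w k i z)" if i: "i < n" for i
  proof -
    define a where "a j = grad (f i j) (x k z) - grad (f i j) xs" for j
    define b where "b j = grad (f i j) (w k i z) - grad (f i j) xs" for j
    have am: "worker_mean m a = gw i (x k z) - gw i xs" and bm: "worker_mean m b = gw i (w k i z) - gw i xs"
      unfolding a_def b_def using gap_mean[OF i] by auto
    have "estimate k i j z - gw i (x k z) = (a j - worker_mean m a) - (b j - worker_mean m b)" for j
      unfolding am bm by (simp add: estimate_def a_def b_def algebra_simps)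
    then have "estimate_var k i z = 1 / real m * (\<Sum>j<m. (norm ((a j - worker_mean m a) - (b j - worker_mean m b)))\<^sup>2)"
      by (simp add: estimate_var_def)
    also have "\<dots> \<le> 1 / real m * (\<Sum>j<m. (1 + \<beta>) * (norm (a j - worker_mean m a))\<^sup>2
        + (1 + 1 / \<beta>) * (norm (b j - worker_mean m b))\<^sup>2)"
      by (intro mult_left_mono sum_mono norm_diff_young assms) simp
    also have "\<dots> = (1 + \<beta>) * (1 / real m * (\<Sum>j<m. (norm (a j - worker_mean m a))\<^sup>2))
        + (1 + 1 / \<beta>) * (1 / real m * (\<Sum>j<m. (norm (b j - worker_mean m b))\<^sup>2))"
      unfolding sum.distrib sum_distrib_left[symmetric] distrib_left by (simp only: mult.left_commute)
    also have "1 / real m * (\<Sum>j<m. (norm (a j - worker_mean m a))\<^sup>2) = gap i (x k z) - (norm (gw i (x k z) - gw i xs))\<^sup>2"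
      using worker_mean_variance[OF m, of a 0] unfolding am by (simp add: gap_def a_def)
    also have "1 / real m * (\<Sum>j<m. (norm (b j - worker_mean m b))\<^sup>2) \<le> gap i (w k i z)"
      using worker_mean_variance[OF m, of b 0] unfolding bm by (simp add: gap_def b_def)
    finally show ?thesis using assms by (simp add: mult_left_mono)
  qed
  then have "mean_estimate_var k z \<le> 1 / real n * (\<Sum>i<n. (1 + \<beta>) * (gap i (x k z) - (norm (gw i (x k z) - gw i xs))\<^sup>2)
      + (1 + 1 / \<beta>) * gap i (w k i z))"
    unfolding mean_estimate_var_def by (intro mult_left_mono sum_mono) auto
  also have "\<dots> = (1 + \<beta>) * (mean_gap (x k z) - worker_gap (x k z)) + (1 + 1 / \<beta>) * sig2 k z"
    unfolding mean_gap_def worker_gap_def sig2_def sum.distrib sum_distrib_left[symmetric] distrib_left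
      sum_subtractf right_diff_distrib[of "1 / real n"]
    by (simp only: mult.left_commute)
       (simp add: right_diff_distrib diff_divide_distrib)
  finally show ?thesis .
qed

text \<open>How far the shifts are from the gradients they should approximate; this is what the quantizer
  has to transmit.\<close>

definition shift_gap :: "nat \<Rightarrow> 'w \<Rightarrow> real" where
  "shift_gap k z = 1 / real n * (\<Sum>i<n. (norm (gw i (x k z) - h k i z))\<^sup>2)"

lemma noise_bar_var_eq:
  "noise_bar_var k z = \<omega> / real n * shift_gap k z + (\<omega> / real n + 1 / real n) * mean_estimate_var k z"
proof -
  have "real n > 0" using n by simp
  then show ?thesis
    unfolding noise_bar_var_def noise_var_def shift_gap_def mean_estimate_var_def sum.distrib sum_distrib_left[symmetric]
    by (simp add: field_simps) (simp add: power2_eq_square algebra_simps)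
qed

lemma shift_gap_le:
  assumes "\<beta> > 0"
  shows "shift_gap k z \<le> (1 + \<beta>) * worker_gap (x k z) + (1 + 1 / \<beta>) * sig1 k z"
proof -
  have "shift_gap k z \<le> 1 / real n * (\<Sum>i<n. (1 + \<beta>) * (norm (gw i (x k z) - gw i xs))\<^sup>2
      + (1 + 1 / \<beta>) * (norm (h k i z - gw i xs))\<^sup>2)"
    unfolding shift_gap_def
  proof (intro mult_left_mono sum_mono)
    fix i
    show "(norm (gw i (x k z) - h k i z))\<^sup>2 \<le> (1 + \<beta>) * (norm (gw i (x k z) - gw i xs))\<^sup>2
      + (1 + 1 / \<beta>) * (norm (h k i z - gw i xs))\<^sup>2"
      using norm_diff_young[OF assms, of "gw i (x k z) - gw i xs" "h k i z - gw i xs"] by simp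
  qed simp
  also have "\<dots> = (1 + \<beta>) * worker_gap (x k z) + (1 + 1 / \<beta>) * sig1 k z"
    unfolding worker_gap_def sig1_def sum.distrib sum_distrib_left[symmetric] distrib_left
    by (simp only: mult.left_commute)
  finally show ?thesis .
qed

lemma worker_gap_nonneg: "worker_gap y \<ge> 0"
  by (simp add: worker_gap_def sum_nonneg)

lemma sig1_nonneg: "sig1 k z \<ge> 0"
  by (simp add: sig1_def sum_nonneg)

lemma sig2_nonneg: "sig2 k z \<ge> 0"
  by (simp add: sig2_def gap_nonneg sum_nonneg)

lemma mean_estimate_var_nonneg: "mean_estimate_var k z \<ge> 0"
  by (simp add: mean_estimate_var_def estimate_var_def sum_nonneg)

lemma gt_le_subopt: "(norm (gt y))\<^sup>2 \<le> 2 * L * subopt y"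
  using gt_le_worker_gap worker_gap_le mean_gap_le_subopt order_trans by meson

lemma ratio_bounds: "\<omega> / real n \<ge> 0" "0 \<le> 1 / real n" "1 / real n \<le> 1"
  using \<omega> n by auto

lemma noise_bar_var_le:
  "noise_bar_var k z \<le> 2 * (\<omega> / real n) * sig1 k z + 2 * (1 + \<omega> / real n) * sig2 k z
     + 2 * (1 + \<omega> / real n) * mean_gap (x k z) - 2 * worker_gap (x k z)"
proof -
  define r where "r = \<omega> / real n"
  note r = ratio_bounds[folded r_def]
  have 1: "r * shift_gap k z \<le> r * (2 * worker_gap (x k z) + 2 * sig1 k z)"
    using shift_gap_le[of 1 k z] r by (intro mult_left_mono) auto
  have "(r + 1 / real n) * mean_estimate_var k z \<le> (r + 1) * mean_estimate_var k z"
    using r mean_estimate_var_nonneg by (intro mult_right_mono) auto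
  also have "\<dots> \<le> (r + 1) * (2 * (mean_gap (x k z) - worker_gap (x k z)) + 2 * sig2 k z)"
    using mean_estimate_var_le[of 1 k z] r by (intro mult_left_mono) auto
  finally show ?thesis
    using 1 unfolding noise_bar_var_eq r_def[symmetric] by (simp add: algebra_simps)
qed

end

section \<open>Geometrically weighted sums\<close>

lemma weight_pos: "\<eta> < 1 \<Longrightarrow> weight \<eta> k > 0"
  by (simp add: weight_def)

lemma weight_step: "\<eta> < 1 \<Longrightarrow> weight \<eta> (Suc k) * (1 - \<eta>) = weight \<eta> k"
  by (simp add: weight_def)

lemma weight_first: "\<eta> < 1 \<Longrightarrow> weight \<eta> 0 * (1 - \<eta>) = 1"
  by (simp add: weight_def)

text \<open>Since \<open>weight \<eta> (Suc k) * (1 - \<eta>) = weight \<eta> k\<close>, the weighted recursion telescopes.\<close>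

lemma weighted_recursion:
  fixes S b :: "nat \<Rightarrow> real"
  assumes \<eta>: "\<eta> < 1" and rec: "\<And>k. S (Suc k) \<le> (1 - \<rho>) * S k + b k"
  shows "(\<rho> - \<eta>) * (\<Sum>k\<le>K. weight \<eta> k * S k) + (1 - \<rho>) * (weight \<eta> K * S K)
    \<le> S 0 + (\<Sum>k<K. weight \<eta> k * b k)"
proof (induction K)
  case 0
  have "(\<rho> - \<eta>) * (weight \<eta> 0 * S 0) + (1 - \<rho>) * (weight \<eta> 0 * S 0) = (weight \<eta> 0 * (1 - \<eta>)) * S 0"
    by (simp add: algebra_simps)
  then show ?case by (simp add: weight_first[OF \<eta>])
next
  case (Suc K)
  have "(\<rho> - \<eta>) * (weight \<eta> (Suc K) * S (Suc K)) + (1 - \<rho>) * (weight \<eta> (Suc K) * S (Suc K))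
      = (weight \<eta> (Suc K) * (1 - \<eta>)) * S (Suc K)"
    by (simp add: algebra_simps)
  also have "\<dots> \<le> weight \<eta> K * ((1 - \<rho>) * S K + b K)"
    unfolding weight_step[OF \<eta>] using rec weight_pos[OF \<eta>] by (intro mult_left_mono) (auto simp: less_imp_le)
  finally show ?case using Suc by (simp add: algebra_simps)
qed

lemma weighted_contraction:
  fixes S b :: "nat \<Rightarrow> real"
  assumes \<eta>: "\<eta> \<le> \<rho> / 4" and \<rho>: "0 < \<rho>" "\<rho> \<le> 1"
    and rec: "\<And>k. S (Suc k) \<le> (1 - \<rho>) * S k + b k"
    and S: "\<And>k. S k \<ge> 0" and b: "\<And>k. b k \<ge> 0"
  shows "(\<Sum>k\<le>K. weight \<eta> k * S k) \<le> 4 / (3 * \<rho>) * (S 0 + (\<Sum>k\<le>K. weight \<eta> k * b k))"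
proof -
  have \<eta>1: "\<eta> < 1" using \<eta> \<rho> by linarith
  note wp = weight_pos[OF \<eta>1]
  let ?\<Sigma> = "\<Sum>k\<le>K. weight \<eta> k * S k"
  have \<Sigma>: "?\<Sigma> \<ge> 0" using S wp by (intro sum_nonneg mult_nonneg_nonneg) (auto simp: less_imp_le)
  have "3 / 4 * \<rho> * ?\<Sigma> \<le> (\<rho> - \<eta>) * ?\<Sigma>" using \<eta> \<Sigma> by (intro mult_right_mono) auto
  also have "\<dots> \<le> (\<rho> - \<eta>) * ?\<Sigma> + (1 - \<rho>) * (weight \<eta> K * S K)"
    using \<rho> S wp[of K] by (simp add: less_imp_le)
  also have "\<dots> \<le> S 0 + (\<Sum>k<K. weight \<eta> k * b k)" by (intro weighted_recursion \<eta>1 rec)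
  also have "\<dots> \<le> S 0 + (\<Sum>k\<le>K. weight \<eta> k * b k)"
    using b wp by (intro add_left_mono sum_mono2) (auto simp: less_imp_le)
  finally show ?thesis using \<rho> by (simp add: field_simps)
qed

lemma weighted_telescope:
  fixes \<Phi> a :: "nat \<Rightarrow> real"
  assumes \<eta>: "\<eta> < 1" and rec: "\<And>k. \<Phi> (Suc k) \<le> (1 - \<eta>) * \<Phi> k - a k" and \<Phi>: "\<And>k. \<Phi> k \<ge> 0"
  shows "(\<Sum>k\<le>K. weight \<eta> k * a k) \<le> \<Phi> 0"
proof -
  have "0 + (1 - \<eta>) * (weight \<eta> (Suc K) * \<Phi> (Suc K)) \<le> \<Phi> 0 + (\<Sum>k<Suc K. weight \<eta> k * (- a k))"
    using weighted_recursion[of \<eta> \<Phi> \<eta> "\<lambda>k. - a k" "Suc K"] \<eta> rec by simp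
  moreover have "(1 - \<eta>) * (weight \<eta> (Suc K) * \<Phi> (Suc K)) \<ge> 0"
    using \<eta> \<Phi> weight_pos[OF \<eta>, of "Suc K"] by (simp add: less_imp_le)
  ultimately show ?thesis by (simp add: sum_negf lessThan_Suc_atMost del: sum.lessThan_Suc)
qed

text \<open>Weights grow by at most the factor \<open>16 / 15\<close> within a window of length \<open>\<tau>\<close>, and every term
  lies in at most \<open>\<tau>\<close> windows.\<close>

lemma weighted_delay:
  fixes a :: "nat \<Rightarrow> real"
  assumes \<eta>: "0 \<le> \<eta>" "\<eta> \<le> 1 / (16 * real \<tau>)" and \<tau>: "\<tau> \<ge> 1" and a: "\<And>k. a k \<ge> 0"
  shows "(\<Sum>k\<le>K. weight \<eta> k * (\<Sum>t\<in>{k - \<tau>..<k}. a t)) \<le> 16 / 15 * real \<tau> * (\<Sum>k\<le>K. weight \<eta> k * a k)"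
proof -
  have "1 / (16 * real \<tau>) \<le> 1 / 16" using \<tau> by (intro divide_left_mono) auto
  then have \<eta>1: "\<eta> < 1" using \<eta>(2) by linarith
  note wp = weight_pos[OF \<eta>1]
  have small: "real \<tau> * \<eta> \<le> 1 / 16" using \<eta>(2) \<tau> by (simp add: field_simps)
  have w: "weight \<eta> k \<le> 16 / 15 * weight \<eta> t" if "t < k" "k \<le> t + \<tau>" for k t
  proof -
    \<comment> \<open>Bernoulli's inequality with \<open>\<tau> * \<eta> \<le> 1 / 16\<close> is the source of 16/15.\<close>
    have "15 / 16 \<le> 1 + real \<tau> * (- \<eta>)" using small by simp
    also have "\<dots> \<le> (1 + (- \<eta>)) ^ \<tau>" using \<eta>1 by (intro Bernoulli_inequality) simp
    also have "\<dots> \<le> (1 - \<eta>) ^ (k - t)" using that \<eta> \<eta>1 by (simp add: power_decreasing)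
    finally have 1: "15 / 16 \<le> (1 - \<eta>) ^ (k - t)" .
    have "(1 - \<eta>) ^ (k + 1) = (1 - \<eta>) ^ (t + 1) * (1 - \<eta>) ^ (k - t)"
      using that by (simp add: power_add[symmetric])
    then have "weight \<eta> t = weight \<eta> k * (1 - \<eta>) ^ (k - t)"
      using \<eta>1 by (simp add: weight_def field_simps)
    moreover have "weight \<eta> k * (15 / 16) \<le> weight \<eta> k * (1 - \<eta>) ^ (k - t)"
      using 1 wp[of k] by (intro mult_left_mono) (auto simp: less_imp_le)
    ultimately show ?thesis by simp
  qed
  let ?I = "\<lambda>k t. if k - \<tau> \<le> t \<and> t < k then 1 else 0 :: real"
  have "(\<Sum>k\<le>K. weight \<eta> k * (\<Sum>t\<in>{k - \<tau>..<k}. a t)) = (\<Sum>k\<le>K. \<Sum>t\<le>K. ?I k t * (weight \<eta> k * a t))"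
  proof (intro sum.cong refl)
    fix k assume "k \<in> {..K}"
    then have "{k - \<tau>..<k} = {t \<in> {..K}. k - \<tau> \<le> t \<and> t < k}" by auto
    then have "(\<Sum>t\<in>{k - \<tau>..<k}. a t) = (\<Sum>t\<le>K. if k - \<tau> \<le> t \<and> t < k then a t else 0)"
      by (simp add: sum.If_cases Int_def)
    also have "weight \<eta> k * \<dots> = (\<Sum>t\<le>K. ?I k t * (weight \<eta> k * a t))"
      unfolding sum_distrib_left by (intro sum.cong) auto
    finally show "weight \<eta> k * (\<Sum>t\<in>{k - \<tau>..<k}. a t) = (\<Sum>t\<le>K. ?I k t * (weight \<eta> k * a t))" .
  qed
  also have "\<dots> \<le> (\<Sum>k\<le>K. \<Sum>t\<le>K. ?I k t * (16 / 15 * weight \<eta> t * a t))"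
  proof (intro sum_mono)
    fix k t
    show "?I k t * (weight \<eta> k * a t) \<le> ?I k t * (16 / 15 * weight \<eta> t * a t)"
      using mult_right_mono[OF w[of t k] a[of t]] by (cases "k - \<tau> \<le> t \<and> t < k") auto
  qed
  also have "\<dots> = (\<Sum>t\<le>K. \<Sum>k\<le>K. ?I k t * (16 / 15 * weight \<eta> t * a t))" by (rule sum.swap)
  also have "\<dots> = (\<Sum>t\<le>K. (\<Sum>k\<le>K. ?I k t) * (16 / 15 * weight \<eta> t * a t))" by (simp only: sum_distrib_right)
  also have "\<dots> \<le> (\<Sum>t\<le>K. real \<tau> * (16 / 15 * weight \<eta> t * a t))"
  proof (intro sum_mono mult_right_mono)
    fix t
    have "(\<Sum>k\<le>K. ?I k t) = real (card {k \<in> {..K}. k - \<tau> \<le> t \<and> t < k})"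
      by (simp add: sum.If_cases Int_def)
    also have "card {k \<in> {..K}. k - \<tau> \<le> t \<and> t < k} \<le> card {t<..t + \<tau>}"
      by (intro card_mono) auto
    finally show "(\<Sum>k\<le>K. ?I k t) \<le> real \<tau>" by simp
    show "0 \<le> 16 / 15 * weight \<eta> t * a t" using wp[of t] a[of t] by (simp add: less_imp_le)
  qed
  also have "\<dots> = 16 / 15 * real \<tau> * (\<Sum>k\<le>K. weight \<eta> k * a k)"
    by (simp add: sum_distrib_left mult_ac)
  finally show ?thesis .
qed


context delayed_diana begin

section \<open>Bounds in terms of the suboptimality\<close>

lemma total_loss_measurable [measurable]: "total_loss n m f \<in> borel_measurable borel"
proof (intro borel_measurable_continuous_onI continuous_at_imp_continuous_on ballI)
  show "isCont (total_loss n m f) y" for y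
    using total_GDERIV[of y] unfolding gderiv_def by (rule has_derivative_continuous)
qed

lemma subopt_measurable [measurable]: "subopt \<in> borel_measurable borel"
  unfolding subopt_def[abs_def] by measurable

lemma quasi_convexity: "subopt y + \<mu> / 2 * (norm (y - xs))\<^sup>2 \<le> gt y \<bullet> (y - xs)"
proof -
  have "total_loss n m f xs \<ge> total_loss n m f y + gt y \<bullet> (xs - y) + \<mu> / 2 * (norm (y - xs))\<^sup>2"
    using qsc by (simp add: quasi_strongly_convex_def)
  then show ?thesis by (simp add: subopt_def inner_diff_right algebra_simps)
qed

lemma subopt_integrable: "integrable M (\<lambda>z. subopt (x k z))"
proof (rule Bochner_Integration.integrable_bound)
  show "integrable M (\<lambda>z. gt (x k z) \<bullet> (x k z - xs))"
    by (intro in_L2_inner gt_in_L2 in_L2_diff x_in_L2 in_L2_const)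
  show "(\<lambda>z. subopt (x k z)) \<in> borel_measurable M"
    using measurable_M[OF x_measurable] by measurable
  have "subopt (x k z) \<le> gt (x k z) \<bullet> (x k z - xs)" for z
  proof -
    have "0 \<le> \<mu> / 2 * (norm (x k z - xs))\<^sup>2" using \<mu> by simp
    then show ?thesis using quasi_convexity[of "x k z"] by linarith
  qed
  then show "AE z in M. norm (subopt (x k z)) \<le> norm (gt (x k z) \<bullet> (x k z - xs))"
    using subopt_nonneg by (intro AE_I2) (simp add: order_trans[OF _ abs_ge_self])
qed

text \<open>At unit distance from the minimizer the norm \<open>G\<close> of the gradient satisfies
  \<open>G \<ge> G\<^sup>2 / (2 * L) + \<mu> / 2\<close>, which has a solution only if \<open>\<mu> \<le> L\<close>.\<close>

lemma mu_le_L: "\<mu> \<le> L"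
proof -
  obtain b :: 'a where b: "b \<in> Basis" using nonempty_Basis by blast
  define G where "G = norm (gt (xs + b))"
  have "subopt (xs + b) + \<mu> / 2 \<le> gt (xs + b) \<bullet> b"
    using quasi_convexity[of "xs + b"] b by simp
  also have "\<dots> \<le> G" using norm_cauchy_schwarz[of "gt (xs + b)" b] b by (simp add: G_def)
  finally have "L * (2 * (subopt (xs + b) + \<mu> / 2)) \<le> L * (2 * G)" using L by simp
  then have "2 * L * subopt (xs + b) + L * \<mu> \<le> 2 * L * G" by (simp add: algebra_simps)
  moreover have "G\<^sup>2 \<le> 2 * L * subopt (xs + b)" using gt_le_subopt by (simp add: G_def)
  moreover have "0 \<le> (L - G)\<^sup>2" by simp
  ultimately have "L * \<mu> \<le> L * L" by (simp add: power2_eq_square algebra_simps)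
  then show ?thesis using L by simp
qed

lemma gbar_bound:
  "cond_le M (\<P> k) (\<lambda>z. (norm (gbar k z))\<^sup>2)
    (\<lambda>z. 2 * (2 * L * (1 + 2 * \<omega> / real n)) * subopt (x k z) + 2 * \<omega> / real n * sig1 k z
      + 2 * (1 + 2 * \<omega> / real n) * sig2 k z)"
proof (rule cond_le_mono[OF gbar_second_moment])
  show "integrable M (\<lambda>z. 2 * (2 * L * (1 + 2 * \<omega> / real n)) * subopt (x k z) + 2 * \<omega> / real n * sig1 k z
      + 2 * (1 + 2 * \<omega> / real n) * sig2 k z)"
    by (intro Bochner_Integration.integrable_add integrable_mult_right subopt_integrable sig1_integrable sig2_integrable)
  fix z
  define r where "r = \<omega> / real n"
  note r = ratio_bounds(1)[folded r_def]
  have "(1 + r) * mean_gap (x k z) \<le> (1 + r) * (2 * L * subopt (x k z))"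
    using r mean_gap_le_subopt by (intro mult_left_mono) auto
  moreover have "0 \<le> r * (L * subopt (x k z))" "0 \<le> r * sig2 k z"
    using r L subopt_nonneg sig2_nonneg by auto
  ultimately have "(norm (gt (x k z)))\<^sup>2 + noise_bar_var k z
      \<le> 2 * (2 * L * (1 + 2 * r)) * subopt (x k z) + 2 * r * sig1 k z + 2 * (1 + 2 * r) * sig2 k z"
    using gt_le_worker_gap[of "x k z"] worker_gap_nonneg[of "x k z"] noise_bar_var_le[of k z, folded r_def]
    by (simp add: algebra_simps)
  then show "(norm (gt (x k z)))\<^sup>2 + noise_bar_var k z
      \<le> 2 * (2 * L * (1 + 2 * \<omega> / real n)) * subopt (x k z) + 2 * \<omega> / real n * sig1 k z
      + 2 * (1 + 2 * \<omega> / real n) * sig2 k z"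
    by (simp add: r_def)
qed

lemma sig1_bound:
  "cond_le M (\<P> k) (sig1 (Suc k))
    (\<lambda>z. (1 - \<alpha>) * sig1 k z + 2 * (3 * L * \<alpha>) * subopt (x k z) + 2 * \<alpha> * sig2 k z)"
proof (rule cond_le_mono[OF sig1_step])
  show "integrable M (\<lambda>z. (1 - \<alpha>) * sig1 k z + 2 * (3 * L * \<alpha>) * subopt (x k z) + 2 * \<alpha> * sig2 k z)"
    by (intro Bochner_Integration.integrable_add integrable_mult_right subopt_integrable sig1_integrable sig2_integrable)
  fix z
  have "worker_gap (x k z) + mean_estimate_var k z \<le> 6 * L * subopt (x k z) + 2 * sig2 k z"
    using mean_estimate_var_le[of 1 k z] worker_gap_nonneg[of "x k z"] mean_gap_le_subopt[of "x k z"]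
      mult_nonneg_nonneg[OF less_imp_le[OF L] subopt_nonneg[of "x k z"]] by simp
  then have "\<alpha> * (worker_gap (x k z) + mean_estimate_var k z) \<le> \<alpha> * (6 * L * subopt (x k z) + 2 * sig2 k z)"
    using \<alpha> by (intro mult_left_mono) auto
  then show "(1 - \<alpha>) * sig1 k z + \<alpha> * (worker_gap (x k z) + mean_estimate_var k z)
      \<le> (1 - \<alpha>) * sig1 k z + 2 * (3 * L * \<alpha>) * subopt (x k z) + 2 * \<alpha> * sig2 k z"
    by (simp add: algebra_simps)
qed

lemma sig2_bound:
  "cond_le M (\<P> k) (sig2 (Suc k)) (\<lambda>z. (1 - p) * sig2 k z + 2 * (L * p) * subopt (x k z))"
proof (rule cond_le_mono[OF sig2_step])
  show "integrable M (\<lambda>z. (1 - p) * sig2 k z + 2 * (L * p) * subopt (x k z))"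
    by (intro Bochner_Integration.integrable_add integrable_mult_right subopt_integrable sig2_integrable)
  fix z
  have "p * mean_gap (x k z) \<le> p * (2 * L * subopt (x k z))"
    using p mean_gap_le_subopt by (intro mult_left_mono) auto
  then show "(1 - p) * sig2 k z + p * mean_gap (x k z) \<le> (1 - p) * sig2 k z + 2 * (L * p) * subopt (x k z)"
    by (simp add: algebra_simps)
qed

definition subopt_mean :: "nat \<Rightarrow> real" where
  "subopt_mean k = (\<integral>z. subopt (x k z) \<partial>M)"

definition sig1_mean :: "nat \<Rightarrow> real" where
  "sig1_mean k = (\<integral>z. sig1 k z \<partial>M)"

definition sig2_mean :: "nat \<Rightarrow> real" where
  "sig2_mean k = (\<integral>z. sig2 k z \<partial>M)"

definition error_mean :: "nat \<Rightarrow> real" where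
  "error_mean k = (\<integral>z. (norm (ebar k z))\<^sup>2 \<partial>M)"

lemma means_nonneg: "subopt_mean k \<ge> 0" "sig1_mean k \<ge> 0" "sig2_mean k \<ge> 0" "error_mean k \<ge> 0"
  unfolding subopt_mean_def sig1_mean_def sig2_mean_def error_mean_def
  by (simp_all add: Bochner_Integration.integral_nonneg subopt_nonneg sig1_nonneg sig2_nonneg)

lemma sig1_mean_step:
  "sig1_mean (Suc k) \<le> (1 - \<alpha>) * sig1_mean k + (6 * L * \<alpha> * subopt_mean k + 2 * \<alpha> * sig2_mean k)"
  using cond_le_expectation[OF \<F>_before_subalgebra sig1_bound[of k]]
    subopt_integrable[of k] sig1_integrable[of k] sig2_integrable[of k]
  by (simp add: sig1_mean_def subopt_mean_def sig2_mean_def)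

lemma sig2_mean_step: "sig2_mean (Suc k) \<le> (1 - p) * sig2_mean k + 2 * L * p * subopt_mean k"
  using cond_le_expectation[OF \<F>_before_subalgebra sig2_bound[of k]]
    subopt_integrable[of k] sig2_integrable[of k]
  by (simp add: subopt_mean_def sig2_mean_def)

section \<open>The accumulated error\<close>

lemma ebar_measurable: "ebar k \<in> borel_measurable (\<P> k)"
proof -
  have "ebar k \<in> borel_measurable (\<P> k) \<longleftrightarrow>
      (\<lambda>z. \<gamma> *\<^sub>R (\<Sum>t\<in>{k - \<tau>..<k}. gbar t z)) \<in> borel_measurable (\<P> k)"
    by (rule measurable_cong) (simp add: ebar_eq)
  also have "\<dots>"
    by (intro borel_measurable_scaleR borel_measurable_sum gbar_measurable) auto
  finally show ?thesis .
qed

lemma ebar_in_L2: "in_L2 M (ebar k)"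
proof -
  have "in_L2 M (\<lambda>z. \<gamma> *\<^sub>R (\<Sum>t\<in>{k - \<tau>..<k}. gbar t z))"
    by (intro in_L2_scale in_L2_sum gbar_in_L2)
  then show ?thesis using ebar_eq by (simp cong: in_L2_cong)
qed

lemma noise_bar_orthogonal_mean:
  assumes "Z \<in> borel_measurable (\<P> k)" "in_L2 M Z"
  shows "(\<integral>z. noise_bar k z \<bullet> Z z \<partial>M) = 0"
proof -
  interpret F: finite_measure_subalgebra M "\<P> k" by (intro cond_subalgebra \<F>_before_subalgebra)
  have "(\<integral>z. noise_bar k z \<bullet> Z z \<partial>M) = (\<integral>z. real_cond_exp M (\<P> k) (\<lambda>z. noise_bar k z \<bullet> Z z) z \<partial>M)"
    using noise_bar_orthogonal(2)[OF assms] by (intro F.real_cond_exp_int(2)[symmetric])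
  also have "\<dots> = (\<integral>z. 0 \<partial>M)"
    using noise_bar_orthogonal(1)[OF assms] by (intro integral_cong_AE) auto
  finally show ?thesis by simp
qed

lemma noise_bar_measurable: "t < k \<Longrightarrow> noise_bar t \<in> borel_measurable (\<P> k)"
  unfolding noise_bar_def[abs_def]
  using gbar_measurable[of t k] \<F>_mono_measurable[OF gt_x_measurable[of t] before_mono[of t k]] by simp

lemma noise_bar_pairwise:
  assumes "r \<noteq> t"
  shows "(\<integral>z. noise_bar r z \<bullet> noise_bar t z \<partial>M) = 0"
proof (cases "r < t")
  case True
  then show ?thesis
    using noise_bar_orthogonal_mean[OF noise_bar_measurable[OF True] noise_bar_in_L2]
    by (simp add: inner_commute)
next
  case False
  then show ?thesis
    using noise_bar_orthogonal_mean[OF noise_bar_measurable noise_bar_in_L2, of t r] assms by simp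
qed

lemma noise_bar_sum:
  assumes "finite I"
  shows "(\<integral>z. (norm (\<Sum>t\<in>I. noise_bar t z))\<^sup>2 \<partial>M) = (\<Sum>t\<in>I. \<integral>z. (norm (noise_bar t z))\<^sup>2 \<partial>M)"
proof -
  have int: "integrable M (\<lambda>z. noise_bar r z \<bullet> noise_bar t z)" for r t
    by (intro in_L2_inner noise_bar_in_L2)
  have "(\<integral>z. (norm (\<Sum>t\<in>I. noise_bar t z))\<^sup>2 \<partial>M) = (\<integral>z. (\<Sum>r\<in>I. \<Sum>t\<in>I. noise_bar r z \<bullet> noise_bar t z) \<partial>M)"
    by (simp add: power2_norm_eq_inner inner_sum_left inner_sum_right) (subst sum.swap, simp)
  also have "\<dots> = (\<Sum>r\<in>I. \<Sum>t\<in>I. \<integral>z. noise_bar r z \<bullet> noise_bar t z \<partial>M)"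
    using int by (simp add: Bochner_Integration.integral_sum Bochner_Integration.integrable_sum)
  also have "\<dots> = (\<Sum>r\<in>I. \<Sum>t\<in>I. if r = t then \<integral>z. (norm (noise_bar r z))\<^sup>2 \<partial>M else 0)"
    using noise_bar_pairwise by (intro sum.cong) (auto simp: power2_norm_eq_inner)
  also have "\<dots> = (\<Sum>t\<in>I. \<integral>z. (norm (noise_bar t z))\<^sup>2 \<partial>M)" using assms by simp
  finally show ?thesis .
qed

lemma noise_bar_mean_le:
  "(\<integral>z. (norm (noise_bar k z))\<^sup>2 \<partial>M) \<le> 4 * L * (1 + \<omega> / real n) * subopt_mean k
    + 2 * (\<omega> / real n) * sig1_mean k + 2 * (1 + \<omega> / real n) * sig2_mean k"
proof -
  define r where "r = \<omega> / real n"
  note r = ratio_bounds(1)[folded r_def]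
  have "(\<integral>z. (norm (noise_bar k z))\<^sup>2 \<partial>M) \<le> (\<integral>z. noise_bar_var k z \<partial>M)"
    by (rule cond_le_expectation[OF \<F>_before_subalgebra noise_bar_variance])
  also have "\<dots> \<le> (\<integral>z. 4 * L * (1 + r) * subopt (x k z) + 2 * r * sig1 k z + 2 * (1 + r) * sig2 k z \<partial>M)"
  proof (rule integral_mono)
    show "integrable M (noise_bar_var k)" using noise_bar_variance[of k] by (simp add: cond_le_def)
    show "integrable M (\<lambda>z. 4 * L * (1 + r) * subopt (x k z) + 2 * r * sig1 k z + 2 * (1 + r) * sig2 k z)"
      by (intro Bochner_Integration.integrable_add integrable_mult_right subopt_integrable sig1_integrable sig2_integrable)
    fix z
    have "(1 + r) * mean_gap (x k z) \<le> (1 + r) * (2 * L * subopt (x k z))"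
      using r mean_gap_le_subopt by (intro mult_left_mono) auto
    then show "noise_bar_var k z \<le> 4 * L * (1 + r) * subopt (x k z) + 2 * r * sig1 k z + 2 * (1 + r) * sig2 k z"
      using noise_bar_var_le[of k z, folded r_def] worker_gap_nonneg[of "x k z"] by (simp add: algebra_simps)
  qed
  also have "\<dots> = 4 * L * (1 + r) * subopt_mean k + 2 * r * sig1_mean k + 2 * (1 + r) * sig2_mean k"
    using subopt_integrable[of k] sig1_integrable[of k] sig2_integrable[of k]
    by (simp add: sig1_mean_def subopt_mean_def sig2_mean_def)
  finally show ?thesis by (simp add: r_def)
qed

definition error_rate :: "nat \<Rightarrow> real" where
  "error_rate t = (2 * L * real \<tau> + 4 * L * (1 + \<omega> / real n)) * subopt_mean t
    + 2 * (\<omega> / real n) * sig1_mean t + 2 * (1 + \<omega> / real n) * sig2_mean t"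

lemma error_rate_nonneg: "error_rate t \<ge> 0"
  unfolding error_rate_def using means_nonneg L ratio_bounds(1)
  by (intro add_nonneg_nonneg mult_nonneg_nonneg) auto

text \<open>The gradients in the window may all point in the same direction, which costs a factor \<open>\<tau>\<close>;
  the noises are orthogonal, so their squared norms only add up.\<close>

lemma error_mean_le: "error_mean k \<le> 2 * \<gamma>\<^sup>2 * (\<Sum>t\<in>{k - \<tau>..<k}. error_rate t)"
proof -
  let ?I = "{k - \<tau>..<k}"
  let ?N = "\<lambda>z. \<Sum>t\<in>?I. noise_bar t z"
  have gti: "integrable M (\<lambda>z. (norm (gt (x t z)))\<^sup>2)" for t
    using gt_in_L2[OF x_in_L2[of t]] by (simp add: in_L2_def)
  have Ni: "integrable M (\<lambda>z. (norm (?N z))\<^sup>2)"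
    using in_L2_sum[of ?I noise_bar] noise_bar_in_L2 by (simp add: in_L2_def)
  have card: "real (card ?I) \<le> real \<tau>" by simp
  have "error_mean k \<le> (\<integral>z. 2 * \<gamma>\<^sup>2 * (real \<tau> * (\<Sum>t\<in>?I. (norm (gt (x t z)))\<^sup>2) + (norm (?N z))\<^sup>2) \<partial>M)"
    unfolding error_mean_def
  proof (rule integral_mono)
    show "integrable M (\<lambda>z. (norm (ebar k z))\<^sup>2)" using ebar_in_L2 by (simp add: in_L2_def)
    show "integrable M (\<lambda>z. 2 * \<gamma>\<^sup>2 * (real \<tau> * (\<Sum>t\<in>?I. (norm (gt (x t z)))\<^sup>2) + (norm (?N z))\<^sup>2))"
      by (intro integrable_mult_right Bochner_Integration.integrable_add Bochner_Integration.integrable_sum gti Ni)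
    fix z assume z: "z \<in> space M"
    let ?G = "\<Sum>t\<in>?I. gt (x t z)"
    have "(\<Sum>t\<in>?I. gbar t z) = ?G + ?N z" by (simp add: noise_bar_def sum.distrib[symmetric])
    then have "(norm (ebar k z))\<^sup>2 = \<gamma>\<^sup>2 * (norm (?G + ?N z))\<^sup>2"
      using ebar_eq[OF z] by (simp add: power_mult_distrib)
    also have "\<dots> \<le> \<gamma>\<^sup>2 * (2 * (norm ?G)\<^sup>2 + 2 * (norm (?N z))\<^sup>2)"
      by (intro mult_left_mono norm_add_young) simp
    also have "\<dots> \<le> \<gamma>\<^sup>2 * (2 * (real \<tau> * (\<Sum>t\<in>?I. (norm (gt (x t z)))\<^sup>2)) + 2 * (norm (?N z))\<^sup>2)"
    proof (intro mult_left_mono add_right_mono)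
      have "(norm ?G)\<^sup>2 \<le> real (card ?I) * (\<Sum>t\<in>?I. (norm (gt (x t z)))\<^sup>2)"
        by (rule norm_sum_squared_le) simp
      also have "\<dots> \<le> real \<tau> * (\<Sum>t\<in>?I. (norm (gt (x t z)))\<^sup>2)"
        by (intro mult_right_mono card sum_nonneg) auto
      finally show "(norm ?G)\<^sup>2 \<le> real \<tau> * (\<Sum>t\<in>?I. (norm (gt (x t z)))\<^sup>2)" .
    qed simp_all
    finally show "(norm (ebar k z))\<^sup>2 \<le> 2 * \<gamma>\<^sup>2 * (real \<tau> * (\<Sum>t\<in>?I. (norm (gt (x t z)))\<^sup>2) + (norm (?N z))\<^sup>2)"
      by (simp add: algebra_simps)
  qed
  also have "\<dots> = 2 * \<gamma>\<^sup>2 * (real \<tau> * (\<Sum>t\<in>?I. \<integral>z. (norm (gt (x t z)))\<^sup>2 \<partial>M)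
      + (\<Sum>t\<in>?I. \<integral>z. (norm (noise_bar t z))\<^sup>2 \<partial>M))"
    using gti Ni by (simp add: noise_bar_sum Bochner_Integration.integrable_sum)
  also have "\<dots> \<le> 2 * \<gamma>\<^sup>2 * (real \<tau> * (\<Sum>t\<in>?I. 2 * L * subopt_mean t)
      + (\<Sum>t\<in>?I. 4 * L * (1 + \<omega> / real n) * subopt_mean t
        + 2 * (\<omega> / real n) * sig1_mean t + 2 * (1 + \<omega> / real n) * sig2_mean t))"
  proof (intro mult_left_mono add_mono sum_mono noise_bar_mean_le)
    fix t
    have "(\<integral>z. (norm (gt (x t z)))\<^sup>2 \<partial>M) \<le> (\<integral>z. 2 * L * subopt (x t z) \<partial>M)"
      by (intro integral_mono gti integrable_mult_right subopt_integrable gt_le_subopt)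
    then show "(\<integral>z. (norm (gt (x t z)))\<^sup>2 \<partial>M) \<le> 2 * L * subopt_mean t" by (simp add: subopt_mean_def)
  qed auto
  also have "\<dots> = 2 * \<gamma>\<^sup>2 * (\<Sum>t\<in>?I. error_rate t)"
    unfolding sum_distrib_left[of "real \<tau>"] sum.distrib[symmetric]
    by (intro arg_cong2[where f = "(*)"] refl sum.cong) (simp add: error_rate_def algebra_simps)
  finally show ?thesis .
qed

end

section \<open>Consequences of the step size condition\<close>

context delayed_diana begin

definition r :: real where "r = \<omega> / real n"

lemma r: "r \<ge> 0"
  unfolding r_def by (rule ratio_bounds)

lemma step_linear: "L * \<gamma> * (37 / 9 + 8 * r) \<le> 1 / 8"
proof -
  have "\<gamma> \<le> 1 / (8 * L * (37 / 9 + 8 * r))" using stepsize by (simp add: r_def)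
  moreover have "8 * L * (37 / 9 + 8 * r) > 0" using L r by (intro mult_pos_pos add_pos_nonneg) auto
  ultimately have "\<gamma> * (8 * L * (37 / 9 + 8 * r)) \<le> 1" by (simp add: pos_le_divide_eq)
  then show ?thesis by (simp add: mult_ac)
qed

text \<open>Bounding \<open>1 / (1 - p)\<close> and \<open>1 / (1 - \<alpha>)\<close> below by 1 turns the second step size condition into
  one that is polynomial in \<open>\<tau>\<close> and \<open>r\<close>.\<close>

lemma
  shows step_quadratic: "L\<^sup>2 * \<gamma>\<^sup>2 * real \<tau> * (6 + real \<tau> + 40 * r) \<le> 1 / 64"
    and step_delay: "L * \<gamma> * real \<tau> \<le> 1 / 8"
proof -
  define X where "X = real \<tau> * (2 + real \<tau> + 4 / (1 - p)
         + 4 * r * (1 + 3 / (1 - \<alpha>) + 2 / (1 - p) + 4 / ((1 - \<alpha>) * (1 - p))))"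
  have p1: "1 \<le> 1 / (1 - p)" and a1: "1 \<le> 1 / (1 - \<alpha>)" using p \<alpha> \<alpha>_less_1 by (auto simp: field_simps)
  have pa: "1 \<le> 1 / ((1 - \<alpha>) * (1 - p))" using mult_mono[OF a1 p1] \<alpha>_less_1 by simp
  have "10 \<le> 1 + 3 / (1 - \<alpha>) + 2 / (1 - p) + 4 / ((1 - \<alpha>) * (1 - p))" using p1 a1 pa by (simp add: field_simps)
  then have "4 * r * 10 \<le> 4 * r * (1 + 3 / (1 - \<alpha>) + 2 / (1 - p) + 4 / ((1 - \<alpha>) * (1 - p)))"
    using r by (intro mult_left_mono) auto
  then have X1: "real \<tau> * (6 + real \<tau> + 40 * r) \<le> X" unfolding X_def using p1 by (intro mult_left_mono) auto
  have "real \<tau> * real \<tau> \<le> real \<tau> * (6 + real \<tau> + 40 * r)" using r by (intro mult_left_mono) auto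
  then have X2: "(real \<tau>)\<^sup>2 \<le> X" using X1 by (simp only: power2_eq_square)
  have "0 < (real \<tau>)\<^sup>2" using \<tau> by simp
  then have X3: "X > 0" using X2 by linarith
  have "\<gamma> \<le> 1 / (8 * L * sqrt X)" using stepsize by (simp add: X_def r_def)
  then have g: "L * \<gamma> * sqrt X \<le> 1 / 8" using L X3 by (simp add: field_simps)
  then have "(L * \<gamma> * sqrt X)\<^sup>2 \<le> (1 / 8)\<^sup>2" using L \<gamma> X3 by (intro power_mono) auto
  then have "L\<^sup>2 * \<gamma>\<^sup>2 * X \<le> 1 / 64" using X3 by (simp add: power_mult_distrib power_divide)
  moreover have "L\<^sup>2 * \<gamma>\<^sup>2 * (real \<tau> * (6 + real \<tau> + 40 * r)) \<le> L\<^sup>2 * \<gamma>\<^sup>2 * X"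
    using X1 by (intro mult_left_mono) auto
  ultimately have "L\<^sup>2 * \<gamma>\<^sup>2 * (real \<tau> * (6 + real \<tau> + 40 * r)) \<le> 1 / 64" by linarith
  then show "L\<^sup>2 * \<gamma>\<^sup>2 * real \<tau> * (6 + real \<tau> + 40 * r) \<le> 1 / 64" by (simp only: mult.assoc)
  have "real \<tau> \<le> sqrt X" using X2 by (rule real_le_rsqrt)
  then have "L * \<gamma> * real \<tau> \<le> L * \<gamma> * sqrt X" using L \<gamma> by (intro mult_left_mono) auto
  then show "L * \<gamma> * real \<tau> \<le> 1 / 8" using g by linarith
qed

definition \<eta> :: real where "\<eta> = min (\<gamma> * \<mu> / 2) (min (\<alpha> / 4) (p / 4))"

lemma \<eta>_bounds: "0 \<le> \<eta>" "\<eta> \<le> \<gamma> * \<mu> / 2" "\<eta> \<le> \<alpha> / 4" "\<eta> \<le> p / 4" "\<eta> < 1"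
  using \<gamma> \<mu> \<alpha> p by (auto simp: \<eta>_def min_def)

lemma \<eta>_delay: "\<eta> \<le> 1 / (16 * real \<tau>)"
proof -
  have "\<gamma> * \<mu> \<le> L * \<gamma>" using mu_le_L \<gamma> by (simp add: mult.commute)
  then have "\<eta> * (16 * real \<tau>) \<le> L * \<gamma> / 2 * (16 * real \<tau>)"
    using \<eta>_bounds(2) by (intro mult_right_mono) auto
  also have "\<dots> = 8 * (L * \<gamma> * real \<tau>)" by simp
  also have "\<dots> \<le> 1" using step_delay by simp
  finally show ?thesis using \<tau> by (simp add: pos_le_divide_eq)
qed

definition wsum :: "(nat \<Rightarrow> real) \<Rightarrow> nat \<Rightarrow> real" where
  "wsum a K = (\<Sum>k\<le>K. weight \<eta> k * a k)"

lemma wsum_mono: "(\<And>k. a k \<le> b k) \<Longrightarrow> wsum a K \<le> wsum b K"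
  unfolding wsum_def using weight_pos[OF \<eta>_bounds(5)]
  by (intro sum_mono mult_left_mono) (auto simp: less_imp_le)

lemma wsum_nonneg: "(\<And>k. 0 \<le> a k) \<Longrightarrow> 0 \<le> wsum a K"
  using wsum_mono[of "\<lambda>_. 0" a K] by (simp add: wsum_def)

lemma wsum_add: "wsum (\<lambda>k. a k + b k) K = wsum a K + wsum b K"
  by (simp add: wsum_def sum.distrib distrib_left)

lemma wsum_scale: "wsum (\<lambda>k. v * a k) K = v * wsum a K"
  by (simp add: wsum_def sum_distrib_left mult_ac)

lemma wsum_sig2:
  "wsum sig2_mean K \<le> 4 / (3 * p) * sig2_mean 0 + 8 / 3 * L * wsum subopt_mean K"
proof -
  have "wsum sig2_mean K \<le> 4 / (3 * p) * (sig2_mean 0 + wsum (\<lambda>k. 2 * L * p * subopt_mean k) K)"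
    unfolding wsum_def
    by (intro weighted_contraction sig2_mean_step means_nonneg \<eta>_bounds p) (use p L means_nonneg in auto)
  then show ?thesis unfolding wsum_scale using p by (simp add: field_simps)
qed

lemma wsum_sig1:
  "wsum sig1_mean K \<le> 4 / (3 * \<alpha>) * sig1_mean 0 + 8 * L * wsum subopt_mean K + 8 / 3 * wsum sig2_mean K"
proof -
  have "wsum sig1_mean K
      \<le> 4 / (3 * \<alpha>) * (sig1_mean 0 + wsum (\<lambda>k. 6 * L * \<alpha> * subopt_mean k + 2 * \<alpha> * sig2_mean k) K)"
    unfolding wsum_def
    by (intro weighted_contraction sig1_mean_step means_nonneg \<eta>_bounds \<alpha>)
      (use \<alpha> \<alpha>_less_1 L means_nonneg in auto)
  then show ?thesis unfolding wsum_add wsum_scale using \<alpha> by (simp add: field_simps)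
qed

abbreviation "F1 \<equiv> 12 * \<gamma>\<^sup>2 * L * \<omega> * real \<tau> * (2 + \<alpha>) / (real n * \<alpha>)"
abbreviation "F2 \<equiv> 12 * \<gamma>\<^sup>2 * real \<tau> * L * (2 + p) / p *
      (4 * \<omega> / (real n * (1 - \<alpha>)) + 1 + 2 * \<omega> / real n)"

text \<open>Both \<open>\<sigma>\<close> processes are eliminated through their contractions, first \<open>sig1\<close> and then \<open>sig2\<close>, which
  feeds it.  The factor 32/5 is 3 times the 2 of \<open>error_mean_le\<close> times the 16/15 of \<open>weighted_delay\<close>.\<close>

lemma weighted_error:
  "3 * L * wsum error_mean K \<le> 1 / 4 * wsum subopt_mean K + F1 * sig1_mean 0 + F2 * sig2_mean 0"
proof -
  define W where "W = wsum subopt_mean K"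
  define q where "q = \<gamma>\<^sup>2 * L * real \<tau>"
  note nn = means_nonneg
  have W: "W \<ge> 0" unfolding W_def by (rule wsum_nonneg) (rule nn)
  have q: "q \<ge> 0" using L by (simp add: q_def)
  have "wsum error_rate K = (2 * L * real \<tau> + 4 * L * (1 + r)) * W + 2 * r * wsum sig1_mean K
      + 2 * (1 + r) * wsum sig2_mean K"
    unfolding error_rate_def[abs_def] wsum_add wsum_scale W_def r_def ..
  also have "\<dots> \<le> (2 * L * real \<tau> + 4 * L * (1 + r)) * W
      + 2 * r * (4 / (3 * \<alpha>) * sig1_mean 0 + 8 * L * W + 8 / 3 * wsum sig2_mean K)
      + 2 * (1 + r) * wsum sig2_mean K"
    using wsum_sig1[of K] r by (intro add_right_mono add_left_mono mult_left_mono) (auto simp: W_def)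
  also have "\<dots> = (2 * L * real \<tau> + 4 * L * (1 + r) + 16 * r * L) * W + 2 * r * (4 / (3 * \<alpha>) * sig1_mean 0)
      + (2 + 22 / 3 * r) * wsum sig2_mean K" by (simp add: algebra_simps)
  also have "\<dots> \<le> (2 * L * real \<tau> + 4 * L * (1 + r) + 16 * r * L) * W + 2 * r * (4 / (3 * \<alpha>) * sig1_mean 0)
      + (2 + 22 / 3 * r) * (4 / (3 * p) * sig2_mean 0 + 8 / 3 * L * W)"
    using wsum_sig2[of K] r by (intro add_left_mono mult_left_mono) (auto simp: W_def)
  also have "\<dots> = L * (2 * real \<tau> + 28 / 3 + 356 / 9 * r) * W + 8 / 3 * r / \<alpha> * sig1_mean 0
      + 4 / 3 * (2 + 22 / 3 * r) / p * sig2_mean 0"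
    using p \<alpha> by (simp add: field_simps)
  finally have rate: "wsum error_rate K \<le> L * (2 * real \<tau> + 28 / 3 + 356 / 9 * r) * W
      + 8 / 3 * r / \<alpha> * sig1_mean 0 + 4 / 3 * (2 + 22 / 3 * r) / p * sig2_mean 0" .
  have "wsum error_mean K \<le> wsum (\<lambda>k. 2 * \<gamma>\<^sup>2 * (\<Sum>t\<in>{k - \<tau>..<k}. error_rate t)) K"
    by (intro wsum_mono error_mean_le)
  also have "\<dots> \<le> 2 * \<gamma>\<^sup>2 * (16 / 15 * real \<tau> * wsum error_rate K)"
    unfolding wsum_scale unfolding wsum_def
    by (intro mult_left_mono weighted_delay \<eta>_bounds \<eta>_delay \<tau> error_rate_nonneg) simp
  finally have "3 * L * wsum error_mean K \<le> 3 * L * (2 * \<gamma>\<^sup>2 * (16 / 15 * real \<tau> * wsum error_rate K))"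
    using L by (intro mult_left_mono) auto
  also have "\<dots> = 32 / 5 * q * wsum error_rate K" by (simp add: q_def)
  also have "\<dots> \<le> 32 / 5 * q * (L * (2 * real \<tau> + 28 / 3 + 356 / 9 * r) * W
      + 8 / 3 * r / \<alpha> * sig1_mean 0 + 4 / 3 * (2 + 22 / 3 * r) / p * sig2_mean 0)"
    using rate q by (intro mult_left_mono) auto
  also have "\<dots> = 32 / 5 * (q * L) * (2 * real \<tau> + 28 / 3 + 356 / 9 * r) * W
      + q * (256 / 15 * r / \<alpha>) * sig1_mean 0 + q * (128 / 15 * (2 + 22 / 3 * r) / p) * sig2_mean 0"
    by (simp add: algebra_simps)
  also have "\<dots> \<le> 1 / 4 * W + F1 * sig1_mean 0 + F2 * sig2_mean 0"
  proof (intro add_mono mult_right_mono W nn)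
    have "32 / 5 * (q * L) * (2 * real \<tau> + 28 / 3 + 356 / 9 * r) = (q * L) * (32 / 5 * (2 * real \<tau> + 28 / 3 + 356 / 9 * r))"
      by simp
    also have "\<dots> \<le> (q * L) * (16 * (6 + real \<tau> + 40 * r))"
      using q L r by (intro mult_left_mono) auto
    also have "q * L * (16 * (6 + real \<tau> + 40 * r)) = 16 * (L\<^sup>2 * \<gamma>\<^sup>2 * real \<tau> * (6 + real \<tau> + 40 * r))"
      by (simp add: q_def power2_eq_square mult_ac)
    finally show "32 / 5 * (q * L) * (2 * real \<tau> + 28 / 3 + 356 / 9 * r) \<le> 1 / 4"
      using step_quadratic by linarith
    have "q * (256 / 15 * r / \<alpha>) \<le> q * (12 * r * (2 + \<alpha>) / \<alpha>)"
    proof (intro mult_left_mono divide_right_mono q)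
      have "256 / 15 * r \<le> 24 * r" using r by simp
      also have "\<dots> \<le> 12 * r * (2 + \<alpha>)" using r \<alpha> by (simp add: algebra_simps)
      finally show "256 / 15 * r \<le> 12 * r * (2 + \<alpha>)" .
    qed (use \<alpha> in simp)
    also have "\<dots> = F1" by (simp add: q_def r_def mult_ac)
    finally show "q * (256 / 15 * r / \<alpha>) \<le> F1" .
    have "q * (128 / 15 * (2 + 22 / 3 * r) / p) \<le> q * (12 * (2 + p) * (4 * r / (1 - \<alpha>) + 1 + 2 * r) / p)"
    proof (intro mult_left_mono divide_right_mono q)
      have ra: "r \<le> r / (1 - \<alpha>)" using r \<alpha> \<alpha>_less_1 by (simp add: le_divide_eq mult_left_le)
      have "128 / 15 * (2 + 22 / 3 * r) \<le> 24 * (4 * (r / (1 - \<alpha>)) + 1 + 2 * r)" using ra r by simp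
      also have "\<dots> \<le> 12 * (2 + p) * (4 * (r / (1 - \<alpha>)) + 1 + 2 * r)"
        using p r ra by (intro mult_right_mono) auto
      finally show "128 / 15 * (2 + 22 / 3 * r) \<le> 12 * (2 + p) * (4 * r / (1 - \<alpha>) + 1 + 2 * r)" by simp
    qed (use p in simp)
    also have "\<dots> = F2"
    proof -
      have br: "4 * r / (1 - \<alpha>) + 1 + 2 * r = 4 * \<omega> / (real n * (1 - \<alpha>)) + 1 + 2 * \<omega> / real n"
        by (simp add: r_def)
      have "q * (12 * (2 + p) * B / p) = 12 * \<gamma>\<^sup>2 * real \<tau> * L * (2 + p) / p * B" for B
        by (simp add: q_def)
      then show ?thesis unfolding br .
    qed
    finally show "q * (128 / 15 * (2 + 22 / 3 * r) / p) \<le> F2" .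
  qed
  finally show ?thesis by (simp add: W_def)
qed

section \<open>Descent of the Lyapunov function\<close>

definition virtual :: "nat \<Rightarrow> 'w \<Rightarrow> 'a" where
  "virtual k z = x k z - ebar k z - xs"

definition virtual_mean :: "nat \<Rightarrow> real" where
  "virtual_mean k = (\<integral>z. (norm (virtual k z))\<^sup>2 \<partial>M)"

lemma virtual_measurable: "virtual k \<in> borel_measurable (\<P> k)"
  unfolding virtual_def[abs_def] using x_measurable ebar_measurable by simp

lemma virtual_in_L2: "in_L2 M (virtual k)"
  unfolding virtual_def[abs_def]
  by (intro in_L2_diff x_in_L2 ebar_in_L2 in_L2_const)

text \<open>The delayed terms of the iterate and of the error cancel: the virtual iterate makes undelayed steps.\<close>

lemma virtual_Suc: "z \<in> space M \<Longrightarrow> virtual (Suc k) z = virtual k z - \<gamma> *\<^sub>R gbar k z"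
  unfolding virtual_def by (simp add: x_Suc ebar_Suc)

text \<open>Of the \<open>2 * \<gamma> * subopt\<close> gained from quasi strong convexity, one half pays for the gradient part of
  Young's inequality for the product of error and gradient.  The factor 3 consists of the 2 from there
  and of 1 from replacing the iterate by the virtual one in the term with \<open>\<mu> \<le> L\<close>.\<close>

lemma virtual_drift:
  "(norm (virtual k z))\<^sup>2 - 2 * \<gamma> * (virtual k z \<bullet> gt (x k z))
    \<le> (1 - \<gamma> * \<mu> / 2) * (norm (virtual k z))\<^sup>2 - \<gamma> * subopt (x k z) + 3 * L * \<gamma> * (norm (ebar k z))\<^sup>2"
proof -
  define d where "d = x k z - xs"
  define e where "e = ebar k z"
  define G where "G = gt (x k z)"
  have v: "virtual k z = d - e" by (simp add: virtual_def d_def e_def)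
  have q: "subopt (x k z) + \<mu> / 2 * (norm d)\<^sup>2 \<le> G \<bullet> d" using quasi_convexity by (simp add: d_def G_def)
  have "(norm (d - e))\<^sup>2 \<le> 2 * (norm d)\<^sup>2 + 2 * (norm e)\<^sup>2" using norm_add_young[of d "- e"] by simp
  then have "\<mu> / 2 * (norm (d - e))\<^sup>2 \<le> \<mu> / 2 * (2 * (norm d)\<^sup>2 + 2 * (norm e)\<^sup>2)" using \<mu> by (intro mult_left_mono) auto
  then have 1: "\<mu> / 2 * (norm (d - e))\<^sup>2 \<le> \<mu> * (norm d)\<^sup>2 + \<mu> * (norm e)\<^sup>2" by (simp add: algebra_simps)
  have 2: "\<mu> * (norm e)\<^sup>2 \<le> L * (norm e)\<^sup>2" using mu_le_L by (intro mult_right_mono) auto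
  have "0 \<le> (norm (G - (2 * L) *\<^sub>R e))\<^sup>2" by simp
  also have "\<dots> = (norm G)\<^sup>2 - 4 * L * (e \<bullet> G) + 4 * L\<^sup>2 * (norm e)\<^sup>2"
    unfolding power2_norm_eq_inner by (simp add: inner_diff_left inner_diff_right inner_commute power2_eq_square)
  also have "(norm G)\<^sup>2 \<le> 2 * L * subopt (x k z)" unfolding G_def by (rule gt_le_subopt)
  finally have "2 * L * (2 * (e \<bullet> G)) \<le> 2 * L * (subopt (x k z) + 2 * L * (norm e)\<^sup>2)"
    by (simp add: algebra_simps power2_eq_square)
  then have 3: "2 * (e \<bullet> G) \<le> subopt (x k z) + 2 * L * (norm e)\<^sup>2" using L by simp
  have "- 2 * ((d - e) \<bullet> G) \<le> - subopt (x k z) - \<mu> / 2 * (norm (d - e))\<^sup>2 + 3 * L * (norm e)\<^sup>2"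
    using q 1 2 3 by (simp add: inner_diff_left inner_commute[of d G])
  then have "\<gamma> * (- 2 * ((d - e) \<bullet> G)) \<le> \<gamma> * (- subopt (x k z) - \<mu> / 2 * (norm (d - e))\<^sup>2 + 3 * L * (norm e)\<^sup>2)"
    using \<gamma> by (intro mult_left_mono) auto
  then show ?thesis unfolding v e_def[symmetric] G_def[symmetric] by (simp add: algebra_simps)
qed

abbreviation "m1 \<equiv> 16 / 9 * r / \<alpha>"
abbreviation "m2 \<equiv> 20 / 9 * (25 / 9 * r + 1) / p"

text \<open>Given the Young parameters 3 (for the shifts) and 3/2 (for the estimator), \<open>m1\<close> and \<open>m2\<close> are the
  weights for which the two \<open>\<sigma>\<close> processes shrink by exactly the fractions \<open>\<alpha> / 4\<close> and \<open>p / 4\<close>.  The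
  parameter 3/2 makes the coefficient of \<open>worker_gap\<close> negative and keeps \<open>m2\<close> below \<open>33/25 * M2\<close>.\<close>

lemma second_order_terms:
  "(norm (gt (x k z)))\<^sup>2 + noise_bar_var k z
    + m1 * ((1 - \<alpha>) * sig1 k z + \<alpha> * (worker_gap (x k z) + mean_estimate_var k z))
    + m2 * ((1 - p) * sig2 k z + p * mean_gap (x k z))
   \<le> m1 * (1 - \<alpha> / 4) * sig1 k z + m2 * (1 - p / 4) * sig2 k z
     + 85 / 9 * L * (25 / 9 * r + 1) * subopt (x k z)"
proof -
  define A where "A = mean_gap (x k z)"
  define P where "P = worker_gap (x k z)"
  define V where "V = mean_estimate_var k z"
  define s1 where "s1 = sig1 k z"
  define s2 where "s2 = sig2 k z"
  have 1: "(norm (gt (x k z)))\<^sup>2 \<le> P" unfolding P_def by (rule gt_le_worker_gap)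
  have 2: "r * shift_gap k z \<le> r * (4 * P + 4 / 3 * s1)"
    using shift_gap_le[of 3 k z] r by (intro mult_left_mono) (auto simp: P_def s1_def)
  have "(r + 1 / real n + 16 / 9 * r) * V \<le> (25 / 9 * r + 1) * V"
    using r ratio_bounds mean_estimate_var_nonneg by (intro mult_right_mono) (auto simp: V_def)
  also have "\<dots> \<le> (25 / 9 * r + 1) * (5 / 2 * (A - P) + 5 / 3 * s2)"
    using mean_estimate_var_le[of "3 / 2" k z] r by (intro mult_left_mono) (auto simp: V_def A_def P_def s2_def)
  finally have 3: "(r + 1 / real n + 16 / 9 * r) * V \<le> (25 / 9 * r + 1) * (5 / 2 * (A - P) + 5 / 3 * s2)" .
  have "(25 / 9 * r + 1) * A \<le> (25 / 9 * r + 1) * (2 * L * subopt (x k z))"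
    unfolding A_def using r mean_gap_le_subopt by (intro mult_left_mono) auto
  then have "85 / 18 * ((25 / 9 * r + 1) * A) \<le> 85 / 18 * ((25 / 9 * r + 1) * (2 * L * subopt (x k z)))"
    by (rule mult_left_mono) simp
  also have "\<dots> = 85 / 9 * L * (25 / 9 * r + 1) * subopt (x k z)" by simp
  finally have 4: "85 / 18 * ((25 / 9 * r + 1) * A) \<le> 85 / 9 * L * (25 / 9 * r + 1) * subopt (x k z)" .
  have 5: "0 \<le> P" "0 \<le> r * P" using worker_gap_nonneg r by (auto simp: P_def)
  have a: "m1 * ((1 - \<alpha>) * s1 + \<alpha> * (P + V)) = m1 * s1 - 16 / 9 * r * s1 + (16 / 9 * r * P + 16 / 9 * r * V)"
    using \<alpha> by (simp add: field_simps)
  have b: "m2 * ((1 - p) * s2 + p * A) = m2 * s2 - 20 / 9 * (25 / 9 * r + 1) * s2 + 20 / 9 * (25 / 9 * r + 1) * A"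
    using p by (simp add: field_simps)
  have c: "m1 * (1 - \<alpha> / 4) * s1 = m1 * s1 - 4 / 9 * r * s1"
    using \<alpha> by (simp add: field_simps)
  have d: "m2 * (1 - p / 4) * s2 = m2 * s2 - 5 / 9 * (25 / 9 * r + 1) * s2"
    using p by (simp add: field_simps)
  have "P + r * (4 * P + 4 / 3 * s1) + (25 / 9 * r + 1) * (5 / 2 * (A - P) + 5 / 3 * s2)
      - 16 / 9 * r * s1 + 16 / 9 * r * P - 20 / 9 * (25 / 9 * r + 1) * s2 + 20 / 9 * (25 / 9 * r + 1) * A
      \<le> - (4 / 9 * r * s1) - 5 / 9 * (25 / 9 * r + 1) * s2 + 85 / 18 * ((25 / 9 * r + 1) * A)"
    using 5 by (simp add: algebra_simps add_divide_distrib diff_divide_distrib)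
  moreover have "(r + 1 / real n) * V + 16 / 9 * r * V \<le> (25 / 9 * r + 1) * (5 / 2 * (A - P) + 5 / 3 * s2)"
    using 3 by (simp only: distrib_right)
  moreover have "g + (q + v) + (u - a + (b + v')) + (u' - c + d) \<le> (u - e) + (u' - e') + kd"
    if "g \<le> P'" "q \<le> q'" "v + v' \<le> v''" "ka \<le> kd" "P' + q' + v'' - a + b - c + d \<le> - e - e' + ka"
    for g q v u a b v' u' c d e e' kd P' q' v'' ka :: real
    using that by linarith
  ultimately have "(norm (gt (x k z)))\<^sup>2 + (r * shift_gap k z + (r + 1 / real n) * V)
      + (m1 * s1 - 16 / 9 * r * s1 + (16 / 9 * r * P + 16 / 9 * r * V))
      + (m2 * s2 - 20 / 9 * (25 / 9 * r + 1) * s2 + 20 / 9 * (25 / 9 * r + 1) * A)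
      \<le> (m1 * s1 - 4 / 9 * r * s1) + (m2 * s2 - 5 / 9 * (25 / 9 * r + 1) * s2)
        + 85 / 9 * L * (25 / 9 * r + 1) * subopt (x k z)"
    using 1 2 4 by blast
  then show ?thesis
    unfolding noise_bar_var_eq r_def[symmetric] A_def[symmetric] P_def[symmetric] V_def[symmetric] s1_def[symmetric] s2_def[symmetric]
      a b c d .
qed

definition lyapunov :: "nat \<Rightarrow> real" where
  "lyapunov k = virtual_mean k + \<gamma>\<^sup>2 * (m1 * sig1_mean k + m2 * sig2_mean k)"

lemma m_nonneg: "m1 \<ge> 0" "m2 \<ge> 0"
  using r \<alpha> p by auto

lemma virtual_mean_nonneg: "virtual_mean k \<ge> 0"
  by (simp add: virtual_mean_def)

lemma lyapunov_nonneg: "lyapunov k \<ge> 0"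
  unfolding lyapunov_def using m_nonneg means_nonneg virtual_mean_nonneg
  by (intro add_nonneg_nonneg mult_nonneg_nonneg) auto

lemma virtual_mean_step:
  "virtual_mean (Suc k) \<le> (1 - \<gamma> * \<mu> / 2) * virtual_mean k - \<gamma> * subopt_mean k + 3 * L * \<gamma> * error_mean k
     + \<gamma>\<^sup>2 * (\<integral>z. (norm (gbar k z))\<^sup>2 \<partial>M)"
proof -
  have vi: "integrable M (\<lambda>z. (norm (virtual k z))\<^sup>2)"
    using virtual_in_L2 by (simp add: in_L2_def)
  have ei: "integrable M (\<lambda>z. (norm (ebar k z))\<^sup>2)"
    using ebar_in_L2 by (simp add: in_L2_def)
  have gi: "integrable M (\<lambda>z. (norm (gbar k z))\<^sup>2)"
    using gbar_in_L2 by (simp add: in_L2_def)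
  have vgi: "integrable M (\<lambda>z. virtual k z \<bullet> gt (x k z))"
    by (intro in_L2_inner virtual_in_L2 gt_in_L2 x_in_L2)
  have ni: "integrable M (\<lambda>z. noise_bar k z \<bullet> virtual k z)"
    by (intro in_L2_inner virtual_in_L2 noise_bar_in_L2)
  have n0: "(\<integral>z. noise_bar k z \<bullet> virtual k z \<partial>M) = 0"
    by (intro noise_bar_orthogonal_mean virtual_measurable virtual_in_L2)
  have "virtual_mean (Suc k) = (\<integral>z. ((norm (virtual k z))\<^sup>2 - 2 * \<gamma> * (virtual k z \<bullet> gt (x k z)))
      - 2 * \<gamma> * (noise_bar k z \<bullet> virtual k z) + \<gamma>\<^sup>2 * (norm (gbar k z))\<^sup>2 \<partial>M)"
    unfolding virtual_mean_def
  proof (intro Bochner_Integration.integral_cong refl)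
    fix z assume z: "z \<in> space M"
    show "(norm (virtual (Suc k) z))\<^sup>2 = ((norm (virtual k z))\<^sup>2 - 2 * \<gamma> * (virtual k z \<bullet> gt (x k z)))
      - 2 * \<gamma> * (noise_bar k z \<bullet> virtual k z) + \<gamma>\<^sup>2 * (norm (gbar k z))\<^sup>2"
      unfolding virtual_Suc[OF z] noise_bar_def power2_norm_eq_inner
      by (simp add: inner_diff_left inner_diff_right inner_commute power2_eq_square algebra_simps)
  qed
  also have "\<dots> = (\<integral>z. (norm (virtual k z))\<^sup>2 - 2 * \<gamma> * (virtual k z \<bullet> gt (x k z)) \<partial>M)
      + \<gamma>\<^sup>2 * (\<integral>z. (norm (gbar k z))\<^sup>2 \<partial>M)"
    using vi gi vgi ni n0 by simp
  finally have 1: "virtual_mean (Suc k) = (\<integral>z. (norm (virtual k z))\<^sup>2 - 2 * \<gamma> * (virtual k z \<bullet> gt (x k z)) \<partial>M)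
      + \<gamma>\<^sup>2 * (\<integral>z. (norm (gbar k z))\<^sup>2 \<partial>M)" .
  have "(\<integral>z. (norm (virtual k z))\<^sup>2 - 2 * \<gamma> * (virtual k z \<bullet> gt (x k z)) \<partial>M)
      \<le> (\<integral>z. (1 - \<gamma> * \<mu> / 2) * (norm (virtual k z))\<^sup>2 - \<gamma> * subopt (x k z) + 3 * L * \<gamma> * (norm (ebar k z))\<^sup>2 \<partial>M)"
  proof (rule integral_mono[OF _ _ virtual_drift])
    show "integrable M (\<lambda>z. (norm (virtual k z))\<^sup>2 - 2 * \<gamma> * (virtual k z \<bullet> gt (x k z)))"
      using vi vgi by simp
    show "integrable M (\<lambda>z. (1 - \<gamma> * \<mu> / 2) * (norm (virtual k z))\<^sup>2 - \<gamma> * subopt (x k z) + 3 * L * \<gamma> * (norm (ebar k z))\<^sup>2)"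
      using vi ei subopt_integrable[of k] by simp
  qed
  also have "\<dots> = (1 - \<gamma> * \<mu> / 2) * virtual_mean k - \<gamma> * subopt_mean k + 3 * L * \<gamma> * error_mean k"
    using vi ei subopt_integrable[of k] by (simp add: virtual_mean_def subopt_mean_def error_mean_def)
  finally show ?thesis using 1 by linarith
qed

lemma second_order_mean:
  "(\<integral>z. (norm (gbar k z))\<^sup>2 \<partial>M) + (m1 * sig1_mean (Suc k) + m2 * sig2_mean (Suc k))
   \<le> m1 * (1 - \<alpha> / 4) * sig1_mean k + m2 * (1 - p / 4) * sig2_mean k
     + 85 / 9 * L * (25 / 9 * r + 1) * subopt_mean k"
proof -
  let ?a = "\<lambda>z. (norm (gt (x k z)))\<^sup>2 + noise_bar_var k z"
  let ?b = "\<lambda>z. (1 - \<alpha>) * sig1 k z + \<alpha> * (worker_gap (x k z) + mean_estimate_var k z)"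
  let ?c = "\<lambda>z. (1 - p) * sig2 k z + p * mean_gap (x k z)"
  have ints: "integrable M ?a" "integrable M ?b" "integrable M ?c"
    using gbar_second_moment[of k] sig1_step[of k] sig2_step[of k] by (auto simp: cond_le_def)
  note le = cond_le_expectation[OF \<F>_before_subalgebra]
  have lin: "(\<integral>z. A z + u * B z + v * C z \<partial>M) = (\<integral>z. A z \<partial>M) + (u * (\<integral>z. B z \<partial>M) + v * (\<integral>z. C z \<partial>M))"
    if "integrable M A" "integrable M B" "integrable M C" for A B C :: "'w \<Rightarrow> real" and u v
    using that by simp
  have "(\<integral>z. (norm (gbar k z))\<^sup>2 \<partial>M) + (m1 * sig1_mean (Suc k) + m2 * sig2_mean (Suc k))
      \<le> (\<integral>z. ?a z \<partial>M) + (m1 * (\<integral>z. ?b z \<partial>M) + m2 * (\<integral>z. ?c z \<partial>M))"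
    unfolding sig1_mean_def sig2_mean_def
    by (intro add_mono mult_left_mono m_nonneg le[OF gbar_second_moment] le[OF sig1_step] le[OF sig2_step])
  also have "\<dots> = (\<integral>z. ?a z + m1 * ?b z + m2 * ?c z \<partial>M)"
    by (rule lin[OF ints, symmetric])
  also have "\<dots> \<le> (\<integral>z. m1 * (1 - \<alpha> / 4) * sig1 k z + m2 * (1 - p / 4) * sig2 k z
     + 85 / 9 * L * (25 / 9 * r + 1) * subopt (x k z) \<partial>M)"
    by (intro integral_mono second_order_terms Bochner_Integration.integrable_add
        integrable_mult_right ints subopt_integrable sig1_integrable sig2_integrable)
  also have "\<dots> = m1 * (1 - \<alpha> / 4) * sig1_mean k + m2 * (1 - p / 4) * sig2_mean k
     + 85 / 9 * L * (25 / 9 * r + 1) * subopt_mean k"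
    unfolding sig1_mean_def sig2_mean_def subopt_mean_def
    by (simp only: Bochner_Integration.integral_add Bochner_Integration.integrable_add integrable_mult_right
        subopt_integrable sig1_integrable sig2_integrable integral_mult_right_zero)
  finally show ?thesis .
qed

text \<open>The first step size condition bounds the second order terms by \<open>21/50 * \<gamma> * subopt\<close>: the comparison
  of \<open>85/9 * (25/9 * r + 1)\<close> with \<open>84/25 * (37/9 + 8 * r)\<close> leaves less than three percent of room as \<open>r\<close> grows.\<close>

lemma lyapunov_step:
  "lyapunov (Suc k) \<le> (1 - \<eta>) * lyapunov k - (29 / 50 * \<gamma> * subopt_mean k - 3 * L * \<gamma> * error_mean k)"
proof -
  note nn = means_nonneg[of k]
  define c where "c = 85 / 9 * L * (25 / 9 * r + 1)"
  \<comment> \<open>21/50 is 84/25 times the 1/8 of \<open>step_linear\<close>.\<close>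
  have "\<gamma> * c = L * \<gamma> * (85 / 9 * (25 / 9 * r + 1))" by (simp add: c_def)
  also have "\<dots> \<le> L * \<gamma> * (84 / 25 * (37 / 9 + 8 * r))" using L \<gamma> r by (intro mult_left_mono) auto
  also have "\<dots> \<le> 21 / 50" using step_linear by linarith
  finally have "\<gamma> * (\<gamma> * c) \<le> \<gamma> * (21 / 50)" using \<gamma> by (intro mult_left_mono) auto
  then have c: "\<gamma>\<^sup>2 * (c * subopt_mean k) \<le> 21 / 50 * \<gamma> * subopt_mean k"
    using mult_right_mono[of "\<gamma> * (\<gamma> * c)" "\<gamma> * (21 / 50)" "subopt_mean k"] nn
    by (simp add: power2_eq_square mult_ac)
  have "\<gamma>\<^sup>2 * ((\<integral>z. (norm (gbar k z))\<^sup>2 \<partial>M) + (m1 * sig1_mean (Suc k) + m2 * sig2_mean (Suc k)))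
      \<le> \<gamma>\<^sup>2 * (m1 * (1 - \<alpha> / 4) * sig1_mean k + m2 * (1 - p / 4) * sig2_mean k + c * subopt_mean k)"
    unfolding c_def by (intro mult_left_mono second_order_mean) simp
  also have "\<dots> = \<gamma>\<^sup>2 * (m1 * ((1 - \<alpha> / 4) * sig1_mean k) + m2 * ((1 - p / 4) * sig2_mean k)) + \<gamma>\<^sup>2 * (c * subopt_mean k)"
    by (simp only: distrib_left mult.assoc)
  also have "\<dots> \<le> \<gamma>\<^sup>2 * (m1 * ((1 - \<eta>) * sig1_mean k) + m2 * ((1 - \<eta>) * sig2_mean k)) + 21 / 50 * \<gamma> * subopt_mean k"
    using \<eta>_bounds by (intro add_mono mult_left_mono mult_right_mono m_nonneg nn c) auto
  finally have 1: "\<gamma>\<^sup>2 * ((\<integral>z. (norm (gbar k z))\<^sup>2 \<partial>M) + (m1 * sig1_mean (Suc k) + m2 * sig2_mean (Suc k)))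
      \<le> (1 - \<eta>) * (\<gamma>\<^sup>2 * (m1 * sig1_mean k + m2 * sig2_mean k)) + 21 / 50 * \<gamma> * subopt_mean k"
    by (simp only: distrib_left mult.left_commute)
  have "(1 - \<gamma> * \<mu> / 2) * virtual_mean k \<le> (1 - \<eta>) * virtual_mean k"
    using \<eta>_bounds virtual_mean_nonneg by (intro mult_right_mono) auto
  then have 2: "virtual_mean (Suc k) \<le> (1 - \<eta>) * virtual_mean k - \<gamma> * subopt_mean k + 3 * L * \<gamma> * error_mean k
     + \<gamma>\<^sup>2 * (\<integral>z. (norm (gbar k z))\<^sup>2 \<partial>M)"
    using virtual_mean_step[of k] by linarith
  show ?thesis
    using 1 2 unfolding lyapunov_def distrib_left[of "1 - \<eta>"] distrib_left[of "\<gamma>\<^sup>2" "\<integral>z. (norm (gbar k z))\<^sup>2 \<partial>M"]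
    by linarith
qed

abbreviation "M1 \<equiv> 8 * \<omega> / (3 * real n * \<alpha>)"
abbreviation "M2 \<equiv> 8 * (7 + 6 * \<omega> / real n) / (9 * p)"

text \<open>After the accumulated error has taken 1/4 from the 29/50 there remains 33/100, which is 33/25 times
  the 1/4 of the claim.  This surplus pays for using the weights \<open>m1\<close> and \<open>m2\<close> instead of \<open>M1\<close> and \<open>M2\<close>.\<close>

lemma weighted_subopt:
  "\<gamma> / 4 * wsum subopt_mean K \<le> virtual_mean 0 + M1 * \<gamma>\<^sup>2 * sig1_mean 0 + M2 * \<gamma>\<^sup>2 * sig2_mean 0
     + \<gamma> * F1 * sig1_mean 0 + \<gamma> * F2 * sig2_mean 0"
proof -
  note nn = means_nonneg[of 0]
  define f1 where "f1 = F1"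
  define f2 where "f2 = F2"
  have M1: "M1 = 8 / 3 * r / \<alpha>" and M2: "M2 = 8 / 9 * (7 + 6 * r) / p" by (simp_all add: r_def)
  have 1: "wsum (\<lambda>k. 29 / 50 * \<gamma> * subopt_mean k - 3 * L * \<gamma> * error_mean k) K \<le> lyapunov 0"
    unfolding wsum_def by (intro weighted_telescope lyapunov_step lyapunov_nonneg \<eta>_bounds)
  have 2: "wsum (\<lambda>k. 29 / 50 * \<gamma> * subopt_mean k - 3 * L * \<gamma> * error_mean k) K
      = 29 / 50 * \<gamma> * wsum subopt_mean K - \<gamma> * (3 * L * wsum error_mean K)"
    using wsum_add[of "\<lambda>k. 29 / 50 * \<gamma> * subopt_mean k" "\<lambda>k. (- 3 * L * \<gamma>) * error_mean k" K]
    unfolding wsum_scale by (simp add: mult_ac)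
  have "\<gamma> * (3 * L * wsum error_mean K)
      \<le> \<gamma> * (1 / 4 * wsum subopt_mean K + f1 * sig1_mean 0 + f2 * sig2_mean 0)"
    unfolding f1_def f2_def using weighted_error \<gamma> by (intro mult_left_mono) auto
  also have "\<dots> = 1 / 4 * \<gamma> * wsum subopt_mean K + (\<gamma> * f1 * sig1_mean 0 + \<gamma> * f2 * sig2_mean 0)"
    by (simp add: algebra_simps)
  finally have "33 / 100 * \<gamma> * wsum subopt_mean K
      \<le> lyapunov 0 + (\<gamma> * f1 * sig1_mean 0 + \<gamma> * f2 * sig2_mean 0)"
    using 1 2 by simp
  also have "\<dots> \<le> 33 / 25 * (virtual_mean 0 + M1 * \<gamma>\<^sup>2 * sig1_mean 0 + M2 * \<gamma>\<^sup>2 * sig2_mean 0)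
      + 33 / 25 * (\<gamma> * f1 * sig1_mean 0 + \<gamma> * f2 * sig2_mean 0)"
  proof (intro add_mono)
    have absorb: "v + u \<le> 33 / 25 * (v + a + b)" if "v \<ge> 0" "u \<le> 33 / 25 * (a + b)" for a b u v :: real
      using that by simp
    have "m1 * sig1_mean 0 \<le> 33 / 25 * M1 * sig1_mean 0"
      unfolding M1 using nn r \<alpha> by (intro mult_right_mono) (auto simp: field_simps)
    moreover have "m2 * sig2_mean 0 \<le> 33 / 25 * M2 * sig2_mean 0"
    proof (intro mult_right_mono nn)
      have "20 / 9 * (25 / 9 * r + 1) / p \<le> 33 / 25 * (8 / 9 * (7 + 6 * r)) / p"
        using r p by (intro divide_right_mono) auto
      then show "m2 \<le> 33 / 25 * M2" unfolding M2 by simp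
    qed
    ultimately have "\<gamma>\<^sup>2 * (m1 * sig1_mean 0 + m2 * sig2_mean 0)
        \<le> \<gamma>\<^sup>2 * (33 / 25 * M1 * sig1_mean 0 + 33 / 25 * M2 * sig2_mean 0)"
      by (intro mult_left_mono) auto
    also have "\<dots> = 33 / 25 * (M1 * \<gamma>\<^sup>2 * sig1_mean 0 + M2 * \<gamma>\<^sup>2 * sig2_mean 0)"
      unfolding M1 M2 by (simp add: algebra_simps)
    finally show "lyapunov 0 \<le> 33 / 25 * (virtual_mean 0 + M1 * \<gamma>\<^sup>2 * sig1_mean 0 + M2 * \<gamma>\<^sup>2 * sig2_mean 0)"
      unfolding lyapunov_def by (rule absorb[OF virtual_mean_nonneg])
    have "f1 \<ge> 0" "f2 \<ge> 0" unfolding f1_def f2_def using L \<omega> \<alpha> p \<alpha>_less_1 by auto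
    then have "0 \<le> \<gamma> * f1 * sig1_mean 0 + \<gamma> * f2 * sig2_mean 0"
      using nn \<gamma> by (intro add_nonneg_nonneg mult_nonneg_nonneg) auto
    then show "\<gamma> * f1 * sig1_mean 0 + \<gamma> * f2 * sig2_mean 0
        \<le> 33 / 25 * (\<gamma> * f1 * sig1_mean 0 + \<gamma> * f2 * sig2_mean 0)"
      using absorb[of "\<gamma> * f1 * sig1_mean 0 + \<gamma> * f2 * sig2_mean 0" 0 0 0] by simp
  qed
  finally have "33 / 100 * \<gamma> * wsum subopt_mean K \<le> \<dots>" .
  moreover have "\<gamma> / 4 * u \<le> a + b + c" if "33 / 100 * \<gamma> * u \<le> 33 / 25 * a + 33 / 25 * (b + c)" for u a b c :: real
    using that by (simp add: algebra_simps add_divide_distrib)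
  ultimately show ?thesis unfolding f1_def f2_def by blast
qed

end

section \<open>Convergence of the weighted average\<close>

lemma convex_on_scaled_sum:
  fixes F :: "'i \<Rightarrow> 'a::real_vector \<Rightarrow> real"
  assumes "finite I" "\<And>i. i \<in> I \<Longrightarrow> convex_on UNIV (F i)" "v \<ge> 0"
  shows "convex_on UNIV (\<lambda>y. v * (\<Sum>i\<in>I. F i y))"
proof -
  have "convex_on UNIV (\<lambda>y. \<Sum>i\<in>I. F i y)"
    using assms(1,2) by (induction I rule: finite_induct) (auto simp: convex_on_const)
  then show ?thesis using assms(3) by (intro convex_on_cmul)
qed

context delayed_diana begin

lemma total_loss_convex: "convex_on UNIV (total_loss n m f)"
  unfolding total_loss_def[abs_def] worker_loss_def[abs_def]
  by (intro convex_on_scaled_sum convex) auto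

lemma total_weight_pos: "total_weight \<eta> K > 0"
  unfolding total_weight_def using weight_pos[OF \<eta>_bounds(5)] by (intro sum_pos) auto

lemma subopt_average_le:
  "subopt (weighted_average \<eta> y K) \<le> (\<Sum>k\<le>K. weight \<eta> k / total_weight \<eta> K * subopt (y k))"
proof -
  let ?a = "\<lambda>k. weight \<eta> k / total_weight \<eta> K"
  have one: "(\<Sum>k\<le>K. ?a k) = 1"
    using total_weight_pos[of K] by (simp add: sum_divide_distrib[symmetric] total_weight_def)
  have avg: "weighted_average \<eta> y K = (\<Sum>k\<le>K. ?a k *\<^sub>R y k)"
    by (simp add: weighted_average_def scaleR_sum_right)
  have "total_loss n m f (\<Sum>k\<le>K. ?a k *\<^sub>R y k) \<le> (\<Sum>k\<le>K. ?a k * total_loss n m f (y k))"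
    using one weight_pos[OF \<eta>_bounds(5)] total_weight_pos[of K]
    by (intro convex_on_sum[OF _ _ total_loss_convex]) (auto simp: less_imp_le)
  then have "total_loss n m f (weighted_average \<eta> y K) - 1 * total_loss n m f xs
      \<le> (\<Sum>k\<le>K. ?a k * total_loss n m f (y k)) - (\<Sum>k\<le>K. ?a k) * total_loss n m f xs"
    unfolding avg one by simp
  then show ?thesis
    unfolding subopt_def right_diff_distrib sum_subtractf sum_distrib_right by simp
qed

lemma
  shows subopt_average_integrable: "integrable M (\<lambda>z. subopt (weighted_average \<eta> (\<lambda>k. x k z) K))"
    and subopt_average_mean: "(\<integral>z. subopt (weighted_average \<eta> (\<lambda>k. x k z) K) \<partial>M)
      \<le> wsum subopt_mean K / total_weight \<eta> K"
proof -
  have bi: "integrable M (\<lambda>z. \<Sum>k\<le>K. weight \<eta> k / total_weight \<eta> K * subopt (x k z))"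
    by (intro Bochner_Integration.integrable_sum integrable_mult_right subopt_integrable)
  show int: "integrable M (\<lambda>z. subopt (weighted_average \<eta> (\<lambda>k. x k z) K))"
  proof (rule Bochner_Integration.integrable_bound[OF bi])
    have xM: "x k \<in> borel_measurable M" for k by (rule measurable_M[OF x_measurable])
    have "(\<lambda>z. weighted_average \<eta> (\<lambda>k. x k z) K) \<in> borel_measurable M"
      unfolding weighted_average_def by (intro borel_measurable_scaleR borel_measurable_sum xM) auto
    then show "(\<lambda>z. subopt (weighted_average \<eta> (\<lambda>k. x k z) K)) \<in> borel_measurable M"
      by measurable
    show "AE z in M. norm (subopt (weighted_average \<eta> (\<lambda>k. x k z) K))
        \<le> norm (\<Sum>k\<le>K. weight \<eta> k / total_weight \<eta> K * subopt (x k z))"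
      using subopt_nonneg subopt_average_le by (intro AE_I2) (auto intro: order_trans[OF _ abs_ge_self])
  qed
  have "(\<integral>z. subopt (weighted_average \<eta> (\<lambda>k. x k z) K) \<partial>M)
      \<le> (\<integral>z. (\<Sum>k\<le>K. weight \<eta> k / total_weight \<eta> K * subopt (x k z)) \<partial>M)"
    by (intro integral_mono int bi subopt_average_le)
  also have "\<dots> = (\<Sum>k\<le>K. weight \<eta> k / total_weight \<eta> K * subopt_mean k)"
    using subopt_integrable by (simp add: Bochner_Integration.integral_sum subopt_mean_def)
  also have "\<dots> = wsum subopt_mean K / total_weight \<eta> K"
    by (simp add: wsum_def sum_divide_distrib)
  finally show "(\<integral>z. subopt (weighted_average \<eta> (\<lambda>k. x k z) K) \<partial>M) \<le> wsum subopt_mean K / total_weight \<eta> K" .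
qed

lemma
  assumes "z \<in> space M"
  shows sig1_mean_0: "sig1_mean 0 = sig1 0 z" and sig2_mean_0: "sig2_mean 0 = sig2 0 z"
    and virtual_mean_0: "virtual_mean 0 = (norm (virtual 0 z))\<^sup>2"
proof -
  have const: "(\<integral>y. F y \<partial>M) = F z" if "\<And>y. y \<in> space M \<Longrightarrow> F y = F z" for F :: "'w \<Rightarrow> real"
  proof -
    have "(\<integral>y. F y \<partial>M) = (\<integral>y. F z \<partial>M)" using that by (rule Bochner_Integration.integral_cong[OF refl])
    then show ?thesis by (simp add: prob_space)
  qed
  show "sig1_mean 0 = sig1 0 z"
    unfolding sig1_mean_def by (rule const) (simp add: sig1_def h_0 assms)
  show "sig2_mean 0 = sig2 0 z"
    unfolding sig2_mean_def by (rule const) (simp add: sig2_def w_0 assms)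
  show "virtual_mean 0 = (norm (virtual 0 z))\<^sup>2"
    unfolding virtual_mean_def by (rule const) (simp add: virtual_def x_0 ebar_0 assms)
qed

abbreviation "initial_bound z \<equiv> (norm (virtual 0 z))\<^sup>2 + M1 * \<gamma>\<^sup>2 * sig1 0 z + M2 * \<gamma>\<^sup>2 * sig2 0 z
     + \<gamma> * F1 * sig1 0 z + \<gamma> * F2 * sig2 0 z"

lemma average_bound:
  assumes "z \<in> space M"
  shows "(\<integral>z. subopt (weighted_average \<eta> (\<lambda>k. x k z) K) \<partial>M) \<le> 4 * initial_bound z / \<gamma> / total_weight \<eta> K"
    and "initial_bound z \<ge> 0"
proof -
  have le: "\<gamma> / 4 * wsum subopt_mean K \<le> initial_bound z" for K
    using weighted_subopt[of K] unfolding sig1_mean_0[OF assms] sig2_mean_0[OF assms] virtual_mean_0[OF assms] .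
  have "0 \<le> \<gamma> / 4 * wsum subopt_mean 0" using \<gamma> wsum_nonneg means_nonneg by simp
  then show "initial_bound z \<ge> 0" using le[of 0] by (rule order_trans)
  have "wsum subopt_mean K \<le> 4 * initial_bound z / \<gamma>"
    using le[of K] \<gamma> by (simp only: pos_le_divide_eq) (simp only: mult.commute times_divide_eq_left times_divide_eq_right pos_divide_le_eq zero_less_numeral)
  then show "(\<integral>z. subopt (weighted_average \<eta> (\<lambda>k. x k z) K) \<partial>M) \<le> 4 * initial_bound z / \<gamma> / total_weight \<eta> K"
    using subopt_average_mean[of K] total_weight_pos[of K] by (meson divide_right_mono less_imp_le order_trans)
qed

text \<open>The last weight alone is at least \<open>(1 - \<eta>)\<close> to the power \<open>- K\<close>.\<close>

lemma linear_rate: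
  assumes "z \<in> space M"
  shows "(\<integral>z. subopt (weighted_average \<eta> (\<lambda>k. x k z) K) \<partial>M) \<le> (1 - \<eta>) ^ K * (4 * initial_bound z / \<gamma>)"
proof -
  have \<eta>0: "0 < 1 - \<eta>" "1 - \<eta> \<le> 1" using \<eta>_bounds by auto
  have "1 / (1 - \<eta>) ^ K \<le> weight \<eta> K"
    unfolding weight_def using \<eta>0 by (intro divide_left_mono power_decreasing) auto
  also have "\<dots> \<le> total_weight \<eta> K"
    unfolding total_weight_def using weight_pos[OF \<eta>_bounds(5)]
    by (intro member_le_sum) (auto simp: less_imp_le)
  finally have W: "1 / (1 - \<eta>) ^ K \<le> total_weight \<eta> K" .
  have nn: "0 \<le> 4 * initial_bound z / \<gamma>" using average_bound(2)[OF assms] \<gamma> by simp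
  have "4 * initial_bound z / \<gamma> / total_weight \<eta> K \<le> 4 * initial_bound z / \<gamma> / (1 / (1 - \<eta>) ^ K)"
    using W \<eta>0 total_weight_pos[of K] by (intro divide_left_mono nn mult_pos_pos) auto
  then show ?thesis using average_bound(1)[OF assms, of K] by (simp add: mult.commute)
qed

text \<open>For \<open>\<mu> = 0\<close> the rate \<open>\<eta>\<close> vanishes and all weights are 1.\<close>

lemma sublinear_rate:
  assumes "z \<in> space M" "\<mu> = 0" "K \<ge> 1"
  shows "(\<integral>z. subopt (weighted_average \<eta> (\<lambda>k. x k z) K) \<partial>M) \<le> 4 * initial_bound z / (\<gamma> * real K)"
proof -
  have "\<eta> = 0" unfolding \<eta>_def using assms(2) \<alpha> p by simp
  then have "total_weight \<eta> K = real K + 1" by (simp add: total_weight_def weight_def)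
  then have W: "real K \<le> total_weight \<eta> K" by simp
  have nn: "0 \<le> 4 * initial_bound z / \<gamma>" using average_bound(2)[OF assms(1)] \<gamma> by simp
  have "4 * initial_bound z / \<gamma> / total_weight \<eta> K \<le> 4 * initial_bound z / \<gamma> / real K"
    using W assms(3) total_weight_pos[of K] by (intro divide_left_mono nn mult_pos_pos) auto
  then show ?thesis using average_bound(1)[OF assms(1), of K] by simp
qed

lemma parametric_estimates:
  "parametric_assumption M (past M N n l s c x) (total_loss n m f) xs L \<mu> \<gamma>
      x (\<lambda>k z. gbar k z) (\<lambda>k z. ebar k z) sig1 sig2
      \<lparr> par_A = 2 * L * (1 + 2 * \<omega> / real n),
        par_B1 = 2 * \<omega> / real n,
        par_B2 = 2 * (1 + 2 * \<omega> / real n),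
        par_D1 = 0,
        par_rho1 = \<alpha>,
        par_C1 = 3 * L * \<alpha>,
        par_G = 2,
        par_D2 = 0,
        par_rho2 = p,
        par_C2 = L * p,
        par_F1 = F1,
        par_F2 = F2,
        par_D3 = 0 \<rparr>"
proof -
  have gI: "integrable M (gbar k)" "integrable M (\<lambda>z. (norm (gbar k z))\<^sup>2)" for k
    using gbar_in_L2[of k] in_L2_integrable by (auto simp: in_L2_def)
  have err: "3 * L * (\<Sum>k\<le>K. weight (rate \<gamma> \<mu> \<alpha> p) k * (\<integral>y. (norm (ebar k y))\<^sup>2 \<partial>M))
        \<le> 1 / 4 * (\<Sum>k\<le>K. weight (rate \<gamma> \<mu> \<alpha> p) k * (\<integral>y. total_loss n m f (x k y) - total_loss n m f xs \<partial>M))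
            + F1 * sig1 0 z + F2 * sig2 0 z" if "z \<in> space M" for K z
  proof -
    have "rate \<gamma> \<mu> \<alpha> p = \<eta>" by (simp add: rate_def \<eta>_def)
    then show ?thesis
      using weighted_error[of K]
      unfolding sig1_mean_0[OF that] sig2_mean_0[OF that] wsum_def error_mean_def subopt_mean_def subopt_def by simp
  qed
  have "\<forall>k. AE z in M. real_cond_exp M (\<P> k) (\<lambda>z. (norm (gbar k z))\<^sup>2) z
      \<le> 2 * (2 * L * (1 + 2 * \<omega> / real n)) * subopt (x k z) + 2 * \<omega> / real n * sig1 k z
      + 2 * (1 + 2 * \<omega> / real n) * sig2 k z + 0"
    "\<forall>k. AE z in M. real_cond_exp M (\<P> k) (sig1 (Suc k)) z
      \<le> (1 - \<alpha>) * sig1 k z + 2 * (3 * L * \<alpha>) * subopt (x k z) + 2 * \<alpha> * sig2 k z + 0"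
    "\<forall>k. AE z in M. real_cond_exp M (\<P> k) (sig2 (Suc k)) z
      \<le> (1 - p) * sig2 k z + 2 * (L * p) * subopt (x k z)"
    using gbar_bound sig1_bound sig2_bound by (simp_all add: cond_le_def)
  moreover have "\<forall>k. AE z in M. vector_cond_exp M (\<P> k) (gbar k) z = gt (x k z)"
    using gbar_cond_exp by blast
  moreover have "\<forall>k. integrable M (\<lambda>z. subopt (x k z)) \<and> integrable M (gbar k) \<and> integrable M (\<lambda>z. (norm (gbar k z))\<^sup>2) \<and>
      integrable M (sig1 k) \<and> integrable M (sig2 k) \<and> integrable M (\<lambda>z. (norm (ebar k z))\<^sup>2)"
    using subopt_integrable gI sig1_integrable sig2_integrable ebar_in_L2
    by (simp add: in_L2_def)
  ultimately show ?thesis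
    unfolding parametric_assumption_def past_eq Let_def parameters.simps subopt_def
    using err by (intro conjI) auto
qed

end

theorem theoremK9:
  fixes f :: "nat \<Rightarrow> nat \<Rightarrow> 'a::euclidean_space \<Rightarrow> real"
    and M :: "'w measure" and N :: "'s measure"
    and Q :: "'s \<Rightarrow> 'a \<Rightarrow> 'a"
    and n m \<tau> :: nat
    and L \<mu> \<omega> p \<alpha> \<gamma> \<eta> M1 M2 F1 F2 :: real
    and l :: "nat \<Rightarrow> nat \<Rightarrow> 'w \<Rightarrow> nat" and s :: "nat \<Rightarrow> nat \<Rightarrow> 'w \<Rightarrow> 's"
    and c :: "nat \<Rightarrow> nat \<Rightarrow> 'w \<Rightarrow> bool"
    and xs x0 :: 'a and h0 w0 :: "nat \<Rightarrow> 'a"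
    and x gbar ebar :: "nat \<Rightarrow> 'w \<Rightarrow> 'a"
    and g h w e :: "nat \<Rightarrow> nat \<Rightarrow> 'w \<Rightarrow> 'a"
    and s1 s2 T :: "nat \<Rightarrow> 'w \<Rightarrow> real"
  assumes "n \<ge> 1" and "m \<ge> 1" and "L > 0" and "\<mu> \<ge> 0" and "\<omega> > 0"
    and "\<And>i j. i < n \<Longrightarrow> j < m \<Longrightarrow> convex_on UNIV (f i j)"
    and "\<And>i j. i < n \<Longrightarrow> j < m \<Longrightarrow> smooth L (f i j)"
    and "quasi_strongly_convex \<mu> (total_loss n m f) xs"
    and "quantizer N \<omega> Q"
    and "\<tau> \<ge> 1" and "0 < p" and "p < 1" and "0 < \<alpha>" and "\<alpha> \<le> 1 / (\<omega> + 1)"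
    and "0 < \<gamma>"
    and "\<gamma> \<le> min (1 / (8 * L * (37 / 9 + 24 * \<omega> / (3 * real n))))
      (1 / (8 * L * sqrt (real \<tau> * (2 + real \<tau> + 4 / (1 - p)
         + 4 * \<omega> / real n * (1 + 3 / (1 - \<alpha>) + 2 / (1 - p) + 4 / ((1 - \<alpha>) * (1 - p)))))))"
    and "prob_space M" and "fresh_draws M N n m p l s c"
    and "\<And>z. z \<in> space M \<Longrightarrow>
      delayed_framework n \<gamma> \<tau> x0 (\<lambda>k. x k z) (\<lambda>k i. g k i z) (\<lambda>k i. e k i z)"
    and "\<And>z. z \<in> space M \<Longrightarrow>
      lsvrg_diana n m f Q \<alpha> h0 w0 (\<lambda>k i. l k i z) (\<lambda>k i. s k i z) (\<lambda>k i. c k i z)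
        (\<lambda>k. x k z) (\<lambda>k i. h k i z) (\<lambda>k i. w k i z) (\<lambda>k i. g k i z)"
    and "\<And>k z. gbar k z = worker_mean n (\<lambda>i. g k i z)"
    and "\<And>k z. ebar k z = worker_mean n (\<lambda>i. e k i z)"
    and "\<And>k z. s1 k z =
      1 / real n * (\<Sum>i<n. (norm (h k i z - grad (worker_loss m f i) xs))\<^sup>2)"
    and "\<And>k z. s2 k z =
      1 / (real n * real m) *
        (\<Sum>i<n. \<Sum>j<m. (norm (grad (f i j) (w k i z) - grad (f i j) xs))\<^sup>2)"
    and "F1 = 12 * \<gamma>\<^sup>2 * L * \<omega> * real \<tau> * (2 + \<alpha>) / (real n * \<alpha>)"
    and "F2 = 12 * \<gamma>\<^sup>2 * real \<tau> * L * (2 + p) / p *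
      (4 * \<omega> / (real n * (1 - \<alpha>)) + 1 + 2 * \<omega> / real n)"
    and "M1 = 8 * \<omega> / (3 * real n * \<alpha>)"
    and "M2 = 8 * (7 + 6 * \<omega> / real n) / (9 * p)"
    and "\<And>k z. T k z =
      (norm ((x k z - ebar k z) - xs))\<^sup>2 + M1 * \<gamma>\<^sup>2 * s1 k z + M2 * \<gamma>\<^sup>2 * s2 k z"
    and "\<eta> = min (\<gamma> * \<mu> / 2) (min (\<alpha> / 4) (p / 4))"
  shows "parametric_assumption M (past M N n l s c x) (total_loss n m f) xs L \<mu> \<gamma>
      x gbar ebar s1 s2
      \<lparr> par_A = 2 * L * (1 + 2 * \<omega> / real n),
        par_B1 = 2 * \<omega> / real n,
        par_B2 = 2 * (1 + 2 * \<omega> / real n),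
        par_D1 = 0,
        par_rho1 = \<alpha>,
        par_C1 = 3 * L * \<alpha>,
        par_G = 2,
        par_D2 = 0,
        par_rho2 = p,
        par_C2 = L * p,
        par_F1 = F1,
        par_F2 = F2,
        par_D3 = 0 \<rparr> \<and>
    (\<forall>K. integrable M
      (\<lambda>z. total_loss n m f (weighted_average \<eta> (\<lambda>k. x k z) K) - total_loss n m f xs)) \<and>
    (\<mu> > 0 \<longrightarrow> (\<forall>K. \<forall>z0\<in>space M.
      (\<integral>z. total_loss n m f (weighted_average \<eta> (\<lambda>k. x k z) K) - total_loss n m f xs \<partial>M)
        \<le> (1 - \<eta>) ^ K * (4 * (T 0 z0 + \<gamma> * F1 * s1 0 z0 + \<gamma> * F2 * s2 0 z0) / \<gamma>))) \<and>
    (\<mu> = 0 \<longrightarrow> (\<forall>K\<ge>1. \<forall>z0\<in>space M.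
      (\<integral>z. total_loss n m f (weighted_average \<eta> (\<lambda>k. x k z) K) - total_loss n m f xs \<partial>M)
        \<le> 4 * (T 0 z0 + \<gamma> * F1 * s1 0 z0 + \<gamma> * F2 * s2 0 z0) / (\<gamma> * real K)))"
proof -
  interpret delayed_diana M f N Q n m \<tau> L \<mu> \<omega> p \<alpha> \<gamma> l s c xs x0 h0 w0 x g h w e
    unfolding delayed_diana_def delayed_diana_axioms_def using assms(1-20) by blast
  have s1: "s1 = sig1" using assms(23) by (auto simp: fun_eq_iff sig1_def)
  have s2: "s2 = sig2"
    using assms(24) by (auto simp: fun_eq_iff sig2_def gap_def sum_distrib_left[symmetric] sum_divide_distrib[symmetric])
  have gb: "gbar = (\<lambda>k z. worker_mean n (\<lambda>i. g k i z))" using assms(21) by (auto simp: fun_eq_iff)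
  have eb: "ebar = (\<lambda>k z. worker_mean n (\<lambda>i. e k i z))" using assms(22) by (auto simp: fun_eq_iff)
  have \<eta>': "\<eta> = delayed_diana.\<eta> \<mu> p \<alpha> \<gamma>" using assms(30) by (simp add: \<eta>_def)
  have T: "T 0 z + \<gamma> * F1 * sig1 0 z + \<gamma> * F2 * sig2 0 z = initial_bound z" for z
    using assms(25-29) by (simp add: s1 s2 virtual_def eb)
  show ?thesis
    unfolding \<eta>' gb eb s1 s2 T
    unfolding assms(25,26)
    using parametric_estimates subopt_average_integrable linear_rate sublinear_rate
    unfolding subopt_def by (intro conjI) auto
qed

end
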